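(* Let $\mathcal C$ be a small category and let $F=(\mathcal G_x,\mathcal X_g,\mu_{g,h})$ be a $\mathcal C$-shaped diagram of groupoid correspondences. Let $\Omega$ be a universal $F$-action. Equip $\Omega$ with the action of the inverse semigroup $\mathcal I(F)$ induced by the $F$-action. Then the transformation groupoid $\mathcal I(F)\ltimes\Omega$ is a groupoid model for $F$.
   Context: Groupoids. All groupoids are topological groupoids $\mathcal G$ (object space $\mathcal G^0\subseteq\mathcal G$, continuous range, source, multiplication, inversion; $gh$ is defined iff $s(g)=r(h)$) that are étale: $r,s$ are local homeomorphisms. No Hausdorff or local compactness assumption is made. A right $\mathcal G$-space is a space $\mathcal X$ with a continuous anchor map $s\colon\mathcal X\to\mathcal G^0$ and a continuous map $\{(x,g): s(x)=r(g)\}\to\mathcal X$, $(x,g)\mapsto xg$, with $s(xg)=s(g)$, $(xg_1)g_2=x(g_1g_2)$, $x\,s(x)=x$; left $\mathcal G$-spaces are analogous with anchor map $r$. $\mathcal X/\mathcal G$ is the orbit space with the quotient topology. A right $\mathcal G$-space is basic if $\{(x,g):s(x)=r(g)\}\to\mathcal X\times\mathcal X$, $(x,g)\mapsto(xg,x)$, is a homeomorphism onto its image. A groupoid correspondence $\mathcal X\colon\mathcal H\leftarrow\mathcal G$ is a space with commuting actions of $\mathcal H$ on the left (anchor $r$) and $\mathcal G$ on the right (anchor $s$) such that $s\colon\mathcal X\to\mathcal G^0$ is a local homeomorphism and the right action is basic. (Commuting: $s(hx)=s(x)$, $r(xg)=r(x)$, $(hx)g=h(xg)$.) For a right $\mathcal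 G$-space $\mathcal X$ and a left $\mathcal G$-space $\mathcal Y$, $\mathcal X\circ_{\mathcal G}\mathcal Y$ is the orbit space of $\{(x,y):s(x)=r(y)\}$ under $g\cdot(x,y)=(xg^{-1},gy)$; the class of $(x,y)$ is $[x,y]$. For correspondences this is the composite correspondence, with the induced outer actions. Isomorphisms of correspondences are biequivariant homeomorphisms. Diagrams. $\mathcal C$ also denotes the set of arrows, objects $\mathcal C^0$ are identified with identity arrows, $g\colon x\leftarrow y$ means $r(g)=x$, $s(g)=y$. A $\mathcal C$-shaped diagram $F=(\mathcal G_x,\mathcal X_g,\mu_{g,h})$ consists of groupoids $\mathcal G_x$ ($x\in\mathcal C^0$), correspondences $\mathcal X_g\colon\mathcal G_{r(g)}\leftarrow\mathcal G_{s(g)}$ ($g\in\mathcal C$) and isomorphisms of correspondences $\mu_{g,h}\colon\mathcal X_g\circ_{\mathcal G_{s(g)}}\mathcal X_h\to\mathcal X_{gh}$ for composable $g,h$, written $\gamma\cdot\eta=\mu_{g,h}[\gamma,\eta]$, such that $\mathcal X_x=\mathcal G_x$ with left and right multiplication for identity arrows $x$, $\mu_{r(g),g}$ and $\mu_{g,s(g)}$ are given by the left and right actions, and the product $\cdot$ is associative. $F$-actions. An $F$-action on a space $Y$ consists of a partition $Y=\bigsqcup_{x\in\mathcal C^0}Y_x$ into clopen subsets, continuous maps $r\colon Y_x\to\mathcal G_x^0$, and open, continuous, surjective maps $\{(\gamma,y)\in\mathcal X_g\times Y_{s(g)}: s(\gamma)=r(y)\}\to Y_{r(g)}$, $(\gamma,y)\mapsto\gamma\cdot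 y$, for all $g\in\mathcal C$, such that (i) $r(\gamma_2\cdot y)=r(\gamma_2)$ and $\gamma_1\cdot(\gamma_2\cdot y)=(\gamma_1\cdot\gamma_2)\cdot y$ for composable $g_1,g_2$, $\gamma_i\in\mathcal X_{g_i}$, $y\in Y_{s(g_2)}$ with $s(\gamma_1)=r(\gamma_2)$, $s(\gamma_2)=r(y)$; (ii) if $\gamma\cdot y=\gamma'\cdot y'$ with $\gamma,\gamma'\in\mathcal X_g$, $y,y'\in Y_{s(g)}$, then there is $\eta\in\mathcal G_{s(g)}$ with $\gamma'=\gamma\eta$ and $y=\eta y'$. A continuous map $\varphi\colon Y\to Y'$ between $F$-actions is $F$-equivariant if $\varphi(Y_x)\subseteq Y'_x$, $r(\varphi(y))=r(y)$ and $\varphi(\gamma\cdot y)=\gamma\cdot\varphi(y)$ whenever defined. An $F$-action $\Omega$ is universal if every $F$-action $Y$ admits a unique $F$-equivariant continuous map $Y\to\Omega$. A groupoid model for $F$ is an étale groupoid $\mathcal U$ with natural bijections, for all spaces $Y$, between left $\mathcal U$-actions and $F$-actions on $Y$; naturality means that a continuous map $Y\to Y'$ is $\mathcal U$-equivariant iff it is $F$-equivariant. The inverse semigroup $\mathcal I(F)$. For $\xi_1,\xi_2$ in a correspondence $\mathcal X\colon \mathcal H\leftarrow\mathcal G$ with the same class in $\mathcal X/\mathcal G$, $\langle\xi_1|\xi_2\rangle$ is the unique $\gamma\in\mathcal G$ with $\xi_2=\xi_1\gamma$. A slice of $\mathcal X$ is an open subset on which both $s$ and the projection $\mathcal X\to\mathcal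 X/\mathcal G$ are injective. $\mathrm{Bis}(\mathcal X_g)$ is the set of slices of $\mathcal X_g$; $\mathrm{Bis}(F)$ is the disjoint union of all $\mathrm{Bis}(\mathcal X_g)$, $g\in\mathcal C$, with all empty slices identified. For $U\in\mathrm{Bis}(\mathcal X_g)$, $V\in\mathrm{Bis}(\mathcal X_h)$, let $UV=\{\gamma\cdot\eta:\gamma\in U,\eta\in V,s(\gamma)=r(\eta)\}\in\mathrm{Bis}(\mathcal X_{gh})$ if $g,h$ are composable and $UV=\emptyset$ otherwise. For $U_1,U_2\in\mathrm{Bis}(\mathcal X_g)$, $\langle U_1|U_2\rangle=\{\langle x|y\rangle:x\in U_1,y\in U_2,[x]=[y]\text{ in }\mathcal X_g/\mathcal G_{s(g)}\}\in\mathrm{Bis}(\mathcal G_{s(g)})$. $\mathcal I(F)$ is the universal inverse semigroup generated by symbols $\Theta(U)$, $U\in\mathrm{Bis}(F)$, with relations $\Theta(UV)=\Theta(U)\Theta(V)$ for all $U,V\in\mathrm{Bis}(F)$ and $\Theta(U_1)^*\Theta(U_2)=\Theta(\langle U_1|U_2\rangle)$ for all $g\in\mathcal C$, $U_1,U_2\in\mathrm{Bis}(\mathcal X_g)$. An action of an inverse semigroup $S$ on a space $Y$ is a homomorphism $\vartheta\colon S\to I(Y)$, where $I(Y)$ is the inverse semigroup of homeomorphisms between open subsets of $Y$. An $F$-action on $Y$ induces an action $\vartheta$ of $\mathcal I(F)$ on $Y$: for $U\in\mathrm{Bis}(\mathcal X_g)$, $\vartheta(\Theta(U))$ has domain $\{y\in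 Y_{s(g)}:r(y)\in s(U)\}$ and maps $y$ to $\gamma\cdot y$ for the unique $\gamma\in U$ with $s(\gamma)=r(y)$. Transformation groupoid. $S\ltimes Y$ has object space $Y$ and arrows the classes $[t,y]$ of pairs with $t\in S$, $y\in\mathrm{dom}(\vartheta_t)$, where $(t,y)\sim(u,y')$ iff $y=y'$ and there is an idempotent $e\in S$ with $y\in\mathrm{dom}(\vartheta_e)$ and $te=ue$; $s[t,y]=y$, $r[t,y]=\vartheta_t(y)$, $[u,\vartheta_t(y)]\cdot[t,y]=[ut,y]$; the sets $\{[t,y]:y\in W\}$ for $t\in S$ and $W\subseteq\mathrm{dom}(\vartheta_t)$ open form a basis of its (étale) topology. *)

theory Defs
  imports "HOL-Analysis.Analysis"
begin

(* Spaces are values of type 'a topology, so the points of a space form a subset of a type.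
   The values of a structure map at arguments outside its domain are irrelevant, except for
   the groupoid actions and diagram actions that are counted by the bijections in the
   definition of a groupoid model: these are required to be extensional. *)

definition fibre_product ::
  "'a topology \<Rightarrow> 'b topology \<Rightarrow> ('a \<Rightarrow> 'c) \<Rightarrow> ('b \<Rightarrow> 'c) \<Rightarrow> ('a \<times> 'b) topology" where
  "fibre_product X Y f g = subtopology (prod_topology X Y) {(x, y). f x = g y}"

definition local_homeomorphism :: "'a topology \<Rightarrow> 'b topology \<Rightarrow> ('a \<Rightarrow> 'b) \<Rightarrow> bool" where
  "local_homeomorphism X Y f \<longleftrightarrow>
     (\<forall>x\<in>topspace X. \<exists>U. openin X U \<and> x \<in> U \<and> openin Y (f ` U) \<and>
        homeomorphic_map (subtopology X U) (subtopology Y (f ` U)) f)"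

definition quotient_topology :: "'a topology \<Rightarrow> ('a \<Rightarrow> 'b) \<Rightarrow> 'b topology" where
  "quotient_topology X q =
     topology (\<lambda>U. U \<subseteq> q ` topspace X \<and> openin X {x \<in> topspace X. q x \<in> U})"

lemma openin_quotient_topology:
  "openin (quotient_topology X q) U \<longleftrightarrow>
     U \<subseteq> q ` topspace X \<and> openin X {x \<in> topspace X. q x \<in> U}"
proof -
  have "istopology (\<lambda>U. U \<subseteq> q ` topspace X \<and> openin X {x \<in> topspace X. q x \<in> U})"
    unfolding istopology_def
  proof (intro conjI allI impI, goal_cases)
    case (2 S T)
    have "{x \<in> topspace X. q x \<in> S \<inter> T} =
        {x \<in> topspace X. q x \<in> S} \<inter> {x \<in> topspace X. q x \<in> T}"
      by auto
    then show ?case using 2 by auto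
  next
    case (4 \<K>)
    have "{x \<in> topspace X. q x \<in> \<Union>\<K>} = (\<Union>K\<in>\<K>. {x \<in> topspace X. q x \<in> K})"
      by auto
    then show ?case using 4 by auto
  qed auto
  then show ?thesis
    unfolding quotient_topology_def by (simp add: topology_inverse')
qed

(* The object space is a space of its own, embedded into the arrow space by g_unit. *)

record ('o, 'a) groupoid =
  g_obj :: "'o topology"
  g_arr :: "'a topology"
  g_rng :: "'a \<Rightarrow> 'o"
  g_src :: "'a \<Rightarrow> 'o"
  g_unit :: "'o \<Rightarrow> 'a"
  g_mult :: "'a \<Rightarrow> 'a \<Rightarrow> 'a"
  g_inv :: "'a \<Rightarrow> 'a"

definition topological_groupoid :: "('o, 'a) groupoid \<Rightarrow> bool" where
  "topological_groupoid G \<longleftrightarrow>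
     continuous_map (g_arr G) (g_obj G) (g_rng G) \<and>
     continuous_map (g_arr G) (g_obj G) (g_src G) \<and>
     embedding_map (g_obj G) (g_arr G) (g_unit G) \<and>
     continuous_map (fibre_product (g_arr G) (g_arr G) (g_src G) (g_rng G)) (g_arr G)
       (\<lambda>(g, h). g_mult G g h) \<and>
     continuous_map (g_arr G) (g_arr G) (g_inv G) \<and>
     (\<forall>x\<in>topspace (g_obj G). g_rng G (g_unit G x) = x \<and> g_src G (g_unit G x) = x) \<and>
     (\<forall>g\<in>topspace (g_arr G). \<forall>h\<in>topspace (g_arr G). g_src G g = g_rng G h \<longrightarrow>
        g_rng G (g_mult G g h) = g_rng G g \<and> g_src G (g_mult G g h) = g_src G h) \<and>
     (\<forall>g\<in>topspace (g_arr G). \<forall>h\<in>topspace (g_arr G). \<forall>k\<in>topspace (g_arr G).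
        g_src G g = g_rng G h \<longrightarrow> g_src G h = g_rng G k \<longrightarrow>
        g_mult G (g_mult G g h) k = g_mult G g (g_mult G h k)) \<and>
     (\<forall>g\<in>topspace (g_arr G).
        g_mult G (g_unit G (g_rng G g)) g = g \<and> g_mult G g (g_unit G (g_src G g)) = g) \<and>
     (\<forall>g\<in>topspace (g_arr G).
        g_rng G (g_inv G g) = g_src G g \<and> g_src G (g_inv G g) = g_rng G g \<and>
        g_mult G g (g_inv G g) = g_unit G (g_rng G g) \<and>
        g_mult G (g_inv G g) g = g_unit G (g_src G g))"

definition etale_groupoid :: "('o, 'a) groupoid \<Rightarrow> bool" where
  "etale_groupoid G \<longleftrightarrow> topological_groupoid G \<and>
     local_homeomorphism (g_arr G) (g_obj G) (g_rng G) \<and>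
     local_homeomorphism (g_arr G) (g_obj G) (g_src G)"

definition left_space ::
  "('o, 'a) groupoid \<Rightarrow> 'x topology \<Rightarrow> ('x \<Rightarrow> 'o) \<Rightarrow> ('a \<Rightarrow> 'x \<Rightarrow> 'x) \<Rightarrow> bool" where
  "left_space G X r act \<longleftrightarrow>
     continuous_map X (g_obj G) r \<and>
     continuous_map (fibre_product (g_arr G) X (g_src G) r) X (\<lambda>(g, x). act g x) \<and>
     (\<forall>g\<in>topspace (g_arr G). \<forall>x\<in>topspace X. g_src G g = r x \<longrightarrow> r (act g x) = g_rng G g) \<and>
     (\<forall>g\<in>topspace (g_arr G). \<forall>h\<in>topspace (g_arr G). \<forall>x\<in>topspace X.
        g_src G g = g_rng G h \<longrightarrow> g_src G h = r x \<longrightarrow>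
        act g (act h x) = act (g_mult G g h) x) \<and>
     (\<forall>x\<in>topspace X. act (g_unit G (r x)) x = x)"

definition right_space ::
  "('o, 'a) groupoid \<Rightarrow> 'x topology \<Rightarrow> ('x \<Rightarrow> 'o) \<Rightarrow> ('x \<Rightarrow> 'a \<Rightarrow> 'x) \<Rightarrow> bool" where
  "right_space G X s act \<longleftrightarrow>
     continuous_map X (g_obj G) s \<and>
     continuous_map (fibre_product X (g_arr G) s (g_rng G)) X (\<lambda>(x, g). act x g) \<and>
     (\<forall>x\<in>topspace X. \<forall>g\<in>topspace (g_arr G). s x = g_rng G g \<longrightarrow> s (act x g) = g_src G g) \<and>
     (\<forall>x\<in>topspace X. \<forall>g\<in>topspace (g_arr G). \<forall>h\<in>topspace (g_arr G).
        s x = g_rng G g \<longrightarrow> g_src G g = g_rng G h \<longrightarrow>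
        act (act x g) h = act x (g_mult G g h)) \<and>
     (\<forall>x\<in>topspace X. act x (g_unit G (s x)) = x)"

definition basic_right_space ::
  "('o, 'a) groupoid \<Rightarrow> 'x topology \<Rightarrow> ('x \<Rightarrow> 'o) \<Rightarrow> ('x \<Rightarrow> 'a \<Rightarrow> 'x) \<Rightarrow> bool" where
  "basic_right_space G X s act \<longleftrightarrow> right_space G X s act \<and>
     embedding_map (fibre_product X (g_arr G) s (g_rng G)) (prod_topology X X)
       (\<lambda>(x, g). (act x g, x))"

record ('o, 'a, 'x) correspondence =
  k_space :: "'x topology"
  k_rng :: "'x \<Rightarrow> 'o"
  k_src :: "'x \<Rightarrow> 'o"
  k_lact :: "'a \<Rightarrow> 'x \<Rightarrow> 'x"
  k_ract :: "'x \<Rightarrow> 'a \<Rightarrow> 'x"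

definition groupoid_correspondence ::
  "('o, 'a) groupoid \<Rightarrow> ('o, 'a) groupoid \<Rightarrow> ('o, 'a, 'x) correspondence \<Rightarrow> bool" where
  "groupoid_correspondence H G X \<longleftrightarrow>
     etale_groupoid H \<and> etale_groupoid G \<and>
     left_space H (k_space X) (k_rng X) (k_lact X) \<and>
     basic_right_space G (k_space X) (k_src X) (k_ract X) \<and>
     local_homeomorphism (k_space X) (g_obj G) (k_src X) \<and>
     (\<forall>h\<in>topspace (g_arr H). \<forall>x\<in>topspace (k_space X). g_src H h = k_rng X x \<longrightarrow>
        k_src X (k_lact X h x) = k_src X x) \<and>
     (\<forall>x\<in>topspace (k_space X). \<forall>g\<in>topspace (g_arr G). k_src X x = g_rng G g \<longrightarrow>
        k_rng X (k_ract X x g) = k_rng X x) \<and>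
     (\<forall>h\<in>topspace (g_arr H). \<forall>x\<in>topspace (k_space X). \<forall>g\<in>topspace (g_arr G).
        g_src H h = k_rng X x \<longrightarrow> k_src X x = g_rng G g \<longrightarrow>
        k_ract X (k_lact X h x) g = k_lact X h (k_ract X x g))"

definition composite_class ::
  "('o, 'a) groupoid \<Rightarrow> ('o, 'a, 'x) correspondence \<Rightarrow> ('o, 'a, 'y) correspondence
     \<Rightarrow> 'x \<times> 'y \<Rightarrow> ('x \<times> 'y) set" where
  "composite_class G X Y = (\<lambda>(x, y).
     {(k_ract X x (g_inv G g), k_lact Y g y) | g. g \<in> topspace (g_arr G) \<and> g_src G g = k_rng Y y})"

(* The outer actions are h [x,y] = [h x, y] and [x,y] g = [x, y g]; the image of an orbit under
   (x,y) |-> (h x, y) or (x,y) |-> (x, y g) is again an orbit because the actions commute. *)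

definition composite ::
  "('o, 'a) groupoid \<Rightarrow> ('o, 'a, 'x) correspondence \<Rightarrow> ('o, 'a, 'y) correspondence
     \<Rightarrow> ('o, 'a, ('x \<times> 'y) set) correspondence" where
  "composite G X Y =
     \<lparr>k_space = quotient_topology (fibre_product (k_space X) (k_space Y) (k_src X) (k_rng Y))
        (composite_class G X Y),
      k_rng = (\<lambda>c. k_rng X (fst (SOME p. p \<in> c))),
      k_src = (\<lambda>c. k_src Y (snd (SOME p. p \<in> c))),
      k_lact = (\<lambda>h c. (\<lambda>(x, y). (k_lact X h x, y)) ` c),
      k_ract = (\<lambda>c g. (\<lambda>(x, y). (x, k_ract Y y g)) ` c)\<rparr>"

definition correspondence_iso ::
  "('o, 'a) groupoid \<Rightarrow> ('o, 'a) groupoid \<Rightarrow> ('o, 'a, 'x) correspondence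
     \<Rightarrow> ('o, 'a, 'y) correspondence \<Rightarrow> ('x \<Rightarrow> 'y) \<Rightarrow> bool" where
  "correspondence_iso H G X Y \<phi> \<longleftrightarrow>
     homeomorphic_map (k_space X) (k_space Y) \<phi> \<and>
     (\<forall>x\<in>topspace (k_space X). k_rng Y (\<phi> x) = k_rng X x \<and> k_src Y (\<phi> x) = k_src X x) \<and>
     (\<forall>h\<in>topspace (g_arr H). \<forall>x\<in>topspace (k_space X). g_src H h = k_rng X x \<longrightarrow>
        \<phi> (k_lact X h x) = k_lact Y h (\<phi> x)) \<and>
     (\<forall>x\<in>topspace (k_space X). \<forall>g\<in>topspace (g_arr G). k_src X x = g_rng G g \<longrightarrow>
        \<phi> (k_ract X x g) = k_ract Y (\<phi> x) g)"

record 'c category =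
  c_arr :: "'c set"
  c_obj :: "'c set"
  c_rng :: "'c \<Rightarrow> 'c"
  c_src :: "'c \<Rightarrow> 'c"
  c_comp :: "'c \<Rightarrow> 'c \<Rightarrow> 'c"

definition small_category :: "'c category \<Rightarrow> bool" where
  "small_category C \<longleftrightarrow>
     c_obj C \<subseteq> c_arr C \<and>
     (\<forall>g\<in>c_arr C. c_rng C g \<in> c_obj C \<and> c_src C g \<in> c_obj C) \<and>
     (\<forall>x\<in>c_obj C. c_rng C x = x \<and> c_src C x = x) \<and>
     (\<forall>g\<in>c_arr C. \<forall>h\<in>c_arr C. c_src C g = c_rng C h \<longrightarrow>
        c_comp C g h \<in> c_arr C \<and> c_rng C (c_comp C g h) = c_rng C g \<and>
        c_src C (c_comp C g h) = c_src C h) \<and>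
     (\<forall>g\<in>c_arr C. \<forall>h\<in>c_arr C. \<forall>k\<in>c_arr C. c_src C g = c_rng C h \<longrightarrow> c_src C h = c_rng C k \<longrightarrow>
        c_comp C (c_comp C g h) k = c_comp C g (c_comp C h k)) \<and>
     (\<forall>g\<in>c_arr C. c_comp C (c_rng C g) g = g \<and> c_comp C g (c_src C g) = g)"

(* All groupoids and correspondences of a diagram share the types 'o and 'a.  This is no
   restriction, since a small family of spaces embeds into one type, and it allows the
   condition that the correspondence of an identity arrow x is the groupoid at x. *)

record ('c, 'o, 'a) diagram =
  d_grpd :: "'c \<Rightarrow> ('o, 'a) groupoid"
  d_corr :: "'c \<Rightarrow> ('o, 'a, 'a) correspondence"
  d_mu :: "'c \<Rightarrow> 'c \<Rightarrow> ('a \<times> 'a) set \<Rightarrow> 'a"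

definition d_space :: "('c, 'o, 'a) diagram \<Rightarrow> 'c \<Rightarrow> 'a set" where
  "d_space F g = topspace (k_space (d_corr F g))"

definition d_mult ::
  "'c category \<Rightarrow> ('c, 'o, 'a) diagram \<Rightarrow> 'c \<Rightarrow> 'c \<Rightarrow> 'a \<Rightarrow> 'a \<Rightarrow> 'a" where
  "d_mult C F g h \<gamma> \<eta> =
     d_mu F g h (composite_class (d_grpd F (c_src C g)) (d_corr F g) (d_corr F h) (\<gamma>, \<eta>))"

definition corr_diagram :: "'c category \<Rightarrow> ('c, 'o, 'a) diagram \<Rightarrow> bool" where
  "corr_diagram C F \<longleftrightarrow>
     (\<forall>x\<in>c_obj C. etale_groupoid (d_grpd F x)) \<and>
     (\<forall>g\<in>c_arr C.
        groupoid_correspondence (d_grpd F (c_rng C g)) (d_grpd F (c_src C g)) (d_corr F g)) \<and>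
     (\<forall>g\<in>c_arr C. \<forall>h\<in>c_arr C. c_src C g = c_rng C h \<longrightarrow>
        correspondence_iso (d_grpd F (c_rng C g)) (d_grpd F (c_src C h))
          (composite (d_grpd F (c_src C g)) (d_corr F g) (d_corr F h))
          (d_corr F (c_comp C g h)) (d_mu F g h)) \<and>
     (\<forall>x\<in>c_obj C. let G = d_grpd F x; X = d_corr F x in
        k_space X = g_arr G \<and>
        (\<forall>\<gamma>\<in>topspace (g_arr G). k_rng X \<gamma> = g_rng G \<gamma> \<and> k_src X \<gamma> = g_src G \<gamma>) \<and>
        (\<forall>\<gamma>\<in>topspace (g_arr G). \<forall>\<eta>\<in>topspace (g_arr G). g_src G \<gamma> = g_rng G \<eta> \<longrightarrow>
           k_lact X \<gamma> \<eta> = g_mult G \<gamma> \<eta> \<and> k_ract X \<gamma> \<eta> = g_mult G \<gamma> \<eta>)) \<and>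
     (\<forall>g\<in>c_arr C. \<forall>\<gamma>\<in>topspace (g_arr (d_grpd F (c_rng C g))). \<forall>\<eta>\<in>d_space F g.
        g_src (d_grpd F (c_rng C g)) \<gamma> = k_rng (d_corr F g) \<eta> \<longrightarrow>
        d_mult C F (c_rng C g) g \<gamma> \<eta> = k_lact (d_corr F g) \<gamma> \<eta>) \<and>
     (\<forall>g\<in>c_arr C. \<forall>\<gamma>\<in>d_space F g. \<forall>\<eta>\<in>topspace (g_arr (d_grpd F (c_src C g))).
        k_src (d_corr F g) \<gamma> = g_rng (d_grpd F (c_src C g)) \<eta> \<longrightarrow>
        d_mult C F g (c_src C g) \<gamma> \<eta> = k_ract (d_corr F g) \<gamma> \<eta>) \<and>
     (\<forall>g\<in>c_arr C. \<forall>h\<in>c_arr C. \<forall>k\<in>c_arr C. c_src C g = c_rng C h \<longrightarrow> c_src C h = c_rng C k \<longrightarrow>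
        (\<forall>\<gamma>\<in>d_space F g. \<forall>\<eta>\<in>d_space F h. \<forall>\<zeta>\<in>d_space F k.
           k_src (d_corr F g) \<gamma> = k_rng (d_corr F h) \<eta> \<longrightarrow>
           k_src (d_corr F h) \<eta> = k_rng (d_corr F k) \<zeta> \<longrightarrow>
           d_mult C F (c_comp C g h) k (d_mult C F g h \<gamma> \<eta>) \<zeta> =
           d_mult C F g (c_comp C h k) \<gamma> (d_mult C F h k \<eta> \<zeta>)))"

record ('c, 'o, 'a, 'y) faction =
  f_part :: "'c \<Rightarrow> 'y set"
  f_rng :: "'y \<Rightarrow> 'o"
  f_act :: "'c \<Rightarrow> 'a \<Rightarrow> 'y \<Rightarrow> 'y"

(* The last three conjuncts only fix the values outside the domains, so that actions that
   agree on their domains are equal. *)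

definition F_action ::
  "'c category \<Rightarrow> ('c, 'o, 'a) diagram \<Rightarrow> 'y topology \<Rightarrow> ('c, 'o, 'a, 'y) faction \<Rightarrow> bool" where
  "F_action C F Y A \<longleftrightarrow>
     (\<Union>x\<in>c_obj C. f_part A x) = topspace Y \<and>
     disjoint_family_on (f_part A) (c_obj C) \<and>
     (\<forall>x\<in>c_obj C. openin Y (f_part A x) \<and> closedin Y (f_part A x)) \<and>
     (\<forall>x\<in>c_obj C. continuous_map (subtopology Y (f_part A x)) (g_obj (d_grpd F x)) (f_rng A)) \<and>
     (\<forall>g\<in>c_arr C.
        let D = fibre_product (k_space (d_corr F g)) (subtopology Y (f_part A (c_src C g)))
                  (k_src (d_corr F g)) (f_rng A);
            R = subtopology Y (f_part A (c_rng C g));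
            m = (\<lambda>(\<gamma>, y). f_act A g \<gamma> y)
        in continuous_map D R m \<and> open_map D R m \<and> m ` topspace D = topspace R) \<and>
     (\<forall>g\<in>c_arr C. \<forall>\<gamma>\<in>d_space F g. \<forall>y\<in>f_part A (c_src C g).
        k_src (d_corr F g) \<gamma> = f_rng A y \<longrightarrow>
        f_rng A (f_act A g \<gamma> y) = k_rng (d_corr F g) \<gamma>) \<and>
     (\<forall>g\<in>c_arr C. \<forall>h\<in>c_arr C. c_src C g = c_rng C h \<longrightarrow>
        (\<forall>\<gamma>\<in>d_space F g. \<forall>\<eta>\<in>d_space F h. \<forall>y\<in>f_part A (c_src C h).
           k_src (d_corr F g) \<gamma> = k_rng (d_corr F h) \<eta> \<longrightarrow> k_src (d_corr F h) \<eta> = f_rng A y \<longrightarrow>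
           f_act A g \<gamma> (f_act A h \<eta> y) = f_act A (c_comp C g h) (d_mult C F g h \<gamma> \<eta>) y)) \<and>
     (\<forall>g\<in>c_arr C. \<forall>\<gamma>\<in>d_space F g. \<forall>\<gamma>'\<in>d_space F g.
        \<forall>y\<in>f_part A (c_src C g). \<forall>y'\<in>f_part A (c_src C g).
        k_src (d_corr F g) \<gamma> = f_rng A y \<longrightarrow> k_src (d_corr F g) \<gamma>' = f_rng A y' \<longrightarrow>
        f_act A g \<gamma> y = f_act A g \<gamma>' y' \<longrightarrow>
        (\<exists>\<eta>\<in>topspace (g_arr (d_grpd F (c_src C g))).
           g_rng (d_grpd F (c_src C g)) \<eta> = k_src (d_corr F g) \<gamma> \<and>
           g_src (d_grpd F (c_src C g)) \<eta> = f_rng A y' \<and>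
           \<gamma>' = k_ract (d_corr F g) \<gamma> \<eta> \<and> y = f_act A (c_src C g) \<eta> y')) \<and>
     (\<forall>x. x \<notin> c_obj C \<longrightarrow> f_part A x = {}) \<and>
     f_rng A \<in> extensional (topspace Y) \<and>
     (\<forall>g \<gamma> y. \<not> (g \<in> c_arr C \<and> \<gamma> \<in> d_space F g \<and> y \<in> f_part A (c_src C g) \<and>
                 k_src (d_corr F g) \<gamma> = f_rng A y) \<longrightarrow> f_act A g \<gamma> y = undefined)"

definition F_equivariant ::
  "'c category \<Rightarrow> ('c, 'o, 'a) diagram \<Rightarrow> 'y topology \<Rightarrow> ('c, 'o, 'a, 'y) faction
     \<Rightarrow> ('c, 'o, 'a, 'z) faction \<Rightarrow> ('y \<Rightarrow> 'z) \<Rightarrow> bool" where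
  "F_equivariant C F Y A B \<phi> \<longleftrightarrow>
     (\<forall>x\<in>c_obj C. \<phi> ` f_part A x \<subseteq> f_part B x) \<and>
     (\<forall>y\<in>topspace Y. f_rng B (\<phi> y) = f_rng A y) \<and>
     (\<forall>g\<in>c_arr C. \<forall>\<gamma>\<in>d_space F g. \<forall>y\<in>f_part A (c_src C g).
        k_src (d_corr F g) \<gamma> = f_rng A y \<longrightarrow> \<phi> (f_act A g \<gamma> y) = f_act B g \<gamma> (\<phi> y))"

(* HOL cannot quantify over types inside a formula.  Hence universality and the model property
   are relative to the spaces whose points belong to a given type 'y. *)

definition universal_F_action ::
  "'y itself \<Rightarrow> 'c category \<Rightarrow> ('c, 'o, 'a) diagram \<Rightarrow> 'w topology
     \<Rightarrow> ('c, 'o, 'a, 'w) faction \<Rightarrow> bool" where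
  "universal_F_action _ C F \<Omega> W \<longleftrightarrow>
     F_action C F \<Omega> W \<and>
     (\<forall>(Y :: 'y topology) A. F_action C F Y A \<longrightarrow>
        (\<exists>!\<phi>. \<phi> \<in> extensional (topspace Y) \<and> continuous_map Y \<Omega> \<phi> \<and>
              F_equivariant C F Y A W \<phi>))"

record ('o, 'a, 'y) gaction =
  l_rng :: "'y \<Rightarrow> 'o"
  l_act :: "'a \<Rightarrow> 'y \<Rightarrow> 'y"

definition groupoid_action ::
  "('o, 'a) groupoid \<Rightarrow> 'y topology \<Rightarrow> ('o, 'a, 'y) gaction \<Rightarrow> bool" where
  "groupoid_action U Y A \<longleftrightarrow>
     left_space U Y (l_rng A) (l_act A) \<and>
     l_rng A \<in> extensional (topspace Y) \<and>
     (\<forall>g y. \<not> (g \<in> topspace (g_arr U) \<and> y \<in> topspace Y \<and> g_src U g = l_rng A y) \<longrightarrow>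
        l_act A g y = undefined)"

definition groupoid_equivariant ::
  "('o, 'a) groupoid \<Rightarrow> 'y topology \<Rightarrow> ('o, 'a, 'y) gaction \<Rightarrow> ('o, 'a, 'z) gaction
     \<Rightarrow> ('y \<Rightarrow> 'z) \<Rightarrow> bool" where
  "groupoid_equivariant U Y A B \<phi> \<longleftrightarrow>
     (\<forall>y\<in>topspace Y. l_rng B (\<phi> y) = l_rng A y) \<and>
     (\<forall>g\<in>topspace (g_arr U). \<forall>y\<in>topspace Y. g_src U g = l_rng A y \<longrightarrow>
        \<phi> (l_act A g y) = l_act B g (\<phi> y))"

definition groupoid_model ::
  "'y itself \<Rightarrow> 'c category \<Rightarrow> ('c, 'o, 'a) diagram \<Rightarrow> ('p, 'b) groupoid \<Rightarrow> bool" where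
  "groupoid_model _ C F U \<longleftrightarrow>
     etale_groupoid U \<and>
     (\<exists>\<Phi> :: 'y topology \<Rightarrow> ('p, 'b, 'y) gaction \<Rightarrow> ('c, 'o, 'a, 'y) faction.
        (\<forall>Y. bij_betw (\<Phi> Y) {A. groupoid_action U Y A} {A. F_action C F Y A}) \<and>
        (\<forall>Y Y' A A' \<phi>. groupoid_action U Y A \<longrightarrow> groupoid_action U Y' A' \<longrightarrow>
           continuous_map Y Y' \<phi> \<longrightarrow>
           (groupoid_equivariant U Y A A' \<phi> \<longleftrightarrow> F_equivariant C F Y (\<Phi> Y A) (\<Phi> Y' A') \<phi>)))"

record 's inv_semigroup =
  s_carrier :: "'s set"
  s_mult :: "'s \<Rightarrow> 's \<Rightarrow> 's"
  s_star :: "'s \<Rightarrow> 's"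

datatype 'u isg_term = Gen 'u | Mul "'u isg_term" "'u isg_term" | Star "'u isg_term"

(* Inverse semigroups form the variety with a binary operation and an involution that is
   axiomatised by the rules assoc, star_star, star_mul, regular and commute below (commute says
   that the idempotents commute).  So the terms over B modulo the least congruence
   satisfying these axioms and the relations in R form the universal inverse semigroup with
   generators B and relations R. *)

inductive isg_eq ::
  "'u set \<Rightarrow> ('u isg_term \<times> 'u isg_term) set \<Rightarrow> 'u isg_term \<Rightarrow> 'u isg_term \<Rightarrow> bool"
  for B R where
  refl: "set_isg_term a \<subseteq> B \<Longrightarrow> isg_eq B R a a"
| sym: "isg_eq B R a b \<Longrightarrow> isg_eq B R b a"
| trans: "isg_eq B R a b \<Longrightarrow> isg_eq B R b c \<Longrightarrow> isg_eq B R a c"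
| mul: "isg_eq B R a a' \<Longrightarrow> isg_eq B R b b' \<Longrightarrow> isg_eq B R (Mul a b) (Mul a' b')"
| star: "isg_eq B R a a' \<Longrightarrow> isg_eq B R (Star a) (Star a')"
| assoc: "set_isg_term a \<subseteq> B \<Longrightarrow> set_isg_term b \<subseteq> B \<Longrightarrow> set_isg_term c \<subseteq> B \<Longrightarrow>
    isg_eq B R (Mul (Mul a b) c) (Mul a (Mul b c))"
| star_star: "set_isg_term a \<subseteq> B \<Longrightarrow> isg_eq B R (Star (Star a)) a"
| star_mul: "set_isg_term a \<subseteq> B \<Longrightarrow> set_isg_term b \<subseteq> B \<Longrightarrow>
    isg_eq B R (Star (Mul a b)) (Mul (Star b) (Star a))"
| regular: "set_isg_term a \<subseteq> B \<Longrightarrow> isg_eq B R (Mul (Mul a (Star a)) a) a"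
| commute: "set_isg_term a \<subseteq> B \<Longrightarrow> set_isg_term b \<subseteq> B \<Longrightarrow>
    isg_eq B R (Mul (Mul a (Star a)) (Mul b (Star b))) (Mul (Mul b (Star b)) (Mul a (Star a)))"
| rel: "(a, b) \<in> R \<Longrightarrow> isg_eq B R a b"

definition presented_isg ::
  "'u set \<Rightarrow> ('u isg_term \<times> 'u isg_term) set \<Rightarrow> 'u isg_term set inv_semigroup" where
  "presented_isg B R =
     \<lparr>s_carrier = {t. set_isg_term t \<subseteq> B} // {(a, b). isg_eq B R a b},
      s_mult = (\<lambda>c d. {t. \<exists>a\<in>c. \<exists>b\<in>d. isg_eq B R (Mul a b) t}),
      s_star = (\<lambda>c. {t. \<exists>a\<in>c. isg_eq B R (Star a) t})\<rparr>"

definition right_orbit ::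
  "('o, 'a) groupoid \<Rightarrow> ('o, 'a, 'x) correspondence \<Rightarrow> 'x \<Rightarrow> 'x set" where
  "right_orbit G X x = {k_ract X x g | g. g \<in> topspace (g_arr G) \<and> k_src X x = g_rng G g}"

definition corr_bracket ::
  "('o, 'a) groupoid \<Rightarrow> ('o, 'a, 'x) correspondence \<Rightarrow> 'x \<Rightarrow> 'x \<Rightarrow> 'a" where
  "corr_bracket G X x y =
     (THE g. g \<in> topspace (g_arr G) \<and> k_src X x = g_rng G g \<and> y = k_ract X x g)"

definition slices ::
  "('o, 'a) groupoid \<Rightarrow> ('o, 'a, 'x) correspondence \<Rightarrow> 'x set set" where
  "slices G X = {U. openin (k_space X) U \<and> inj_on (k_src X) U \<and> inj_on (right_orbit G X) U}"

definition slice_bracket ::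
  "('o, 'a) groupoid \<Rightarrow> ('o, 'a, 'x) correspondence \<Rightarrow> 'x set \<Rightarrow> 'x set \<Rightarrow> 'a set" where
  "slice_bracket G X U V =
     {corr_bracket G X x y | x y. x \<in> U \<and> y \<in> V \<and> right_orbit G X x = right_orbit G X y}"

(* A slice U of the correspondence at g is encoded as {g} \<times> U.  This makes the union over g
   disjoint and identifies all empty slices. *)

definition diagram_slices :: "'c category \<Rightarrow> ('c, 'o, 'a) diagram \<Rightarrow> ('c \<times> 'a) set set" where
  "diagram_slices C F =
     {{g} \<times> U | g U. g \<in> c_arr C \<and> U \<in> slices (d_grpd F (c_src C g)) (d_corr F g)}"

(* For P = {g} \<times> U and Q = {h} \<times> V this is {gh} \<times> UV if g, h are composable, and empty
   otherwise. *)

definition diagram_slice_mult ::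
  "'c category \<Rightarrow> ('c, 'o, 'a) diagram \<Rightarrow> ('c \<times> 'a) set \<Rightarrow> ('c \<times> 'a) set \<Rightarrow> ('c \<times> 'a) set" where
  "diagram_slice_mult C F P Q =
     {(c_comp C g h, d_mult C F g h \<gamma> \<eta>) | g h \<gamma> \<eta>.
        (g, \<gamma>) \<in> P \<and> (h, \<eta>) \<in> Q \<and> c_src C g = c_rng C h \<and>
        k_src (d_corr F g) \<gamma> = k_rng (d_corr F h) \<eta>}"

definition diagram_isg_relations ::
  "'c category \<Rightarrow> ('c, 'o, 'a) diagram
     \<Rightarrow> (('c \<times> 'a) set isg_term \<times> ('c \<times> 'a) set isg_term) set" where
  "diagram_isg_relations C F =
     {(Gen (diagram_slice_mult C F P Q), Mul (Gen P) (Gen Q)) | P Q.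
        P \<in> diagram_slices C F \<and> Q \<in> diagram_slices C F} \<union>
     {(Mul (Star (Gen ({g} \<times> U))) (Gen ({g} \<times> V)),
       Gen ({c_src C g} \<times> slice_bracket (d_grpd F (c_src C g)) (d_corr F g) U V)) | g U V.
        g \<in> c_arr C \<and> U \<in> slices (d_grpd F (c_src C g)) (d_corr F g) \<and>
        V \<in> slices (d_grpd F (c_src C g)) (d_corr F g)}"

definition diagram_isg ::
  "'c category \<Rightarrow> ('c, 'o, 'a) diagram \<Rightarrow> ('c \<times> 'a) set isg_term set inv_semigroup" where
  "diagram_isg C F = presented_isg (diagram_slices C F) (diagram_isg_relations C F)"

(* Partial homeomorphisms of Y are encoded as partial functions 'y \<rightharpoonup> 'y; their product is
   \<circ>\<^sub>m and their involution is partial_inverse. *)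

definition partial_inverse :: "('y \<rightharpoonup> 'y) \<Rightarrow> ('y \<rightharpoonup> 'y)" where
  "partial_inverse f = (\<lambda>z. if z \<in> ran f then Some (SOME y. f y = Some z) else None)"

primrec isg_eval :: "('u \<Rightarrow> 'y \<rightharpoonup> 'y) \<Rightarrow> 'u isg_term \<Rightarrow> 'y \<rightharpoonup> 'y" where
  "isg_eval \<theta> (Gen u) = \<theta> u"
| "isg_eval \<theta> (Mul a b) = isg_eval \<theta> a \<circ>\<^sub>m isg_eval \<theta> b"
| "isg_eval \<theta> (Star a) = partial_inverse (isg_eval \<theta> a)"

definition slice_action ::
  "'c category \<Rightarrow> ('c, 'o, 'a) diagram \<Rightarrow> ('c, 'o, 'a, 'y) faction
     \<Rightarrow> ('c \<times> 'a) set \<Rightarrow> 'y \<rightharpoonup> 'y" where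
  "slice_action C F A P y =
     (if \<exists>g \<gamma>. (g, \<gamma>) \<in> P \<and> y \<in> f_part A (c_src C g) \<and> k_src (d_corr F g) \<gamma> = f_rng A y
      then Some (THE z. \<exists>g \<gamma>. (g, \<gamma>) \<in> P \<and> y \<in> f_part A (c_src C g) \<and>
                   k_src (d_corr F g) \<gamma> = f_rng A y \<and> z = f_act A g \<gamma> y)
      else None)"

(* The homomorphism on the presented inverse semigroup that is given by slice_action on the
   generators; its value on a class does not depend on the representing term. *)

definition induced_action ::
  "'c category \<Rightarrow> ('c, 'o, 'a) diagram \<Rightarrow> ('c, 'o, 'a, 'y) faction
     \<Rightarrow> ('c \<times> 'a) set isg_term set \<Rightarrow> 'y \<rightharpoonup> 'y" where
  "induced_action C F A c = isg_eval (slice_action C F A) (SOME t. t \<in> c)"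

definition s_idempotents :: "'s inv_semigroup \<Rightarrow> 's set" where
  "s_idempotents S = {e \<in> s_carrier S. s_mult S e e = e}"

definition germ ::
  "'s inv_semigroup \<Rightarrow> ('s \<Rightarrow> 'y \<rightharpoonup> 'y) \<Rightarrow> 's \<Rightarrow> 'y \<Rightarrow> ('s \<times> 'y) set" where
  "germ S \<theta> t y =
     {(u, y') | u y'. u \<in> s_carrier S \<and> y' \<in> dom (\<theta> u) \<and> y' = y \<and>
        (\<exists>e\<in>s_idempotents S. y \<in> dom (\<theta> e) \<and> s_mult S t e = s_mult S u e)}"

(* The unit at y is the germ at y of any idempotent that is defined at y.  The generating
   sets of the topology on the arrows form a basis. *)

definition transformation_groupoid ::
  "'s inv_semigroup \<Rightarrow> 'y topology \<Rightarrow> ('s \<Rightarrow> 'y \<rightharpoonup> 'y) \<Rightarrow> ('y, ('s \<times> 'y) set) groupoid" where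
  "transformation_groupoid S Y \<theta> =
     \<lparr>g_obj = Y,
      g_arr = topology_generated_by
        {{germ S \<theta> t y | y. y \<in> W} | t W. t \<in> s_carrier S \<and> openin Y W \<and> W \<subseteq> dom (\<theta> t)},
      g_rng = (\<lambda>c. let (t, y) = SOME p. p \<in> c in the (\<theta> t y)),
      g_src = (\<lambda>c. let (t, y) = SOME p. p \<in> c in y),
      g_unit = (\<lambda>y. germ S \<theta> (SOME e. e \<in> s_idempotents S \<and> y \<in> dom (\<theta> e)) y),
      g_mult = (\<lambda>c d. let (u, z) = SOME p. p \<in> c; (t, y) = SOME p. p \<in> d
                      in germ S \<theta> (s_mult S u t) y),
      g_inv = (\<lambda>c. let (t, y) = SOME p. p \<in> c in germ S \<theta> (s_star S t) (the (\<theta> t y)))\<rparr>"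

end

theory Submission
  imports Defs
begin

text \<open>
  An action of a transformation groupoid \<open>S \<ltimes> \<Omega>\<close> on a space \<open>Y\<close> has an anchor map \<open>\<rho>: Y \<rightarrow> \<Omega>\<close>, and the
  germ \<open>[t, \<rho>(y)]\<close> moves \<open>y\<close> to a point \<open>\<tau>\<^sub>t(y)\<close>.  In this way an action of \<open>S \<ltimes> \<Omega>\<close> on \<open>Y\<close> is the same
  as a continuous map \<open>\<rho>: Y \<rightarrow> \<Omega>\<close> together with an action \<open>\<tau>\<close> of \<open>S\<close> on \<open>Y\<close> such that \<open>\<rho>\<close> intertwines
  \<open>\<tau>\<close> with the given action \<open>\<theta>\<close> on \<open>\<Omega>\<close> and \<open>\<tau>\<^sub>t\<close> is defined exactly on \<open>\<rho>\<^sup>-\<^sup>1(dom \<theta>\<^sub>t)\<close>.  The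
  condition on the domains makes \<open>\<tau>\<^sub>t(y)\<close> depend only on the germ of \<open>t\<close> at \<open>\<rho>(y)\<close>.  This is
  \<open>action_over\<close>, and the two directions are \<open>action_over_action_hom\<close> and
  \<open>groupoid_action_over_action\<close>.

  Now let \<open>S = \<I>(F)\<close> and let \<open>\<Omega>\<close> be an \<open>F\<close>-action.  A pair \<open>(\<rho>, \<tau>)\<close> as above is the same as
  an \<open>F\<close>-action on \<open>Y\<close> with an \<open>F\<close>-equivariant continuous map \<open>\<rho>: Y \<rightarrow> \<Omega>\<close>.
  Given \<open>(\<rho>, \<tau>)\<close>, pull back the partition and the maps to the object spaces along \<open>\<rho>\<close> and let
  \<open>\<gamma> \<cdot> y = \<tau>\<^bsub>\<Theta>(U)\<^esub>(y)\<close> for any slice \<open>U\<close> containing \<open>\<gamma>\<close>.  The slices form a basis of each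
  \<open>\<X>\<^sub>g\<close>, so the topological axioms become statements about the partial homeomorphisms
  \<open>\<tau>\<^bsub>\<Theta>(U)\<^esub>\<close>; surjectivity and condition (ii) are inherited from \<open>\<Omega>\<close> because the domains of the
  \<open>\<tau>\<^sub>t\<close>, and hence also their ranges, are full preimages (\<open>F_action_pullback\<close>).  Conversely, an
  \<open>F\<close>-action induces an action of \<open>\<I>(F)\<close> on \<open>Y\<close>, since its slices satisfy the defining
  relations (\<open>isg_action_theta\<close>).  An equivariant map automatically satisfies the condition on the
  domains (\<open>F_equivariant_action_over\<close>).  The two passages are inverse to each other because an
  action of \<open>\<I>(F)\<close> is determined by the \<open>\<tau>\<^bsub>\<Theta>(U)\<^esub>\<close> (\<open>induced_pullback\<close>, \<open>pullback_induced\<close>).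

  If \<open>\<Omega>\<close> is universal, then every \<open>F\<close>-action on \<open>Y\<close> has exactly one equivariant map to \<open>\<Omega>\<close>, so
  that the map \<open>\<rho>\<close> is redundant and actions of \<open>\<I>(F) \<ltimes> \<Omega>\<close> correspond bijectively to \<open>F\<close>-actions.
  Uniqueness also gives naturality: if \<open>\<phi>: Y \<rightarrow> Y'\<close> is \<open>F\<close>-equivariant, then \<open>\<rho>' \<circ> \<phi>\<close> is an
  equivariant map \<open>Y \<rightarrow> \<Omega>\<close> and so equal to \<open>\<rho>\<close>.
\<close>

section \<open>Fibre products and local homeomorphisms\<close>

lemma topspace_fibre_product [simp]:
  "topspace (fibre_product X Y f g) = {(x, y). x \<in> topspace X \<and> y \<in> topspace Y \<and> f x = g y}"
  by (auto simp: fibre_product_def)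

text \<open>Working with neighbourhoods \<open>U \<times> V\<close> of a point avoids sets of pairs in later continuity
  arguments.\<close>

lemma openin_fibre_product:
  "openin (fibre_product X Y f g) S \<longleftrightarrow>
     S \<subseteq> {(x, y). f x = g y} \<and>
     (\<forall>x y. (x, y) \<in> S \<longrightarrow> (\<exists>U V. openin X U \<and> openin Y V \<and> x \<in> U \<and> y \<in> V \<and>
        (\<forall>x'\<in>U. \<forall>y'\<in>V. f x' = g y' \<longrightarrow> (x', y') \<in> S)))"
  (is "?L \<longleftrightarrow> ?R")
proof
  assume ?L
  then obtain T where T: "openin (prod_topology X Y) T" "S = T \<inter> {(x, y). f x = g y}"
    unfolding fibre_product_def openin_subtopology by auto
  show ?R
  proof (intro conjI allI impI)
    show "S \<subseteq> {(x, y). f x = g y}" using T by auto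
    fix x y assume "(x, y) \<in> S"
    then have "(x, y) \<in> T" using T(2) by simp
    then obtain U V where "openin X U" "openin Y V" "x \<in> U" "y \<in> V" "U \<times> V \<subseteq> T"
      using T(1)[unfolded openin_prod_topology_alt, rule_format, of x y] by auto
    then show "\<exists>U V. openin X U \<and> openin Y V \<and> x \<in> U \<and> y \<in> V \<and>
        (\<forall>x'\<in>U. \<forall>y'\<in>V. f x' = g y' \<longrightarrow> (x', y') \<in> S)"
      using T by blast
  qed
next
  assume R: ?R
  define T where "T = \<Union>{U \<times> V | U V. openin X U \<and> openin Y V \<and>
        (\<forall>x'\<in>U. \<forall>y'\<in>V. f x' = g y' \<longrightarrow> (x', y') \<in> S)}"
  have "openin (prod_topology X Y) T"
    unfolding T_def by (rule openin_Union) (auto simp: openin_prod_Times_iff)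
  moreover have "S = T \<inter> {(x, y). f x = g y}"
  proof
    show "S \<subseteq> T \<inter> {(x, y). f x = g y}"
    proof
      fix p assume p: "p \<in> S"
      obtain x y where xy: "p = (x, y)" by force
      then obtain U V where "openin X U" "openin Y V" "x \<in> U" "y \<in> V"
        "\<forall>x'\<in>U. \<forall>y'\<in>V. f x' = g y' \<longrightarrow> (x', y') \<in> S"
        using R p by blast
      then have "p \<in> T" unfolding T_def xy by blast
      then show "p \<in> T \<inter> {(x, y). f x = g y}" using R p by blast
    qed
    show "T \<inter> {(x, y). f x = g y} \<subseteq> S" unfolding T_def by auto
  qed
  ultimately show ?L unfolding fibre_product_def openin_subtopology by blast
qed

lemma openin_fibre_product_box:
  assumes "openin X U" "openin Y V"
  shows "openin (fibre_product X Y f g) {(x, y). x \<in> U \<and> y \<in> V \<and> f x = g y}"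
  unfolding openin_fibre_product using assms by auto

lemma openin_fibre_product_preimage:
  assumes "continuous_map (fibre_product X Y f g) Z m" "openin Z W"
  shows "openin (fibre_product X Y f g)
           {(x, y). x \<in> topspace X \<and> y \<in> topspace Y \<and> f x = g y \<and> m (x, y) \<in> W}"
proof -
  have "{(x, y). x \<in> topspace X \<and> y \<in> topspace Y \<and> f x = g y \<and> m (x, y) \<in> W} =
      {p \<in> topspace (fibre_product X Y f g). m p \<in> W}" by auto
  then show ?thesis using assms by (metis openin_continuous_map_preimage)
qed

lemma continuous_map_fibre_productI:
  assumes "\<And>x y. x \<in> topspace X \<Longrightarrow> y \<in> topspace Y \<Longrightarrow> f x = g y \<Longrightarrow> m x y \<in> topspace Z"
    and "\<And>x y W. x \<in> topspace X \<Longrightarrow> y \<in> topspace Y \<Longrightarrow> f x = g y \<Longrightarrow> openin Z W \<Longrightarrow> m x y \<in> W \<Longrightarrow>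
       \<exists>U V. openin X U \<and> openin Y V \<and> x \<in> U \<and> y \<in> V \<and>
         (\<forall>x'\<in>U. \<forall>y'\<in>V. f x' = g y' \<longrightarrow> m x' y' \<in> W)"
  shows "continuous_map (fibre_product X Y f g) Z (\<lambda>(x, y). m x y)"
  unfolding continuous_map_def
proof (intro conjI allI impI)
  show "(\<lambda>(x, y). m x y) \<in> topspace (fibre_product X Y f g) \<rightarrow> topspace Z"
    using assms(1) by auto
  fix W assume W: "openin Z W"
  have "\<exists>U V. openin X U \<and> openin Y V \<and> x \<in> U \<and> y \<in> V \<and>
        (\<forall>x'\<in>U. \<forall>y'\<in>V. f x' = g y' \<longrightarrow> x' \<in> topspace X \<and> y' \<in> topspace Y \<and> m x' y' \<in> W)"
    if xy: "x \<in> topspace X" "y \<in> topspace Y" "f x = g y" "m x y \<in> W" for x y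
  proof -
    obtain U V where "openin X U" "openin Y V" "x \<in> U" "y \<in> V"
      "\<forall>x'\<in>U. \<forall>y'\<in>V. f x' = g y' \<longrightarrow> m x' y' \<in> W"
      using assms(2)[OF xy(1-3) W xy(4)] by blast
    moreover have "U \<subseteq> topspace X" "V \<subseteq> topspace Y"
      using \<open>openin X U\<close> \<open>openin Y V\<close> by (auto dest: openin_subset)
    ultimately show ?thesis by blast
  qed
  then show "openin (fibre_product X Y f g)
      {p \<in> topspace (fibre_product X Y f g). (case p of (x, y) \<Rightarrow> m x y) \<in> W}"
    unfolding openin_fibre_product by auto
qed

lemma continuous_map_fibre_productD:
  assumes "continuous_map (fibre_product X Y f g) Z (\<lambda>(x, y). m x y)"
    and "x \<in> topspace X" "y \<in> topspace Y" "f x = g y"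
  shows "m x y \<in> topspace Z"
  using continuous_map_image_subset_topspace[OF assms(1)] assms(2-) by force

lemma continuous_map_fibre_product_box:
  assumes m: "continuous_map (fibre_product X Y f g) Z (\<lambda>(x, y). m x y)" and W: "openin Z W"
    and xy: "x \<in> topspace X" "y \<in> topspace Y" "f x = g y" "m x y \<in> W"
  shows "\<exists>U V. openin X U \<and> openin Y V \<and> x \<in> U \<and> y \<in> V \<and>
    (\<forall>x'\<in>U. \<forall>y'\<in>V. f x' = g y' \<longrightarrow> m x' y' \<in> W)"
proof -
  define E where "E = {(x, y). x \<in> topspace X \<and> y \<in> topspace Y \<and> f x = g y \<and>
    (case (x, y) of (x, y) \<Rightarrow> m x y) \<in> W}"
  have E: "openin (fibre_product X Y f g) E"
    unfolding E_def by (rule openin_fibre_product_preimage[OF m W])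
  have "(x, y) \<in> E" using xy unfolding E_def by simp
  then obtain U V where UV: "openin X U" "openin Y V" "x \<in> U" "y \<in> V"
    "\<forall>x'\<in>U. \<forall>y'\<in>V. f x' = g y' \<longrightarrow> (x', y') \<in> E"
    using E[unfolded openin_fibre_product] by blast
  have "\<forall>x'\<in>U. \<forall>y'\<in>V. f x' = g y' \<longrightarrow> m x' y' \<in> W"
    using UV(5) unfolding E_def by simp
  then show ?thesis using UV(1-4) by blast
qed

lemma open_map_fibre_product_snd:
  assumes f: "open_map X Z f" and g: "continuous_map Y Z g"
  shows "open_map (fibre_product X Y f g) Y snd"
  unfolding open_map_def
proof (intro allI impI)
  fix S assume S: "openin (fibre_product X Y f g) S"
  show "openin Y (snd ` S)"
  proof (subst openin_subopen, intro ballI)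
    fix y assume "y \<in> snd ` S"
    then obtain x where xy: "(x, y) \<in> S" by auto
    then obtain U V where UV: "openin X U" "openin Y V" "x \<in> U" "y \<in> V"
      "\<forall>x'\<in>U. \<forall>y'\<in>V. f x' = g y' \<longrightarrow> (x', y') \<in> S"
      using S unfolding openin_fibre_product by blast
    have fxy: "f x = g y" using S xy unfolding openin_fibre_product by auto
    define T where "T = {y \<in> topspace Y. g y \<in> f ` U} \<inter> V"
    have "openin Y T"
      unfolding T_def using f g UV unfolding open_map_def
      by (intro openin_Int openin_continuous_map_preimage) auto
    moreover have "y \<in> T"
      using UV fxy openin_subset[OF UV(2)] unfolding T_def by force
    moreover have "T \<subseteq> snd ` S"
      using UV(5) unfolding T_def by force
    ultimately show "\<exists>T. openin Y T \<and> y \<in> T \<and> T \<subseteq> snd ` S" by blast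
  qed
qed

text \<open>For continuous open maps, being a local homeomorphism is a matter of local injectivity.\<close>

lemma local_homeomorphism_iff:
  "local_homeomorphism X Y f \<longleftrightarrow> continuous_map X Y f \<and> open_map X Y f \<and>
     (\<forall>x\<in>topspace X. \<exists>U. openin X U \<and> x \<in> U \<and> inj_on f U)" (is "?L \<longleftrightarrow> ?R")
proof
  assume L: ?L
  have ex: "\<exists>U. openin X U \<and> x \<in> U \<and> openin Y (f ` U) \<and>
      continuous_map (subtopology X U) (subtopology Y (f ` U)) f \<and>
      open_map (subtopology X U) (subtopology Y (f ` U)) f \<and> inj_on f U"
    if x: "x \<in> topspace X" for x
  proof -
    obtain U where U: "openin X U" "x \<in> U" "openin Y (f ` U)"
      "homeomorphic_map (subtopology X U) (subtopology Y (f ` U)) f"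
      using L x unfolding local_homeomorphism_def by blast
    have "U \<inter> topspace X = U" using openin_subset[OF U(1)] by auto
    then show ?thesis
      using U homeomorphic_imp_continuous_map[OF U(4)] homeomorphic_imp_open_map[OF U(4)]
        homeomorphic_imp_injective_map[OF U(4)]
      by (intro exI[of _ U]) (simp add: Int_commute)
  qed
  have "continuous_map X Y f"
    unfolding continuous_map_def
  proof (intro conjI allI impI)
    show "f \<in> topspace X \<rightarrow> topspace Y" using ex by (blast dest: openin_subset)
    fix V assume V: "openin Y V"
    show "openin X {x \<in> topspace X. f x \<in> V}"
    proof (subst openin_subopen, intro ballI)
      fix x assume x: "x \<in> {x \<in> topspace X. f x \<in> V}"
      then obtain U where U: "openin X U" "x \<in> U" "openin Y (f ` U)"
        "continuous_map (subtopology X U) (subtopology Y (f ` U)) f" using ex by blast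
      have "openin (subtopology X U)
          {z \<in> topspace (subtopology X U). f z \<in> f ` U \<inter> V}"
        using V by (intro openin_continuous_map_preimage[OF U(4)]) (metis openin_subtopology_Int2)
      then have "openin X {z \<in> topspace (subtopology X U). f z \<in> f ` U \<inter> V}"
        using U(1) openin_trans_full by blast
      then show "\<exists>T. openin X T \<and> x \<in> T \<and> T \<subseteq> {x \<in> topspace X. f x \<in> V}"
        using x U(2) by (intro exI) auto
    qed
  qed
  moreover have "open_map X Y f"
    unfolding open_map_def
  proof (intro allI impI)
    fix V assume V: "openin X V"
    show "openin Y (f ` V)"
    proof (subst openin_subopen, intro ballI)
      fix y assume "y \<in> f ` V"
      then obtain x where x: "x \<in> V" "y = f x" by auto
      then obtain U where U: "openin X U" "x \<in> U" "openin Y (f ` U)"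
        "open_map (subtopology X U) (subtopology Y (f ` U)) f"
        using ex openin_subset[OF V] by blast
      have "openin (subtopology Y (f ` U)) (f ` (U \<inter> V))"
        using U(4) V unfolding open_map_def by (metis openin_subtopology_Int2)
      then have "openin Y (f ` (U \<inter> V))" using U(3) openin_trans_full by blast
      then show "\<exists>T. openin Y T \<and> y \<in> T \<and> T \<subseteq> f ` V"
        using x U(2) by (intro exI) auto
    qed
  qed
  ultimately show ?R using ex by blast
next
  assume R: ?R
  show ?L
    unfolding local_homeomorphism_def
  proof
    fix x assume "x \<in> topspace X"
    then obtain U where U: "openin X U" "x \<in> U" "inj_on f U" using R by blast
    have fU: "openin Y (f ` U)" using R U(1) unfolding open_map_def by blast
    have tU: "topspace (subtopology X U) = U" using openin_subset[OF U(1)] by auto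
    have "homeomorphic_map (subtopology X U) (subtopology Y (f ` U)) f"
    proof (rule bijective_open_imp_homeomorphic_map)
      show "continuous_map (subtopology X U) (subtopology Y (f ` U)) f"
        using R by (auto simp: continuous_map_in_subtopology continuous_map_from_subtopology)
      show "open_map (subtopology X U) (subtopology Y (f ` U)) f"
        unfolding open_map_def
      proof (intro allI impI)
        fix V assume "openin (subtopology X U) V"
        then have V: "openin X V" "V \<subseteq> U"
          using U(1) openin_trans_full openin_subset tU by (blast, metis openin_subset)
        then have "openin Y (f ` V)" "f ` V = f ` U \<inter> f ` V" using R unfolding open_map_def by auto
        then show "openin (subtopology Y (f ` U)) (f ` V)"
          by (metis openin_subtopology_Int2)
      qed
      show "f ` topspace (subtopology X U) = topspace (subtopology Y (f ` U))"
        using openin_subset[OF fU] tU by auto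
      show "inj_on f (topspace (subtopology X U))" using U(3) tU by simp
    qed
    then show "\<exists>U. openin X U \<and> x \<in> U \<and> openin Y (f ` U) \<and>
        homeomorphic_map (subtopology X U) (subtopology Y (f ` U)) f"
      using U fU by blast
  qed
qed

section \<open>Partial homeomorphisms\<close>

definition partial_inj :: "('x \<rightharpoonup> 'y) \<Rightarrow> bool" where
  "partial_inj f \<longleftrightarrow> (\<forall>x x' y. f x = Some y \<longrightarrow> f x' = Some y \<longrightarrow> x = x')"

text \<open>The instances \<open>V = topspace Y\<close> of the last two conditions say that the domain and the range are
  open.\<close>

definition partial_homeo :: "'y topology \<Rightarrow> ('y \<rightharpoonup> 'y) \<Rightarrow> bool" where
  "partial_homeo Y f \<longleftrightarrow> dom f \<subseteq> topspace Y \<and> ran f \<subseteq> topspace Y \<and> partial_inj f \<and>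
     (\<forall>V. openin Y V \<longrightarrow> openin Y {y. \<exists>z\<in>V. f y = Some z}) \<and>
     (\<forall>V. openin Y V \<longrightarrow> openin Y {z. \<exists>y\<in>V. f y = Some z})"

lemma map_eqI: "(\<And>x y. f x = Some y \<longleftrightarrow> g x = Some y) \<Longrightarrow> f = g"
  by (rule ext, metis option.exhaust)

lemma partial_inverse_Some_iff:
  assumes "partial_inj f"
  shows "partial_inverse f z = Some y \<longleftrightarrow> f y = Some z"
proof -
  have *: "(SOME y. f y = Some z) = y" if "f y = Some z" for y
    using assms that unfolding partial_inj_def by blast
  show ?thesis
  proof (cases "z \<in> ran f")
    case True
    then obtain y' where "f y' = Some z" by (auto simp: ran_def)
    then show ?thesis using *[of y'] assms True
      unfolding partial_inverse_def partial_inj_def by auto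
  next
    case False
    then show ?thesis unfolding partial_inverse_def by (auto simp: ran_def)
  qed
qed

lemma partial_inj_comp: "partial_inj f \<Longrightarrow> partial_inj g \<Longrightarrow> partial_inj (f \<circ>\<^sub>m g)"
  unfolding partial_inj_def map_comp_Some_iff by metis

lemma partial_inj_inverse: "partial_inj f \<Longrightarrow> partial_inj (partial_inverse f)"
  unfolding partial_inj_def[of "partial_inverse f"] by (simp add: partial_inverse_Some_iff)

lemma partial_homeo_comp:
  assumes "partial_homeo Y f" "partial_homeo Y g"
  shows "partial_homeo Y (f \<circ>\<^sub>m g)"
proof -
  have 1: "openin Y {y. \<exists>z\<in>V. (f \<circ>\<^sub>m g) y = Some z}" if "openin Y V" for V
  proof -
    have "{y. \<exists>z\<in>V. (f \<circ>\<^sub>m g) y = Some z} = {y. \<exists>z\<in>{y. \<exists>z\<in>V. f y = Some z}. g y = Some z}"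
      by (auto simp: map_comp_Some_iff)
    then show ?thesis using assms that unfolding partial_homeo_def by auto
  qed
  have 2: "openin Y {z. \<exists>y\<in>V. (f \<circ>\<^sub>m g) y = Some z}" if "openin Y V" for V
  proof -
    have "{z. \<exists>y\<in>V. (f \<circ>\<^sub>m g) y = Some z} = {z. \<exists>y\<in>{z. \<exists>y\<in>V. g y = Some z}. f y = Some z}"
      by (auto simp: map_comp_Some_iff)
    then show ?thesis using assms that unfolding partial_homeo_def by auto
  qed
  have "dom (f \<circ>\<^sub>m g) \<subseteq> topspace Y" "ran (f \<circ>\<^sub>m g) \<subseteq> topspace Y"
    using assms unfolding partial_homeo_def by (auto simp: map_comp_Some_iff dom_def ran_def)
  then show ?thesis
    using assms 1 2 by (auto simp: partial_homeo_def intro: partial_inj_comp)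
qed

lemma partial_homeo_inverse:
  assumes "partial_homeo Y f"
  shows "partial_homeo Y (partial_inverse f)"
proof -
  have f: "partial_inj f" using assms unfolding partial_homeo_def by auto
  show ?thesis
    using assms partial_inj_inverse[OF f] unfolding partial_homeo_def
    by (simp add: partial_inverse_Some_iff[OF f] dom_def ran_def)
qed

lemma partial_homeo_openin_dom:
  assumes "partial_homeo Y f"
  shows "openin Y (dom f)"
proof -
  have "dom f = {y. \<exists>z\<in>topspace Y. f y = Some z}"
    using assms unfolding partial_homeo_def dom_def ran_def by auto
  then show ?thesis using assms unfolding partial_homeo_def by (metis openin_topspace)
qed

section \<open>Inverse semigroups given by generators and relations\<close>

locale inverse_semigroup =
  fixes S :: "'s inv_semigroup"
  assumes mult_closed: "a \<in> s_carrier S \<Longrightarrow> b \<in> s_carrier S \<Longrightarrow> s_mult S a b \<in> s_carrier S"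
    and star_closed: "a \<in> s_carrier S \<Longrightarrow> s_star S a \<in> s_carrier S"
    and mult_assoc: "a \<in> s_carrier S \<Longrightarrow> b \<in> s_carrier S \<Longrightarrow> c \<in> s_carrier S \<Longrightarrow>
      s_mult S (s_mult S a b) c = s_mult S a (s_mult S b c)"
    and star_star: "a \<in> s_carrier S \<Longrightarrow> s_star S (s_star S a) = a"
    and star_mult: "a \<in> s_carrier S \<Longrightarrow> b \<in> s_carrier S \<Longrightarrow>
      s_star S (s_mult S a b) = s_mult S (s_star S b) (s_star S a)"
    and regular: "a \<in> s_carrier S \<Longrightarrow> s_mult S (s_mult S a (s_star S a)) a = a"
    and projections_commute: "a \<in> s_carrier S \<Longrightarrow> b \<in> s_carrier S \<Longrightarrow>
      s_mult S (s_mult S a (s_star S a)) (s_mult S b (s_star S b)) =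
      s_mult S (s_mult S b (s_star S b)) (s_mult S a (s_star S a))"
begin

abbreviation mult (infixl "\<odot>" 70) where "a \<odot> b \<equiv> s_mult S a b"
abbreviation star ("_\<^sup>\<star>" [1000] 999) where "a\<^sup>\<star> \<equiv> s_star S a"
abbreviation "carr \<equiv> s_carrier S"
abbreviation "idem \<equiv> s_idempotents S"

lemmas closed = mult_closed star_closed

lemma idem_carr: "e \<in> idem \<Longrightarrow> e \<in> carr"
  by (simp add: s_idempotents_def)

lemma idem_idem: "e \<in> idem \<Longrightarrow> e \<odot> e = e"
  by (simp add: s_idempotents_def)

lemma range_idem: "a \<in> carr \<Longrightarrow> a \<odot> a\<^sup>\<star> \<in> idem"
  by (simp add: s_idempotents_def closed regular mult_assoc[symmetric])

lemma source_idem: "a \<in> carr \<Longrightarrow> a\<^sup>\<star> \<odot> a \<in> idem"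
  using range_idem[of "a\<^sup>\<star>"] by (simp add: star_star closed)

text \<open>Writing \<open>e\<^sup>\<star> = (e\<^sup>\<star> e) (e e\<^sup>\<star>)\<close> and commuting the two projections gives
  \<open>e\<^sup>\<star> = e e\<^sup>\<star> e = e\<close>.\<close>

lemma idem_star: assumes "e \<in> idem" shows "e\<^sup>\<star> = e"
proof -
  have e: "e \<in> carr" "e \<odot> e = e" using assms by (auto simp: s_idempotents_def)
  have "e\<^sup>\<star> = e\<^sup>\<star> \<odot> (e \<odot> e) \<odot> e\<^sup>\<star>"
    using regular[of "e\<^sup>\<star>"] e by (simp add: star_star closed)
  also have "\<dots> = (e\<^sup>\<star> \<odot> e) \<odot> (e \<odot> e\<^sup>\<star>)"
    using e(1) by (simp add: mult_assoc closed)
  also have "\<dots> = (e \<odot> e\<^sup>\<star>) \<odot> (e\<^sup>\<star> \<odot> e)"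
    using projections_commute[of "e\<^sup>\<star>" e] e by (simp add: star_star closed)
  also have "\<dots> = e \<odot> (e \<odot> e)\<^sup>\<star> \<odot> e"
    using e(1) by (simp add: mult_assoc star_mult closed)
  also have "\<dots> = e" using e regular by simp
  finally show ?thesis .
qed

lemma idem_commute: assumes "e \<in> idem" "f \<in> idem" shows "e \<odot> f = f \<odot> e"
  using projections_commute[of e f] assms
  by (simp add: idem_star idem_carr idem_idem)

lemma idem_mult: assumes "e \<in> idem" "f \<in> idem" shows "e \<odot> f \<in> idem"
proof -
  have c: "e \<in> carr" "f \<in> carr" using assms idem_carr by auto
  have "(e \<odot> f) \<odot> (e \<odot> f) = e \<odot> (f \<odot> e) \<odot> f" using c by (simp add: mult_assoc closed)
  also have "\<dots> = (e \<odot> e) \<odot> (f \<odot> f)"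
    using c by (simp add: mult_assoc closed idem_commute[OF assms(2,1)])
  finally show ?thesis using assms c by (simp add: s_idempotents_def closed)
qed

lemma idem_conj: assumes "e \<in> idem" "t \<in> carr" shows "t\<^sup>\<star> \<odot> e \<odot> t \<in> idem"
proof -
  have c: "e \<in> carr" using assms idem_carr by auto
  have "t\<^sup>\<star> \<odot> e \<odot> t \<odot> (t\<^sup>\<star> \<odot> e \<odot> t) = t\<^sup>\<star> \<odot> (e \<odot> (t \<odot> t\<^sup>\<star>)) \<odot> (e \<odot> t)"
    using c assms by (simp add: mult_assoc closed)
  also have "\<dots> = t\<^sup>\<star> \<odot> t \<odot> t\<^sup>\<star> \<odot> (e \<odot> e) \<odot> t"
    using c assms by (simp add: mult_assoc closed idem_commute[OF assms(1) range_idem[OF assms(2)]])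
  also have "\<dots> = t\<^sup>\<star> \<odot> e \<odot> t"
    using regular[of "t\<^sup>\<star>"] assms by (simp add: star_star closed idem_idem)
  finally show ?thesis using assms c by (simp add: s_idempotents_def closed)
qed

lemma idem_past: assumes "e \<in> idem" "t \<in> carr" shows "t \<odot> (t\<^sup>\<star> \<odot> e \<odot> t) = e \<odot> t"
proof -
  have c: "e \<in> carr" using assms idem_carr by auto
  have "t \<odot> (t\<^sup>\<star> \<odot> e \<odot> t) = (t \<odot> t\<^sup>\<star>) \<odot> e \<odot> t"
    using c assms by (simp add: mult_assoc closed)
  also have "\<dots> = e \<odot> (t \<odot> t\<^sup>\<star>) \<odot> t"
    using idem_commute[OF assms(1) range_idem[OF assms(2)]] by simp
  also have "\<dots> = e \<odot> (t \<odot> t\<^sup>\<star> \<odot> t)"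
    using c assms by (simp add: mult_assoc closed)
  finally show ?thesis using regular assms by simp
qed

end

definition isg_class ::
  "'u set \<Rightarrow> ('u isg_term \<times> 'u isg_term) set \<Rightarrow> 'u isg_term \<Rightarrow> 'u isg_term set" where
  "isg_class B R t = {t'. isg_eq B R t t'}"

lemma presented_isg_carrier:
  "s_carrier (presented_isg B R) = isg_class B R ` {t. set_isg_term t \<subseteq> B}"
  by (auto simp: presented_isg_def isg_class_def quotient_def)

lemma isg_class_eqI: "isg_eq B R a b \<Longrightarrow> isg_class B R a = isg_class B R b"
  unfolding isg_class_def by (blast intro: isg_eq.sym isg_eq.trans)

lemma isg_class_refl: "set_isg_term a \<subseteq> B \<Longrightarrow> a \<in> isg_class B R a"
  by (simp add: isg_class_def isg_eq.refl)

lemma presented_isg_mult: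
  assumes "set_isg_term a \<subseteq> B" "set_isg_term b \<subseteq> B"
  shows "s_mult (presented_isg B R) (isg_class B R a) (isg_class B R b) = isg_class B R (Mul a b)"
proof -
  have "isg_eq B R (Mul a b) t \<longleftrightarrow>
      (\<exists>a'. isg_eq B R a a' \<and> (\<exists>b'. isg_eq B R b b' \<and> isg_eq B R (Mul a' b') t))" for t
    using isg_eq.refl[OF assms(1)] isg_eq.refl[OF assms(2)] isg_eq.trans[OF isg_eq.mul] by metis
  then show ?thesis
    unfolding presented_isg_def isg_class_def by auto
qed

lemma presented_isg_star:
  assumes "set_isg_term a \<subseteq> B"
  shows "s_star (presented_isg B R) (isg_class B R a) = isg_class B R (Star a)"
proof -
  have "isg_eq B R (Star a) t" if "isg_eq B R a a'" "isg_eq B R (Star a') t" for a' t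
    using isg_eq.trans[OF isg_eq.star[OF that(1)] that(2)] .
  then show ?thesis
    using isg_eq.refl[OF assms(1)] unfolding presented_isg_def isg_class_def by auto
qed

lemma inverse_semigroup_presented_isg: "inverse_semigroup (presented_isg B R)"
proof
  let ?P = "presented_isg B R" and ?c = "isg_class B R"
  have carr: "\<exists>t. set_isg_term t \<subseteq> B \<and> a = ?c t" if "a \<in> s_carrier ?P" for a
    using that unfolding presented_isg_carrier by auto
  have mem: "?c t \<in> s_carrier ?P" if "set_isg_term t \<subseteq> B" for t
    using that unfolding presented_isg_carrier by auto
  note ops = presented_isg_mult presented_isg_star mem
  show "s_mult ?P a b \<in> s_carrier ?P" if "a \<in> s_carrier ?P" "b \<in> s_carrier ?P" for a b
    using carr[OF that(1)] carr[OF that(2)] by (auto simp: ops)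
  show "s_star ?P a \<in> s_carrier ?P" if "a \<in> s_carrier ?P" for a
    using carr[OF that] by (auto simp: ops)
  show "s_mult ?P (s_mult ?P a b) c = s_mult ?P a (s_mult ?P b c)"
    if "a \<in> s_carrier ?P" "b \<in> s_carrier ?P" "c \<in> s_carrier ?P" for a b c
    using carr[OF that(1)] carr[OF that(2)] carr[OF that(3)]
    by (clarsimp simp: ops) (intro isg_class_eqI isg_eq.assoc; assumption)
  show "s_star ?P (s_star ?P a) = a" if "a \<in> s_carrier ?P" for a
    using carr[OF that] by (clarsimp simp: ops) (intro isg_class_eqI isg_eq.star_star; assumption)
  show "s_star ?P (s_mult ?P a b) = s_mult ?P (s_star ?P b) (s_star ?P a)"
    if "a \<in> s_carrier ?P" "b \<in> s_carrier ?P" for a b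
    using carr[OF that(1)] carr[OF that(2)] by (clarsimp simp: ops) (intro isg_class_eqI isg_eq.star_mul; assumption)
  show "s_mult ?P (s_mult ?P a (s_star ?P a)) a = a" if "a \<in> s_carrier ?P" for a
    using carr[OF that] by (clarsimp simp: ops) (intro isg_class_eqI isg_eq.regular; assumption)
  show "s_mult ?P (s_mult ?P a (s_star ?P a)) (s_mult ?P b (s_star ?P b)) =
      s_mult ?P (s_mult ?P b (s_star ?P b)) (s_mult ?P a (s_star ?P a))"
    if "a \<in> s_carrier ?P" "b \<in> s_carrier ?P" for a b
    using carr[OF that(1)] carr[OF that(2)] by (clarsimp simp: ops) (intro isg_class_eqI isg_eq.commute; assumption)
qed

text \<open>Partial injections form an inverse semigroup, so an assignment of partial injections to the
  generators extends to the presented inverse semigroup as soon as it respects the relations.\<close>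

lemma partial_inj_isg_eval:
  assumes "\<And>u. u \<in> B \<Longrightarrow> partial_inj (\<theta> u)" "set_isg_term t \<subseteq> B"
  shows "partial_inj (isg_eval \<theta> t)"
  using assms(2)
  by (induction t) (auto intro: assms(1) partial_inj_comp partial_inj_inverse)

lemma isg_eval_eq:
  assumes inj: "\<And>u. u \<in> B \<Longrightarrow> partial_inj (\<theta> u)"
    and rel: "\<And>a b. (a, b) \<in> R \<Longrightarrow> isg_eval \<theta> a = isg_eval \<theta> b"
    and eq: "isg_eq B R a b"
  shows "isg_eval \<theta> a = isg_eval \<theta> b"
  using eq
proof induction
  case (assoc a b c)
  show ?case by (rule map_eqI) (auto simp: map_comp_Some_iff)
next
  case (star_star a)
  then have "partial_inj (isg_eval \<theta> a)" by (auto intro: partial_inj_isg_eval inj)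
  then show ?case
    by (intro map_eqI) (simp add: partial_inverse_Some_iff partial_inj_inverse)
next
  case (star_mul a b)
  then have "partial_inj (isg_eval \<theta> a)" "partial_inj (isg_eval \<theta> b)"
    by (auto intro: partial_inj_isg_eval inj)
  then show ?case
    by (intro map_eqI)
      (auto simp: partial_inverse_Some_iff partial_inj_inverse partial_inj_comp map_comp_Some_iff)
next
  case (regular a)
  then have "partial_inj (isg_eval \<theta> a)" by (auto intro: partial_inj_isg_eval inj)
  then show ?case
    by (intro map_eqI)
      (auto simp: partial_inverse_Some_iff map_comp_Some_iff partial_inj_def)
next
  case (commute a b)
  then have "partial_inj (isg_eval \<theta> a)" "partial_inj (isg_eval \<theta> b)"
    by (auto intro: partial_inj_isg_eval inj)
  then have "(isg_eval \<theta> c \<circ>\<^sub>m partial_inverse (isg_eval \<theta> c)) x = Some y \<longleftrightarrow>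
      x = y \<and> x \<in> ran (isg_eval \<theta> c)" if "c \<in> {a, b}" for c x y
    using that by (auto simp: map_comp_Some_iff partial_inverse_Some_iff ran_def)
  then show ?case
    by (intro map_eqI) (auto simp: map_comp_Some_iff[of "isg_eval \<theta> _ \<circ>\<^sub>m partial_inverse (isg_eval \<theta> _)"])
qed (auto simp: rel)

section \<open>The transformation groupoid of an inverse semigroup action\<close>

locale isg_action = inverse_semigroup S
  for S :: "'s inv_semigroup" and Y :: "'y topology" and \<theta> :: "'s \<Rightarrow> 'y \<rightharpoonup> 'y" +
  assumes homeo: "t \<in> s_carrier S \<Longrightarrow> partial_homeo Y (\<theta> t)"
    and act_mult: "t \<in> s_carrier S \<Longrightarrow> u \<in> s_carrier S \<Longrightarrow> \<theta> (s_mult S t u) = \<theta> t \<circ>\<^sub>m \<theta> u"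
    and act_star: "t \<in> s_carrier S \<Longrightarrow> \<theta> (s_star S t) = partial_inverse (\<theta> t)"
    and cover: "y \<in> topspace Y \<Longrightarrow> \<exists>t\<in>s_carrier S. y \<in> dom (\<theta> t)"
begin

abbreviation "T \<equiv> transformation_groupoid S Y \<theta>"
abbreviation "arrows \<equiv> topspace (g_arr T)"
abbreviation "gm \<equiv> germ S \<theta>"
abbreviation "im t y \<equiv> the (\<theta> t y)"

lemma act_inj: "t \<in> carr \<Longrightarrow> \<theta> t y = Some z \<Longrightarrow> \<theta> t y' = Some z \<Longrightarrow> y = y'"
  using homeo unfolding partial_homeo_def partial_inj_def by blast

lemma act_star_iff: "t \<in> carr \<Longrightarrow> \<theta> (t\<^sup>\<star>) z = Some y \<longleftrightarrow> \<theta> t y = Some z"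
  using homeo[of t] act_star[of t] unfolding partial_homeo_def by (simp add: partial_inverse_Some_iff)

lemma act_mult_iff: "t \<in> carr \<Longrightarrow> u \<in> carr \<Longrightarrow>
    \<theta> (t \<odot> u) y = Some z \<longleftrightarrow> (\<exists>x. \<theta> u y = Some x \<and> \<theta> t x = Some z)"
  by (simp add: act_mult map_comp_Some_iff)

lemma dom_top: "t \<in> carr \<Longrightarrow> y \<in> dom (\<theta> t) \<Longrightarrow> y \<in> topspace Y"
  using homeo unfolding partial_homeo_def by blast

lemma im_top: "t \<in> carr \<Longrightarrow> y \<in> dom (\<theta> t) \<Longrightarrow> im t y \<in> topspace Y"
  using homeo[of t] unfolding partial_homeo_def by (auto simp: ran_def)

lemma open_dom: "t \<in> carr \<Longrightarrow> openin Y (dom (\<theta> t))"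
  using homeo partial_homeo_openin_dom by blast

lemma open_preim: "t \<in> carr \<Longrightarrow> openin Y V \<Longrightarrow> openin Y {y \<in> dom (\<theta> t). im t y \<in> V}"
proof -
  assume *: "t \<in> carr" "openin Y V"
  have "{y \<in> dom (\<theta> t). im t y \<in> V} = {y. \<exists>z\<in>V. \<theta> t y = Some z}" by auto
  then show ?thesis using homeo[OF *(1)] *(2) unfolding partial_homeo_def by auto
qed

lemma open_im: "t \<in> carr \<Longrightarrow> openin Y V \<Longrightarrow> openin Y (im t ` (V \<inter> dom (\<theta> t)))"
proof -
  assume *: "t \<in> carr" "openin Y V"
  have "im t ` (V \<inter> dom (\<theta> t)) = {z. \<exists>y\<in>V. \<theta> t y = Some z}" by force
  then show ?thesis using homeo[OF *(1)] *(2) unfolding partial_homeo_def by auto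
qed

text \<open>Since \<open>e e = e\<close>, both \<open>y\<close> and its image \<open>z\<close> are mapped to \<open>z\<close>, and \<open>\<theta> e\<close> is injective.\<close>

lemma act_idem: assumes "e \<in> idem" "\<theta> e y = Some z" shows "z = y"
proof -
  have "\<theta> (e \<odot> e) y = Some z" using assms by (simp add: idem_idem)
  then obtain x where "\<theta> e y = Some x" "\<theta> e x = Some z"
    using act_mult_iff idem_carr[OF assms(1)] by blast
  then show ?thesis using assms act_inj[of e] idem_carr by auto
qed

lemma act_mult_idem:
  assumes "t \<in> carr" "e \<in> idem" "y \<in> dom (\<theta> e)"
  shows "\<theta> (t \<odot> e) y = \<theta> t y"
proof -
  obtain z where "\<theta> e y = Some z" using assms(3) by auto
  then show ?thesis using act_mult[OF assms(1) idem_carr[OF assms(2)]] act_idem[OF assms(2)] by auto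
qed

lemma dom_idem_mult:
  assumes "e \<in> idem" "f \<in> idem" "y \<in> dom (\<theta> e)" "y \<in> dom (\<theta> f)"
  shows "y \<in> dom (\<theta> (e \<odot> f))"
  using assms act_mult_idem[of e f y] by (auto simp: idem_carr)

lemma cover_idem: assumes "y \<in> topspace Y" shows "\<exists>e\<in>idem. y \<in> dom (\<theta> e)"
proof -
  obtain t z where t: "t \<in> carr" "\<theta> t y = Some z" using cover[OF assms] by auto
  then have "\<theta> (t\<^sup>\<star> \<odot> t) y = Some y" by (simp add: act_mult_iff act_star_iff closed)
  then show ?thesis using source_idem[OF t(1)] by blast
qed

lemma germ_iff: "p \<in> gm t y \<longleftrightarrow> snd p = y \<and> fst p \<in> carr \<and> y \<in> dom (\<theta> (fst p)) \<and>
    (\<exists>e\<in>idem. y \<in> dom (\<theta> e) \<and> t \<odot> e = fst p \<odot> e)"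
  unfolding germ_def by (cases p) auto

lemma germ_refl: assumes "t \<in> carr" "y \<in> dom (\<theta> t)" shows "(t, y) \<in> gm t y"
  using assms cover_idem[OF dom_top[OF assms]] by (auto simp: germ_iff)

lemma germ_eq_iff:
  assumes "t \<in> carr" "y \<in> dom (\<theta> t)" "u \<in> carr" "y' \<in> dom (\<theta> u)"
  shows "gm t y = gm u y' \<longleftrightarrow>
    y = y' \<and> (\<exists>e\<in>idem. y \<in> dom (\<theta> e) \<and> t \<odot> e = u \<odot> e)"
proof
  assume "gm t y = gm u y'"
  then have "(u, y') \<in> gm t y" using germ_refl[OF assms(3,4)] by simp
  then show "y = y' \<and> (\<exists>e\<in>idem. y \<in> dom (\<theta> e) \<and> t \<odot> e = u \<odot> e)"
    by (auto simp: germ_iff)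
next
  have sub: "gm u y \<subseteq> gm t y"
    if t: "t \<in> carr" and u: "u \<in> carr" and e: "e \<in> idem" "y \<in> dom (\<theta> e)" "t \<odot> e = u \<odot> e"
    for t u e
  proof
    fix p assume p: "p \<in> gm u y"
    then obtain f where f: "f \<in> idem" "y \<in> dom (\<theta> f)" "u \<odot> f = fst p \<odot> f" "fst p \<in> carr"
      by (auto simp: germ_iff)
    have c: "e \<in> carr" "f \<in> carr" using e f idem_carr by auto
    have "t \<odot> (e \<odot> f) = u \<odot> (e \<odot> f)"
      using c t u e by (simp add: mult_assoc[symmetric])
    also have "\<dots> = u \<odot> (f \<odot> e)" using idem_commute[OF e(1) f(1)] by simp
    also have "\<dots> = fst p \<odot> (f \<odot> e)"
      using c f u by (simp add: mult_assoc[symmetric])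
    also have "\<dots> = fst p \<odot> (e \<odot> f)" using idem_commute[OF e(1) f(1)] by simp
    finally have "t \<odot> (e \<odot> f) = fst p \<odot> (e \<odot> f)" .
    then show "p \<in> gm t y"
      using p idem_mult[OF e(1) f(1)] dom_idem_mult[OF e(1) f(1) e(2) f(2)]
      unfolding germ_iff by blast
  qed
  assume "y = y' \<and> (\<exists>e\<in>idem. y \<in> dom (\<theta> e) \<and> t \<odot> e = u \<odot> e)"
  then obtain e where e: "e \<in> idem" "y \<in> dom (\<theta> e)" "t \<odot> e = u \<odot> e" "y = y'" by auto
  show "gm t y = gm u y'"
    using sub[OF assms(1,3) e(1-3)] sub[OF assms(3,1) e(1,2) e(3)[symmetric]] e(4) by auto
qed

lemma germ_restrict:
  assumes "t \<in> carr" "e \<in> idem" "y \<in> dom (\<theta> e)" "y \<in> dom (\<theta> t)"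
  shows "gm (t \<odot> e) y = gm t y"
proof -
  have "t \<odot> e \<odot> e = t \<odot> e" using assms by (simp add: mult_assoc idem_carr idem_idem)
  then show ?thesis
    using assms act_mult_idem[OF assms(1-3)]
    by (subst germ_eq_iff) (auto simp: closed idem_carr)
qed

lemma germ_eq_act:
  assumes "t \<in> carr" "y \<in> dom (\<theta> t)" "u \<in> carr" "y \<in> dom (\<theta> u)" "gm t y = gm u y"
  shows "\<theta> t y = \<theta> u y"
proof -
  obtain e where "e \<in> idem" "y \<in> dom (\<theta> e)" "t \<odot> e = u \<odot> e"
    using germ_eq_iff[OF assms(1-4)] assms(5) by auto
  then show ?thesis using act_mult_idem[of t e y] act_mult_idem[of u e y] assms by simp
qed

text \<open>The groupoid operations are defined through a chosen representative of a germ.\<close>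

lemma germ_some:
  assumes "t \<in> carr" "y \<in> dom (\<theta> t)" "p = (SOME p. p \<in> gm t y)"
  shows "snd p = y" "fst p \<in> carr" "y \<in> dom (\<theta> (fst p))" "gm (fst p) y = gm t y"
    "\<theta> (fst p) y = \<theta> t y"
proof -
  have "p \<in> gm t y" using germ_refl[OF assms(1,2)] assms(3) by (metis someI_ex)
  then obtain e where e: "snd p = y" "fst p \<in> carr" "y \<in> dom (\<theta> (fst p))"
    "e \<in> idem" "y \<in> dom (\<theta> e)" "t \<odot> e = fst p \<odot> e"
    by (auto simp: germ_iff)
  then show "snd p = y" "fst p \<in> carr" "y \<in> dom (\<theta> (fst p))" by auto
  show "gm (fst p) y = gm t y"
    using germ_eq_iff[OF assms(1,2) e(2,3)] e by auto
  then show "\<theta> (fst p) y = \<theta> t y" using germ_eq_act[OF e(2,3) assms(1,2)] by simp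
qed

lemma T_obj: "g_obj T = Y" by (simp add: transformation_groupoid_def)

lemma T_src: assumes "t \<in> carr" "y \<in> dom (\<theta> t)" shows "g_src T (gm t y) = y"
  using germ_some(1)[OF assms HOL.refl]
  by (simp add: transformation_groupoid_def case_prod_beta Let_def)

lemma T_rng: assumes "t \<in> carr" "y \<in> dom (\<theta> t)" shows "g_rng T (gm t y) = im t y"
  using germ_some[OF assms HOL.refl]
  by (simp add: transformation_groupoid_def case_prod_beta Let_def)

text \<open>Let \<open>t e = t' e\<close> and \<open>u f = u' f\<close>.  The idempotent \<open>d = t\<^sup>\<star> f t\<close> satisfies \<open>t d = f t\<close>, so that
  \<open>u t d e = u f t e\<close>, and here \<open>u\<close> and \<open>t\<close> may be replaced by \<open>u'\<close> and \<open>t'\<close>.\<close>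

lemma germ_mult_cong:
  assumes "t \<in> carr" "\<theta> t y = Some z" "t' \<in> carr" "\<theta> t' y = Some z"
    "u \<in> carr" "z \<in> dom (\<theta> u)" "u' \<in> carr" "z \<in> dom (\<theta> u')"
    and tt: "gm t y = gm t' y" and uu: "gm u z = gm u' z"
  shows "gm (u \<odot> t) y = gm (u' \<odot> t') y"
proof -
  obtain e where e: "e \<in> idem" "y \<in> dom (\<theta> e)" "t \<odot> e = t' \<odot> e"
    using tt assms germ_eq_iff[of t y t' y] by auto
  obtain f where f: "f \<in> idem" "z \<in> dom (\<theta> f)" "u \<odot> f = u' \<odot> f"
    using uu assms germ_eq_iff[of u z u' z] by auto
  have c: "e \<in> carr" "f \<in> carr" using e f idem_carr by auto
  define d where "d = t\<^sup>\<star> \<odot> f \<odot> t"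
  have d: "d \<in> idem" "d \<in> carr" using idem_conj[OF f(1) assms(1)] idem_carr d_def by auto
  have "\<theta> f z = Some z" using f(2) act_idem[OF f(1)] by auto
  then have "\<theta> d y = Some y"
    unfolding d_def using assms(1,2) c by (simp add: act_mult_iff act_star_iff closed)
  then have yd: "y \<in> dom (\<theta> d)" by auto
  have td: "t \<odot> d = f \<odot> t" unfolding d_def by (rule idem_past[OF f(1) assms(1)])
  have "u \<odot> t \<odot> (d \<odot> e) = u \<odot> (t \<odot> d) \<odot> e"
    using assms c d by (simp add: mult_assoc closed)
  also have "\<dots> = (u \<odot> f) \<odot> t \<odot> e"
    using assms c d by (simp add: td mult_assoc closed)
  also have "\<dots> = u' \<odot> (f \<odot> t) \<odot> e"
    using assms c d f(3) by (simp add: mult_assoc closed)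
  also have "\<dots> = u' \<odot> (t \<odot> (d \<odot> e))"
    using assms c d by (simp add: td[symmetric] mult_assoc closed)
  also have "\<dots> = u' \<odot> (t \<odot> (e \<odot> d))" using idem_commute[OF d(1) e(1)] by simp
  also have "\<dots> = u' \<odot> (t' \<odot> e) \<odot> d"
    using assms c d e(3) by (simp add: mult_assoc[symmetric] closed)
  also have "\<dots> = u' \<odot> t' \<odot> (e \<odot> d)"
    using assms c d by (simp add: mult_assoc closed)
  also have "\<dots> = u' \<odot> t' \<odot> (d \<odot> e)" using idem_commute[OF d(1) e(1)] by simp
  finally have eq: "u \<odot> t \<odot> (d \<odot> e) = u' \<odot> t' \<odot> (d \<odot> e)" .
  have dom: "y \<in> dom (\<theta> (u \<odot> t))" "y \<in> dom (\<theta> (u' \<odot> t'))"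
    using assms by (auto simp: act_mult map_comp_Some_iff closed)
  show ?thesis
    using eq dom idem_mult[OF d(1) e(1)] dom_idem_mult[OF d(1) e(1) yd e(2)] assms
    by (subst germ_eq_iff) (auto simp: closed)
qed

lemma T_mult:
  assumes "t \<in> carr" "\<theta> t y = Some z" "u \<in> carr" "z \<in> dom (\<theta> u)"
  shows "g_mult T (gm u z) (gm t y) = gm (u \<odot> t) y"
proof -
  define p where "p = (SOME p. p \<in> gm u z)"
  define q where "q = (SOME p. p \<in> gm t y)"
  have y: "y \<in> dom (\<theta> t)" using assms by auto
  note q = germ_some[OF assms(1) y q_def] and p = germ_some[OF assms(3,4) p_def]
  have "g_mult T (gm u z) (gm t y) = gm (fst p \<odot> fst q) y"
    using q(1) by (simp add: transformation_groupoid_def case_prod_beta Let_def p_def q_def)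
  also have "\<dots> = gm (u \<odot> t) y"
    using q p assms by (intro germ_mult_cong) auto
  finally show ?thesis .
qed

text \<open>If \<open>t e = t' e\<close>, then the idempotent \<open>f = t e t\<^sup>\<star> = t' e t'\<^sup>\<star>\<close> satisfies
  \<open>t\<^sup>\<star> f = (t e)\<^sup>\<star> = t'\<^sup>\<star> f\<close>.\<close>

lemma germ_star_cong:
  assumes "t \<in> carr" "\<theta> t y = Some z" "t' \<in> carr" "\<theta> t' y = Some z" "gm t y = gm t' y"
  shows "gm (t\<^sup>\<star>) z = gm (t'\<^sup>\<star>) z"
proof -
  obtain e where e: "e \<in> idem" "y \<in> dom (\<theta> e)" "t \<odot> e = t' \<odot> e"
    using assms germ_eq_iff[of t y t' y] by auto
  have c: "e \<in> carr" using e idem_carr by auto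
  define f where "f = t \<odot> e \<odot> t\<^sup>\<star>"
  have f: "f = t' \<odot> e \<odot> t'\<^sup>\<star>"
  proof -
    have *: "s \<odot> e \<odot> s\<^sup>\<star> = (s \<odot> e) \<odot> (s \<odot> e)\<^sup>\<star>" if "s \<in> carr" for s
      using that c idem_idem[OF e(1)]
      by (simp add: star_mult idem_star[OF e(1)] mult_assoc closed) (simp add: mult_assoc[symmetric] closed)
    show ?thesis unfolding f_def using *[OF assms(1)] *[OF assms(3)] e(3) by simp
  qed
  have fi: "f \<in> idem"
    using idem_conj[of e "t\<^sup>\<star>"] e assms unfolding f_def by (simp add: star_star closed)
  have past: "s\<^sup>\<star> \<odot> (s \<odot> e \<odot> s\<^sup>\<star>) = (s \<odot> e)\<^sup>\<star>" if "s \<in> carr" for s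
    using idem_past[of e "s\<^sup>\<star>"] that e c
    by (simp add: star_star star_mult closed idem_star)
  have "\<theta> e y = Some y" using e(2) act_idem[OF e(1)] by auto
  then have "\<theta> f z = Some z"
    unfolding f_def using assms c by (simp add: act_mult_iff act_star_iff closed) blast
  moreover have "t\<^sup>\<star> \<odot> f = t'\<^sup>\<star> \<odot> f"
    using past[OF assms(1)] past[OF assms(3)] e(3) f f_def by metis
  moreover have "\<theta> (t\<^sup>\<star>) z = Some y" "\<theta> (t'\<^sup>\<star>) z = Some y"
    using assms by (auto simp: act_star_iff)
  ultimately show ?thesis
    using fi assms by (subst germ_eq_iff) (auto simp: closed)
qed

lemma T_inv:
  assumes "t \<in> carr" "\<theta> t y = Some z"
  shows "g_inv T (gm t y) = gm (t\<^sup>\<star>) z"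
proof -
  define q where "q = (SOME p. p \<in> gm t y)"
  have y: "y \<in> dom (\<theta> t)" using assms by auto
  note q = germ_some[OF assms(1) y q_def]
  have "g_inv T (gm t y) = gm ((fst q)\<^sup>\<star>) z"
    using q assms by (simp add: transformation_groupoid_def case_prod_beta Let_def q_def)
  also have "\<dots> = gm (t\<^sup>\<star>) z"
    using q assms by (intro germ_star_cong) auto
  finally show ?thesis .
qed

lemma germ_idem_eq:
  assumes "e \<in> idem" "y \<in> dom (\<theta> e)" "f \<in> idem" "y \<in> dom (\<theta> f)"
  shows "gm e y = gm f y"
  using germ_restrict[of e f y] germ_restrict[of f e y] assms idem_commute[of e f]
  by (simp add: idem_carr)

lemma T_unit:
  assumes "e \<in> idem" "y \<in> dom (\<theta> e)"
  shows "g_unit T y = gm e y"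
proof -
  define f where "f = (SOME e. e \<in> idem \<and> y \<in> dom (\<theta> e))"
  have "f \<in> idem \<and> y \<in> dom (\<theta> f)"
    unfolding f_def by (rule someI[of _ e]) (use assms in auto)
  then show ?thesis
    using germ_idem_eq[OF assms, of f] by (simp add: transformation_groupoid_def flip: f_def)
qed

lemma T_arrows: "arrows = {gm t y | t y. t \<in> carr \<and> y \<in> dom (\<theta> t)}"
proof -
  have "\<Union>{{gm t y | y. y \<in> W} | t W. t \<in> carr \<and> openin Y W \<and> W \<subseteq> dom (\<theta> t)} =
      {gm t y | t y. t \<in> carr \<and> y \<in> dom (\<theta> t)}" (is "?L = ?R")
  proof
    show "?L \<subseteq> ?R" by blast
    show "?R \<subseteq> ?L"
    proof
      fix c assume "c \<in> ?R"
      then obtain t y where "t \<in> carr" "y \<in> dom (\<theta> t)" "c = gm t y" by auto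
      then show "c \<in> ?L" using open_dom[of t] by blast
    qed
  qed
  then show ?thesis by (simp add: transformation_groupoid_def)
qed

lemma arrow_cases:
  assumes "c \<in> arrows"
  obtains t y z where "t \<in> carr" "\<theta> t y = Some z" "c = gm t y" "y \<in> dom (\<theta> t)"
    "g_src T c = y" "g_rng T c = z" "y \<in> topspace Y" "z \<in> topspace Y"
proof -
  obtain t y where t: "t \<in> carr" "y \<in> dom (\<theta> t)" "c = gm t y" using assms T_arrows by auto
  then show thesis
    using that[of t y "im t y"] T_src T_rng dom_top im_top by auto
qed

lemma germ_arrow: "t \<in> carr \<Longrightarrow> y \<in> dom (\<theta> t) \<Longrightarrow> gm t y \<in> arrows"
  using T_arrows by auto

lemma T_src_Some: "t \<in> carr \<Longrightarrow> \<theta> t y = Some z \<Longrightarrow> g_src T (gm t y) = y"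
  and T_rng_Some: "t \<in> carr \<Longrightarrow> \<theta> t y = Some z \<Longrightarrow> g_rng T (gm t y) = z"
  using T_src[of t y] T_rng[of t y] by auto

lemma openin_T_slice:
  assumes "t \<in> carr" "openin Y V" "V \<subseteq> dom (\<theta> t)"
  shows "openin (g_arr T) (gm t ` V)"
proof -
  have "gm t ` V = {gm t y | y. y \<in> V}" by auto
  moreover have "gm t ` V \<in> {{gm t y | y. y \<in> W} | t W. t \<in> carr \<and> openin Y W \<and> W \<subseteq> dom (\<theta> t)}"
    using assms calculation by blast
  ultimately show ?thesis
    unfolding transformation_groupoid_def by (simp add: topology_generated_by_Basis)
qed

text \<open>Two slices \<open>y \<mapsto> [t, y]\<close> and \<open>y \<mapsto> [u, y]\<close> agree on the union of the open sets \<open>dom (\<theta> e)\<close> with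
  \<open>t e = u e\<close>.  Therefore the basic open sets generate the final topology for the slices, and maps
  out of the groupoid are continuous once they are so along each slice.\<close>

lemma openin_T:
  "openin (g_arr T) U \<longleftrightarrow> U \<subseteq> arrows \<and>
     (\<forall>t\<in>carr. openin Y {y \<in> dom (\<theta> t). gm t y \<in> U})" (is "?L \<longleftrightarrow> ?R")
proof
  assume L: ?L
  define \<B> where "\<B> = {{gm t y | y. y \<in> W} | t W. t \<in> carr \<and> openin Y W \<and> W \<subseteq> dom (\<theta> t)}"
  have "generate_topology_on \<B> U"
    using L by (simp add: transformation_groupoid_def openin_topology_generated_by_iff \<B>_def)
  then have "openin Y {y \<in> dom (\<theta> t). gm t y \<in> U}" if "t \<in> carr" for t
  proof induction
    case (Int A B)
    have *: "{y \<in> dom (\<theta> t). gm t y \<in> A \<inter> B} =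
        {y \<in> dom (\<theta> t). gm t y \<in> A} \<inter> {y \<in> dom (\<theta> t). gm t y \<in> B}" by auto
    show ?case using Int.IH unfolding * by (rule openin_Int)
  next
    case (UN K)
    have "{y \<in> dom (\<theta> t). gm t y \<in> \<Union>K} = \<Union>{{y \<in> dom (\<theta> t). gm t y \<in> k} | k. k \<in> K}" by auto
    then show ?case using UN by auto
  next
    case (Basis B)
    then obtain u W where u: "B = {gm u y | y. y \<in> W}" "u \<in> carr" "openin Y W" "W \<subseteq> dom (\<theta> u)"
      unfolding \<B>_def by auto
    have "{y \<in> dom (\<theta> t). gm t y \<in> B} =
        \<Union>{dom (\<theta> t) \<inter> W \<inter> dom (\<theta> e) | e. e \<in> idem \<and> t \<odot> e = u \<odot> e}" (is "_ = ?U")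
    proof (intro equalityI subsetI)
      fix y assume "y \<in> {y \<in> dom (\<theta> t). gm t y \<in> B}"
      then obtain y' where y: "y \<in> dom (\<theta> t)" "y' \<in> W" "gm t y = gm u y'" using u(1) by auto
      then have "y' \<in> dom (\<theta> u)" using u(4) by blast
      then have "y = y'" "\<exists>e\<in>idem. y \<in> dom (\<theta> e) \<and> t \<odot> e = u \<odot> e"
        using germ_eq_iff[OF that y(1) u(2)] y(3) by blast+
      then show "y \<in> ?U" using y by blast
    next
      fix y assume "y \<in> ?U"
      then obtain e where y: "y \<in> dom (\<theta> t)" "y \<in> W" "y \<in> dom (\<theta> e)" "e \<in> idem" "t \<odot> e = u \<odot> e"
        by blast
      then have "y \<in> dom (\<theta> u)" using u(4) by blast
      then have "gm t y = gm u y" using germ_eq_iff[OF that y(1) u(2), of y] y by blast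
      then show "y \<in> {y \<in> dom (\<theta> t). gm t y \<in> B}" using u(1) y by blast
    qed
    moreover have "openin Y (dom (\<theta> t) \<inter> W \<inter> dom (\<theta> e))" if "e \<in> idem" for e
      using open_dom[OF \<open>t \<in> carr\<close>] open_dom[OF idem_carr[OF that]] u(3) by blast
    then have "openin Y ?U" by (intro openin_Union) blast
    ultimately show ?case by simp
  qed auto
  then show ?R using openin_subset[OF L] by auto
next
  assume R: ?R
  have slice: "openin (g_arr T) (gm t ` {y \<in> dom (\<theta> t). gm t y \<in> U})" if "t \<in> carr" for t
    using R that by (intro openin_T_slice[OF that]) simp_all
  have "U = (\<Union>t\<in>carr. gm t ` {y \<in> dom (\<theta> t). gm t y \<in> U})"
  proof (intro equalityI subsetI)
    fix c assume c: "c \<in> U"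
    then have "c \<in> arrows" using R by (simp add: subset_iff)
    then obtain t y where "t \<in> carr" "y \<in> dom (\<theta> t)" "c = gm t y" unfolding T_arrows by blast
    then show "c \<in> (\<Union>t\<in>carr. gm t ` {y \<in> dom (\<theta> t). gm t y \<in> U})" using c by blast
  qed blast
  moreover have "openin (g_arr T) (\<Union>t\<in>carr. gm t ` {y \<in> dom (\<theta> t). gm t y \<in> U})"
    using slice by (intro openin_Union) auto
  ultimately show ?L by simp
qed

lemma continuous_map_T:
  assumes "\<And>t y. t \<in> carr \<Longrightarrow> y \<in> dom (\<theta> t) \<Longrightarrow> f (gm t y) \<in> topspace Z"
    and "\<And>t V. t \<in> carr \<Longrightarrow> openin Z V \<Longrightarrow> openin Y {y \<in> dom (\<theta> t). f (gm t y) \<in> V}"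
  shows "continuous_map (g_arr T) Z f"
  unfolding continuous_map_def
proof (intro conjI allI impI)
  show "f \<in> arrows \<rightarrow> topspace Z" using assms(1) T_arrows by auto
  fix V assume V: "openin Z V"
  have "{y \<in> dom (\<theta> t). gm t y \<in> {c \<in> arrows. f c \<in> V}} =
      {y \<in> dom (\<theta> t). f (gm t y) \<in> V}" if "t \<in> carr" for t
    using germ_arrow[OF that] by auto
  then show "openin (g_arr T) {c \<in> arrows. f c \<in> V}"
    unfolding openin_T using assms(2)[OF _ V] by auto
qed

lemma T_src_continuous: "continuous_map (g_arr T) Y (g_src T)"
proof (rule continuous_map_T)
  fix t V assume t: "t \<in> carr" and V: "openin Y V"
  have "{y \<in> dom (\<theta> t). g_src T (gm t y) \<in> V} = dom (\<theta> t) \<inter> V"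
    by (auto simp: T_src_Some[OF t])
  then show "openin Y {y \<in> dom (\<theta> t). g_src T (gm t y) \<in> V}" using open_dom[OF t] V by auto
qed (use T_src dom_top in auto)

lemma T_rng_continuous: "continuous_map (g_arr T) Y (g_rng T)"
proof (rule continuous_map_T)
  fix t V assume t: "t \<in> carr" and V: "openin Y V"
  have "{y \<in> dom (\<theta> t). g_rng T (gm t y) \<in> V} = {y \<in> dom (\<theta> t). im t y \<in> V}"
    by (auto simp: T_rng_Some[OF t])
  then show "openin Y {y \<in> dom (\<theta> t). g_rng T (gm t y) \<in> V}" using open_preim[OF t V] by simp
qed (use T_rng im_top in auto)

lemma T_arrow_slice:
  assumes c: "c \<in> arrows"
  shows "\<exists>U. openin (g_arr T) U \<and> c \<in> U \<and> inj_on (g_src T) U \<and> inj_on (g_rng T) U"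
proof -
  obtain t y where t: "t \<in> carr" "y \<in> dom (\<theta> t)" "c = gm t y" using c T_arrows by auto
  have "inj_on (g_src T) (gm t ` dom (\<theta> t))" using T_src[OF t(1)] by (auto simp: inj_on_def)
  moreover have "inj_on (g_rng T) (gm t ` dom (\<theta> t))"
    using T_rng[OF t(1)] act_inj[OF t(1)] by (force simp: inj_on_def)
  ultimately show ?thesis
    using t openin_T_slice[OF t(1) open_dom[OF t(1)]] by blast
qed

lemma T_src_local_homeomorphism: "local_homeomorphism (g_arr T) Y (g_src T)"
proof -
  have "openin Y (g_src T ` U)" if U: "openin (g_arr T) U" for U
  proof -
    have "g_src T ` U = (\<Union>t\<in>carr. {y \<in> dom (\<theta> t). gm t y \<in> U})" (is "_ = ?R")
    proof (intro equalityI subsetI)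
      fix y assume "y \<in> g_src T ` U"
      then obtain c where c: "c \<in> U" "y = g_src T c" by auto
      then have "c \<in> arrows" using openin_subset[OF U] by auto
      then show "y \<in> ?R" by (rule arrow_cases) (use c in auto)
    next
      fix y assume "y \<in> ?R"
      then show "y \<in> g_src T ` U" using T_src by force
    qed
    then show ?thesis using U unfolding openin_T by auto
  qed
  then show ?thesis
    unfolding local_homeomorphism_iff open_map_def using T_src_continuous T_arrow_slice by blast
qed

lemma T_rng_local_homeomorphism: "local_homeomorphism (g_arr T) Y (g_rng T)"
proof -
  have "openin Y (g_rng T ` U)" if U: "openin (g_arr T) U" for U
  proof -
    have "g_rng T ` U = (\<Union>t\<in>carr. im t ` ({y \<in> dom (\<theta> t). gm t y \<in> U} \<inter> dom (\<theta> t)))" (is "_ = ?R")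
    proof (intro equalityI subsetI)
      fix y assume "y \<in> g_rng T ` U"
      then obtain c where c: "c \<in> U" "y = g_rng T c" by auto
      then have "c \<in> arrows" using openin_subset[OF U] by auto
      then show "y \<in> ?R" by (rule arrow_cases) (use c in force)
    next
      fix y assume "y \<in> ?R"
      then show "y \<in> g_rng T ` U" using T_rng by force
    qed
    moreover have "openin Y (im t ` ({y \<in> dom (\<theta> t). gm t y \<in> U} \<inter> dom (\<theta> t)))"
      if "t \<in> carr" for t
      using U that unfolding openin_T by (intro open_im) auto
    ultimately show ?thesis by auto
  qed
  then show ?thesis
    unfolding local_homeomorphism_iff open_map_def using T_rng_continuous T_arrow_slice by blast
qed

text \<open>The source map is a continuous left inverse of the unit map.\<close>

lemma T_unit_embedding: "embedding_map Y (g_arr T) (g_unit T)"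
proof (rule section_imp_embedding_map)
  have unit: "\<exists>e\<in>idem. y \<in> dom (\<theta> e) \<and> g_unit T y = gm e y" if "y \<in> topspace Y" for y
    using cover_idem[OF that] T_unit by blast
  have "continuous_map Y (g_arr T) (g_unit T)"
    unfolding continuous_map_def
  proof (intro conjI allI impI)
    show "g_unit T \<in> topspace Y \<rightarrow> arrows"
      using unit germ_arrow idem_carr by fastforce
    fix U assume U: "openin (g_arr T) U"
    have "{y \<in> topspace Y. g_unit T y \<in> U} = (\<Union>e\<in>idem. {y \<in> dom (\<theta> e). gm e y \<in> U})"
      (is "?L = ?R")
    proof (intro equalityI subsetI)
      fix y assume "y \<in> ?L" then show "y \<in> ?R" using unit by fastforce
    next
      fix y assume "y \<in> ?R" then show "y \<in> ?L" using T_unit dom_top idem_carr by fastforce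
    qed
    then show "openin Y {y \<in> topspace Y. g_unit T y \<in> U}"
      using U idem_carr unfolding openin_T by auto
  qed
  moreover have "g_src T (g_unit T y) = y" if "y \<in> topspace Y" for y
    using unit[OF that] T_src_Some idem_carr by auto
  ultimately show "section_map Y (g_arr T) (g_unit T)"
    unfolding section_map_def retraction_maps_def using T_src_continuous by blast
qed

lemma T_mult_continuous:
  "continuous_map (fibre_product (g_arr T) (g_arr T) (g_src T) (g_rng T)) (g_arr T)
     (\<lambda>(g, h). g_mult T g h)"
proof (rule continuous_map_fibre_productI)
  fix c d assume c: "c \<in> arrows" and d: "d \<in> arrows"
    and cd: "g_src T c = g_rng T d"
  obtain u z x where u: "u \<in> carr" "\<theta> u z = Some x" "c = gm u z" "g_src T c = z"
    by (rule arrow_cases[OF c]) blast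
  obtain t y z' where "t \<in> carr" "\<theta> t y = Some z'" "d = gm t y" "g_rng T d = z'"
    by (rule arrow_cases[OF d]) blast
  then have t: "t \<in> carr" "\<theta> t y = Some z" "d = gm t y" using u cd by auto
  have yt: "y \<in> dom (\<theta> t)" and zu: "z \<in> dom (\<theta> u)" using t u by auto
  have ut: "u \<odot> t \<in> carr" using u t by (simp add: closed)
  have y: "y \<in> dom (\<theta> (u \<odot> t))" using t u by (auto simp: act_mult_iff)
  have m: "g_mult T c d = gm (u \<odot> t) y" using T_mult[OF t(1,2) u(1) zu] u(3) t(3) by simp
  show "g_mult T c d \<in> arrows" using m germ_arrow[OF ut y] by simp
  fix U assume U: "openin (g_arr T) U" "g_mult T c d \<in> U"
  define V where "V = {y \<in> dom (\<theta> (u \<odot> t)). gm (u \<odot> t) y \<in> U} \<inter> dom (\<theta> t)"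
  have V: "openin Y V" using U(1) ut open_dom[OF t(1)] unfolding V_def openin_T by auto
  show "\<exists>U' V'. openin (g_arr T) U' \<and> openin (g_arr T) V' \<and> c \<in> U' \<and> d \<in> V' \<and>
      (\<forall>c'\<in>U'. \<forall>d'\<in>V'. g_src T c' = g_rng T d' \<longrightarrow> g_mult T c' d' \<in> U)"
  proof (rule exI[of _ "gm u ` dom (\<theta> u)"], rule exI[of _ "gm t ` V"], intro conjI ballI impI)
    show "openin (g_arr T) (gm u ` dom (\<theta> u))" "openin (g_arr T) (gm t ` V)"
      using openin_T_slice[OF u(1) open_dom[OF u(1)]] openin_T_slice[OF t(1) V]
      unfolding V_def by auto
    show "c \<in> gm u ` dom (\<theta> u)" using u by auto
    show "d \<in> gm t ` V" using t(3) y yt U(2) m unfolding V_def by auto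
    fix c' d' assume "c' \<in> gm u ` dom (\<theta> u)" "d' \<in> gm t ` V" and cd': "g_src T c' = g_rng T d'"
    then obtain z1 y1 where 1: "z1 \<in> dom (\<theta> u)" "c' = gm u z1" "y1 \<in> V" "d' = gm t y1" by auto
    have yt1: "y1 \<in> dom (\<theta> t)" using 1 V_def by auto
    have "z1 = im t y1" using cd' 1 T_src[OF u(1) 1(1)] T_rng[OF t(1) yt1] by simp
    then have "\<theta> t y1 = Some z1" using yt1 by auto
    then have "g_mult T c' d' = gm (u \<odot> t) y1" using T_mult[OF t(1) _ u(1) 1(1)] 1 by simp
    then show "g_mult T c' d' \<in> U" using 1(3) unfolding V_def by simp
  qed
qed

lemma T_inv_continuous: "continuous_map (g_arr T) (g_arr T) (g_inv T)"
proof (rule continuous_map_T)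
  have inv: "g_inv T (gm t y) = gm (t\<^sup>\<star>) (im t y) \<and> im t y \<in> dom (\<theta> (t\<^sup>\<star>))"
    if "t \<in> carr" "y \<in> dom (\<theta> t)" for t y
    using that T_inv[OF that(1)] act_star_iff[OF that(1)] by fastforce
  show "g_inv T (gm t y) \<in> arrows" if "t \<in> carr" "y \<in> dom (\<theta> t)" for t y
    using inv[OF that] germ_arrow that closed by simp
  fix t V assume t: "t \<in> carr" and V: "openin (g_arr T) V"
  define V' where "V' = {z \<in> dom (\<theta> (t\<^sup>\<star>)). gm (t\<^sup>\<star>) z \<in> V}"
  have "openin Y V'" using V t closed unfolding V'_def openin_T by auto
  moreover have "{y \<in> dom (\<theta> t). g_inv T (gm t y) \<in> V} = {y \<in> dom (\<theta> t). im t y \<in> V'}"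
    unfolding V'_def by (auto simp: T_inv[OF t] act_star_iff[OF t])
  ultimately show "openin Y {y \<in> dom (\<theta> t). g_inv T (gm t y) \<in> V}" using open_preim[OF t] by simp
qed

lemma T_algebra:
  shows "\<And>y. y \<in> topspace Y \<Longrightarrow> g_rng T (g_unit T y) = y \<and> g_src T (g_unit T y) = y"
    and "\<And>c d. c \<in> arrows \<Longrightarrow> d \<in> arrows \<Longrightarrow> g_src T c = g_rng T d \<Longrightarrow>
      g_rng T (g_mult T c d) = g_rng T c \<and> g_src T (g_mult T c d) = g_src T d"
    and "\<And>b c d. b \<in> arrows \<Longrightarrow> c \<in> arrows \<Longrightarrow> d \<in> arrows \<Longrightarrow>
      g_src T b = g_rng T c \<Longrightarrow> g_src T c = g_rng T d \<Longrightarrow>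
      g_mult T (g_mult T b c) d = g_mult T b (g_mult T c d)"
    and "\<And>c. c \<in> arrows \<Longrightarrow>
      g_mult T (g_unit T (g_rng T c)) c = c \<and> g_mult T c (g_unit T (g_src T c)) = c"
    and "\<And>c. c \<in> arrows \<Longrightarrow>
      g_rng T (g_inv T c) = g_src T c \<and> g_src T (g_inv T c) = g_rng T c \<and>
      g_mult T c (g_inv T c) = g_unit T (g_rng T c) \<and> g_mult T (g_inv T c) c = g_unit T (g_src T c)"
proof -
  have unit: "\<exists>e\<in>idem. \<theta> e y = Some y \<and> g_unit T y = gm e y" if "y \<in> topspace Y" for y
    using cover_idem[OF that] T_unit act_idem by blast
  show "g_rng T (g_unit T y) = y \<and> g_src T (g_unit T y) = y" if "y \<in> topspace Y" for y
    using unit[OF that] T_src T_rng idem_carr by fastforce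
  note src = T_src_Some and rng = T_rng_Some
  have mult: "g_mult T (gm u z) (gm t y) = gm (u \<odot> t) y"
    if "t \<in> carr" "\<theta> t y = Some z" "u \<in> carr" "\<theta> u z = Some x" for t y z u x
    using T_mult[OF that(1-3)] that(4) by auto
  show "g_rng T (g_mult T c d) = g_rng T c \<and> g_src T (g_mult T c d) = g_src T d"
    if cd: "c \<in> arrows" "d \<in> arrows" "g_src T c = g_rng T d" for c d
  proof -
    obtain u z x where u: "u \<in> carr" "\<theta> u z = Some x" "c = gm u z" "g_src T c = z" "g_rng T c = x"
      by (rule arrow_cases[OF cd(1)]) blast
    obtain t y z' where t: "t \<in> carr" "\<theta> t y = Some z'" "d = gm t y" "g_rng T d = z'" "g_src T d = y"
      by (rule arrow_cases[OF cd(2)]) blast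
    have z: "z' = z" using u t cd(3) by simp
    have "\<theta> (u \<odot> t) y = Some x" using u t z by (simp add: act_mult_iff)
    then show ?thesis
      using u t z src[of "u \<odot> t" y] rng[of "u \<odot> t" y] mult[of t y z u x] by (simp add: closed)
  qed
  show "g_mult T (g_mult T b c) d = g_mult T b (g_mult T c d)"
    if bcd: "b \<in> arrows" "c \<in> arrows" "d \<in> arrows"
      "g_src T b = g_rng T c" "g_src T c = g_rng T d" for b c d
  proof -
    obtain v x w where v: "v \<in> carr" "\<theta> v x = Some w" "b = gm v x" "g_src T b = x"
      by (rule arrow_cases[OF bcd(1)]) blast
    obtain u z x' where u: "u \<in> carr" "\<theta> u z = Some x'" "c = gm u z" "g_src T c = z" "g_rng T c = x'"
      by (rule arrow_cases[OF bcd(2)]) blast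
    obtain t y z' where t: "t \<in> carr" "\<theta> t y = Some z'" "d = gm t y" "g_rng T d = z'"
      by (rule arrow_cases[OF bcd(3)]) blast
    have eq: "z' = z" "x' = x" using v u t bcd by auto
    have "\<theta> (u \<odot> t) y = Some x" "\<theta> (v \<odot> u) z = Some w"
      using v u t eq by (auto simp: act_mult_iff)
    then show ?thesis
      using v u t eq mult[of t y z u x] mult[of u z x v w] mult[of t y z "v \<odot> u" w]
        mult[of "u \<odot> t" y x v w]
      by (simp add: closed mult_assoc)
  qed
  show "g_mult T (g_unit T (g_rng T c)) c = c \<and> g_mult T c (g_unit T (g_src T c)) = c"
    if c: "c \<in> arrows" for c
  proof -
    obtain t y z where t: "t \<in> carr" "\<theta> t y = Some z" "c = gm t y" "g_src T c = y" "g_rng T c = z"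
      "y \<in> topspace Y" "z \<in> topspace Y"
      by (rule arrow_cases[OF c]) blast
    obtain e where e: "e \<in> idem" "\<theta> e y = Some y" "g_unit T y = gm e y" using unit t by blast
    obtain f where f: "f \<in> idem" "\<theta> f z = Some z" "g_unit T z = gm f z" using unit t by blast
    have 1: "g_mult T c (g_unit T y) = c"
      using mult[of e y y t z] e t germ_restrict[of t e y] by (auto simp: idem_carr)
    define d where "d = t\<^sup>\<star> \<odot> f \<odot> t"
    have d: "d \<in> idem" unfolding d_def by (rule idem_conj[OF f(1) t(1)])
    have "f \<odot> t = t \<odot> d" unfolding d_def by (rule idem_past[OF f(1) t(1), symmetric])
    moreover have "\<theta> d y = Some y"
      unfolding d_def using t f by (simp add: act_mult_iff act_star_iff closed idem_carr)
    ultimately have "gm (f \<odot> t) y = gm t y" using germ_restrict[OF t(1) d, of y] t(2) by auto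
    then have "g_mult T (g_unit T z) c = c"
      using mult[of t y z f z] f t by (auto simp: idem_carr)
    with 1 show ?thesis using t by simp
  qed
  show "g_rng T (g_inv T c) = g_src T c \<and> g_src T (g_inv T c) = g_rng T c \<and>
      g_mult T c (g_inv T c) = g_unit T (g_rng T c) \<and> g_mult T (g_inv T c) c = g_unit T (g_src T c)"
    if c: "c \<in> arrows" for c
  proof -
    obtain t y z where t: "t \<in> carr" "\<theta> t y = Some z" "c = gm t y" "g_src T c = y" "g_rng T c = z"
      "y \<in> topspace Y" "z \<in> topspace Y"
      by (rule arrow_cases[OF c]) blast
    have ts: "\<theta> (t\<^sup>\<star>) z = Some y" "t\<^sup>\<star> \<in> carr" using t by (auto simp: act_star_iff closed)
    have "\<theta> (t\<^sup>\<star> \<odot> t) y = Some y" "\<theta> (t \<odot> t\<^sup>\<star>) z = Some z"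
      using t ts by (auto simp: act_mult_iff)
    then have "g_unit T y = gm (t\<^sup>\<star> \<odot> t) y" "g_unit T z = gm (t \<odot> t\<^sup>\<star>) z"
      using T_unit[OF source_idem[OF t(1)], of y] T_unit[OF range_idem[OF t(1)], of z]
      by (simp_all add: domIff)
    then show ?thesis
      using t ts T_inv[OF t(1,2)] src[OF ts(2,1)] rng[OF ts(2,1)] mult[OF t(1,2) ts(2,1)]
        mult[OF ts(2,1) t(1,2)] by simp
  qed
qed

theorem etale_T: "etale_groupoid T"
  unfolding etale_groupoid_def topological_groupoid_def T_obj
  using T_src_continuous T_rng_continuous T_unit_embedding T_mult_continuous T_inv_continuous
    T_algebra T_src_local_homeomorphism T_rng_local_homeomorphism
  by (intro conjI ballI impI) simp_all

end

section \<open>Actions of the transformation groupoid\<close>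

text \<open>The condition on \<open>dom (\<tau> t)\<close> is the one that makes \<open>\<tau>\<close> factor through germs at \<open>\<rho> z\<close>; it does not
  follow from the intertwining property.\<close>

definition action_over ::
  "'s inv_semigroup \<Rightarrow> 'y topology \<Rightarrow> ('s \<Rightarrow> 'y \<rightharpoonup> 'y) \<Rightarrow> 'z topology \<Rightarrow> ('z \<Rightarrow> 'y)
     \<Rightarrow> ('s \<Rightarrow> 'z \<rightharpoonup> 'z) \<Rightarrow> bool" where
  "action_over S Y \<theta> Z \<rho> \<tau> \<longleftrightarrow>
     continuous_map Z Y \<rho> \<and>
     (\<forall>t\<in>s_carrier S. partial_homeo Z (\<tau> t) \<and>
        \<tau> (s_star S t) = partial_inverse (\<tau> t) \<and>
        (\<forall>z. z \<in> dom (\<tau> t) \<longleftrightarrow> z \<in> topspace Z \<and> \<rho> z \<in> dom (\<theta> t)) \<and>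
        (\<forall>z z'. \<tau> t z = Some z' \<longrightarrow> \<theta> t (\<rho> z) = Some (\<rho> z'))) \<and>
     (\<forall>t\<in>s_carrier S. \<forall>u\<in>s_carrier S. \<tau> (s_mult S t u) = \<tau> t \<circ>\<^sub>m \<tau> u)"

context isg_action
begin

definition action_hom :: "'z topology \<Rightarrow> ('y, ('s \<times> 'y) set, 'z) gaction \<Rightarrow> 's \<Rightarrow> 'z \<rightharpoonup> 'z" where
  "action_hom Z A t z =
     (if z \<in> topspace Z \<and> l_rng A z \<in> dom (\<theta> t) then Some (l_act A (gm t (l_rng A z)) z) else None)"

definition over_action ::
  "'z topology \<Rightarrow> ('z \<Rightarrow> 'y) \<Rightarrow> ('s \<Rightarrow> 'z \<rightharpoonup> 'z) \<Rightarrow> ('y, ('s \<times> 'y) set, 'z) gaction" where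
  "over_action Z \<rho> \<tau> =
     \<lparr>l_rng = \<rho>,
      l_act = (\<lambda>c z. if c \<in> arrows \<and> z \<in> topspace Z \<and> g_src T c = \<rho> z
                     then the (\<tau> (fst (SOME p. p \<in> c)) z) else undefined)\<rparr>"

lemma action_hom_iff: "action_hom Z A t z = Some z' \<longleftrightarrow>
    z \<in> topspace Z \<and> l_rng A z \<in> dom (\<theta> t) \<and> z' = l_act A (gm t (l_rng A z)) z"
  unfolding action_hom_def by auto

text \<open>The arrow \<open>[t\<^sup>\<star>, \<theta>\<^sub>t(\<rho>(z))]\<close> is inverse to \<open>[t, \<rho>(z)]\<close>, so \<open>\<tau>\<close> maps \<open>t\<^sup>\<star>\<close> to the partial inverse of
  \<open>\<tau> t\<close>.  Therefore it is enough to see that preimages of open sets are open, which follows from the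
  continuity of the groupoid action along the slice \<open>y \<mapsto> [t, y]\<close>.\<close>

lemma action_over_action_hom:
  assumes A: "groupoid_action T Z A"
  shows "action_over S Y \<theta> Z (l_rng A) (action_hom Z A)"
proof -
  let ?\<rho> = "l_rng A" and ?\<tau> = "action_hom Z A"
  have space: "left_space T Z ?\<rho> (l_act A)" using A unfolding groupoid_action_def by blast
  have cont: "continuous_map Z Y ?\<rho>"
    and cact: "continuous_map (fibre_product (g_arr T) Z (g_src T) ?\<rho>) Z (\<lambda>(c, z). l_act A c z)"
    and unit: "\<And>z. z \<in> topspace Z \<Longrightarrow> l_act A (g_unit T (?\<rho> z)) z = z"
    using space unfolding left_space_def T_obj by blast+
  have rng: "?\<rho> (l_act A c z) = g_rng T c"
    if "c \<in> arrows" "z \<in> topspace Z" "g_src T c = ?\<rho> z" for c z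
    using space that unfolding left_space_def by blast
  have comp: "l_act A c (l_act A d z) = l_act A (g_mult T c d) z"
    if "c \<in> arrows" "d \<in> arrows" "z \<in> topspace Z"
      "g_src T c = g_rng T d" "g_src T d = ?\<rho> z" for c d z
    using space that unfolding left_space_def by blast
  have val: "z \<in> topspace Z \<and> z' \<in> topspace Z \<and> \<theta> t (?\<rho> z) = Some (?\<rho> z')"
    if t: "t \<in> carr" and z: "?\<tau> t z = Some z'" for t z z'
  proof -
    have z: "z \<in> topspace Z" "?\<rho> z \<in> dom (\<theta> t)" "z' = l_act A (gm t (?\<rho> z)) z"
      using z unfolding action_hom_iff by auto
    have g: "gm t (?\<rho> z) \<in> arrows" "g_src T (gm t (?\<rho> z)) = ?\<rho> z"
      using z(2) t germ_arrow T_src by auto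
    show ?thesis
      using rng[OF g(1) z(1) g(2)] continuous_map_fibre_productD[OF cact g(1) z(1) g(2)] z(2)
        T_rng[OF t z(2)] unfolding z(3) by (auto simp: z(1))
  qed
  have mult: "?\<tau> t z' = Some (l_act A (gm (t \<odot> u) (?\<rho> z)) z)"
    if tu: "t \<in> carr" "u \<in> carr" and z: "?\<tau> u z = Some z'" "?\<rho> z' \<in> dom (\<theta> t)" for t u z z'
  proof -
    have z1: "z \<in> topspace Z" "?\<rho> z \<in> dom (\<theta> u)" "z' = l_act A (gm u (?\<rho> z)) z"
      using z(1) unfolding action_hom_iff by auto
    note z2 = val[OF tu(2) z(1)]
    have "l_act A (gm t (?\<rho> z')) z' = l_act A (g_mult T (gm t (?\<rho> z')) (gm u (?\<rho> z))) z"
      unfolding z1(3)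
      using z1 z2 z(2) tu germ_arrow T_src T_rng_Some[OF tu(2), of "?\<rho> z" "?\<rho> z'"]
      by (intro comp) auto
    also have "g_mult T (gm t (?\<rho> z')) (gm u (?\<rho> z)) = gm (t \<odot> u) (?\<rho> z)"
      using T_mult[OF tu(2) _ tu(1) z(2)] z2 by blast
    finally show ?thesis using z2 z(2) unfolding action_hom_iff by simp
  qed
  have star: "?\<tau> (t\<^sup>\<star>) z' = Some z" if t: "t \<in> carr" and z: "?\<tau> t z = Some z'" for t z z'
  proof -
    note z2 = val[OF t z]
    have s: "\<theta> (t\<^sup>\<star>) (?\<rho> z') = Some (?\<rho> z)" using z2 act_star_iff[OF t] by blast
    then have "\<theta> (t\<^sup>\<star> \<odot> t) (?\<rho> z) = Some (?\<rho> z)" using z2 t by (auto simp: act_mult_iff closed)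
    then have "gm (t\<^sup>\<star> \<odot> t) (?\<rho> z) = g_unit T (?\<rho> z)"
      using T_unit[OF source_idem[OF t], of "?\<rho> z"] by (simp add: domIff)
    then show ?thesis
      using mult[OF star_closed[OF t] t z] s unit z2 by (simp add: domIff)
  qed
  have star_iff: "?\<tau> (t\<^sup>\<star>) z' = Some z \<longleftrightarrow> ?\<tau> t z = Some z'" if t: "t \<in> carr" for t z z'
    using star[OF t, of z z'] star[OF star_closed[OF t], of z' z] star_star[OF t] by auto
  have inj: "partial_inj (?\<tau> t)" if "t \<in> carr" for t
    unfolding partial_inj_def
  proof (intro allI impI)
    fix x x' z assume "?\<tau> t x = Some z" "?\<tau> t x' = Some z"
    then show "x = x'" using star[OF that, of x z] star[OF that, of x' z] by simp
  qed
  have open_preimage: "openin Z {z. \<exists>z'\<in>V. ?\<tau> t z = Some z'}"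
    if t: "t \<in> carr" and V: "openin Z V" for t V
  proof (subst openin_subopen, intro ballI)
    fix z assume "z \<in> {z. \<exists>z'\<in>V. ?\<tau> t z = Some z'}"
    then have z: "z \<in> topspace Z" "?\<rho> z \<in> dom (\<theta> t)" "l_act A (gm t (?\<rho> z)) z \<in> V"
      unfolding action_hom_iff by auto
    obtain U V' where U: "openin (g_arr T) U" "openin Z V'" "gm t (?\<rho> z) \<in> U" "z \<in> V'"
      "\<forall>c\<in>U. \<forall>z\<in>V'. g_src T c = ?\<rho> z \<longrightarrow> l_act A c z \<in> V"
      using continuous_map_fibre_product_box[OF cact V germ_arrow[OF t z(2)] z(1) T_src[OF t z(2)] z(3)]
      by blast
    define N where "N = {z \<in> topspace Z. ?\<rho> z \<in> {y \<in> dom (\<theta> t). gm t y \<in> U}} \<inter> V'"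
    have "openin Z N"
      unfolding N_def using U t unfolding openin_T
      by (intro openin_Int openin_continuous_map_preimage[OF cont]) auto
    moreover have "z \<in> N" using z U unfolding N_def by blast
    moreover have "N \<subseteq> {z. \<exists>z'\<in>V. ?\<tau> t z = Some z'}"
    proof
      fix x assume x: "x \<in> N"
      then have x1: "x \<in> topspace Z" "?\<rho> x \<in> dom (\<theta> t)" "gm t (?\<rho> x) \<in> U" "x \<in> V'"
        unfolding N_def by blast+
      then have "l_act A (gm t (?\<rho> x)) x \<in> V" using U(5) T_src[OF t x1(2)] by blast
      then show "x \<in> {z. \<exists>z'\<in>V. ?\<tau> t z = Some z'}" using x1 unfolding action_hom_iff by blast
    qed
    ultimately show "\<exists>N. openin Z N \<and> z \<in> N \<and> N \<subseteq> {z. \<exists>z'\<in>V. ?\<tau> t z = Some z'}" by blast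
  qed
  have open_image: "openin Z {z'. \<exists>z\<in>V. ?\<tau> t z = Some z'}" if "t \<in> carr" "openin Z V" for t V
    using open_preimage[OF star_closed[OF that(1)] that(2)] star_iff[OF that(1)] by simp
  have homeo: "partial_homeo Z (?\<tau> t)" if t: "t \<in> carr" for t
  proof -
    have "dom (?\<tau> t) \<subseteq> topspace Z" "ran (?\<tau> t) \<subseteq> topspace Z"
      using val[OF t] by (auto simp: dom_def ran_def)
    then show ?thesis
      using open_preimage[OF t] open_image[OF t] inj[OF t] unfolding partial_homeo_def by simp
  qed
  have inverse: "?\<tau> (t\<^sup>\<star>) = partial_inverse (?\<tau> t)" if "t \<in> carr" for t
    by (rule map_eqI) (simp add: partial_inverse_Some_iff[OF inj[OF that]] star_iff[OF that])
  have dom: "z \<in> dom (?\<tau> t) \<longleftrightarrow> z \<in> topspace Z \<and> ?\<rho> z \<in> dom (\<theta> t)" for t z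
    unfolding action_hom_def by (simp add: domIff)
  have prod: "?\<tau> (t \<odot> u) = ?\<tau> t \<circ>\<^sub>m ?\<tau> u" if tu: "t \<in> carr" "u \<in> carr" for t u
  proof (rule map_eqI)
    fix z z'
    show "?\<tau> (t \<odot> u) z = Some z' \<longleftrightarrow> (?\<tau> t \<circ>\<^sub>m ?\<tau> u) z = Some z'"
    proof
      assume z: "?\<tau> (t \<odot> u) z = Some z'"
      then have z1: "z \<in> topspace Z" "z' = l_act A (gm (t \<odot> u) (?\<rho> z)) z" "\<theta> (t \<odot> u) (?\<rho> z) = Some (?\<rho> z')"
        using val[OF mult_closed[OF tu] z] unfolding action_hom_iff by auto
      then obtain y where y: "\<theta> u (?\<rho> z) = Some y" "\<theta> t y = Some (?\<rho> z')"
        using act_mult_iff[OF tu] by blast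
      then obtain x where x: "?\<tau> u z = Some x" using z1(1) dom[of z u] by blast
      then have "?\<rho> x = y" using val[OF tu(2) x] y by simp
      then have "?\<tau> t x = Some z'" using mult[OF tu x] y z1(2) by auto
      then show "(?\<tau> t \<circ>\<^sub>m ?\<tau> u) z = Some z'" using x by simp
    next
      assume "(?\<tau> t \<circ>\<^sub>m ?\<tau> u) z = Some z'"
      then obtain x where x: "?\<tau> u z = Some x" "?\<tau> t x = Some z'" by (auto simp: map_comp_Some_iff)
      note v = val[OF tu(2) x(1)] val[OF tu(1) x(2)]
      have "\<theta> (t \<odot> u) (?\<rho> z) = Some (?\<rho> z')"
        using v act_mult_iff[OF tu] by blast
      then have d: "?\<rho> z \<in> dom (\<theta> (t \<odot> u))" by blast
      have "?\<rho> x \<in> dom (\<theta> t)" using v by blast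
      then show "?\<tau> (t \<odot> u) z = Some z'" using mult[OF tu x(1)] x(2) d v unfolding action_hom_iff by simp
    qed
  qed
  show ?thesis
    unfolding action_over_def using cont homeo inverse dom val prod by blast
qed

lemma isg_action_over:
  assumes over: "action_over S Y \<theta> Z \<rho> \<tau>"
  shows "isg_action S Z \<tau>"
proof
  fix z assume "z \<in> topspace Z"
  moreover from this have "\<rho> z \<in> topspace Y"
    using over continuous_map_funspace unfolding action_over_def by blast
  ultimately show "\<exists>t\<in>carr. z \<in> dom (\<tau> t)"
    using cover[of "\<rho> z"] over unfolding action_over_def by blast
qed (use over in \<open>auto simp: action_over_def\<close>)

text \<open>Germs at \<open>\<rho> z\<close> act on \<open>z\<close> because \<open>\<tau> e\<close> is defined at \<open>z\<close> whenever \<open>\<theta> e\<close> is defined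
  at \<open>\<rho> z\<close>.\<close>

lemma over_germ_eq:
  assumes over: "action_over S Y \<theta> Z \<rho> \<tau>"
    and z: "z \<in> topspace Z" "\<rho> z \<in> dom (\<theta> t)" "\<rho> z \<in> dom (\<theta> u)"
    and tu: "t \<in> carr" "u \<in> carr" "gm t (\<rho> z) = gm u (\<rho> z)"
  shows "\<tau> t z = \<tau> u z"
proof -
  interpret Z: isg_action S Z \<tau> by (rule isg_action_over[OF over])
  obtain e where e: "e \<in> idem" "\<rho> z \<in> dom (\<theta> e)" "t \<odot> e = u \<odot> e"
    using tu(3) germ_eq_iff[OF tu(1) z(2) tu(2) z(3)] by blast
  have "z \<in> dom (\<tau> e)" using over e(2) z(1) idem_carr[OF e(1)] unfolding action_over_def by blast
  then show ?thesis
    using Z.act_mult_idem[OF tu(1) e(1)] Z.act_mult_idem[OF tu(2) e(1)] e(3) by simp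
qed

lemma over_action_germ:
  assumes over: "action_over S Y \<theta> Z \<rho> \<tau>"
    and z: "z \<in> topspace Z" "\<rho> z \<in> dom (\<theta> t)" and t: "t \<in> carr"
  shows "l_act (over_action Z \<rho> \<tau>) (gm t (\<rho> z)) z = the (\<tau> t z)"
proof -
  define p where "p = (SOME p. p \<in> gm t (\<rho> z))"
  note p = germ_some[OF t z(2) p_def]
  have "\<tau> (fst p) z = \<tau> t z" by (rule over_germ_eq[OF over z(1) p(3) z(2) p(2) t p(4)])
  then show ?thesis
    using germ_arrow[OF t z(2)] T_src[OF t z(2)] z(1) by (simp add: over_action_def p_def)
qed

text \<open>Near an arrow \<open>[t, y]\<close>, the action map is \<open>(c, z) \<mapsto> \<tau> t z\<close>; this gives continuity.  The algebraic
  laws are those of \<open>\<tau>\<close>.\<close>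

lemma groupoid_action_over_action:
  assumes over: "action_over S Y \<theta> Z \<rho> \<tau>" and ext: "\<rho> \<in> extensional (topspace Z)"
  shows "groupoid_action T Z (over_action Z \<rho> \<tau>)"
proof -
  interpret Z: isg_action S Z \<tau> by (rule isg_action_over[OF over])
  let ?A = "over_action Z \<rho> \<tau>"
  have cont: "continuous_map Z Y \<rho>" using over unfolding action_over_def by blast
  have dom: "z \<in> dom (\<tau> t) \<longleftrightarrow> z \<in> topspace Z \<and> \<rho> z \<in> dom (\<theta> t)" if "t \<in> carr" for t z
    using over that unfolding action_over_def by blast
  have val: "\<theta> t (\<rho> z) = Some (\<rho> z')" if "t \<in> carr" "\<tau> t z = Some z'" for t z z'
    using over that unfolding action_over_def by blast
  have arr: "\<exists>t z'. t \<in> carr \<and> c = gm t (\<rho> z) \<and> \<rho> z \<in> dom (\<theta> t) \<and> \<tau> t z = Some z' \<and>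
      g_rng T c = \<rho> z' \<and> l_act ?A c z = z' \<and> z' \<in> topspace Z"
    if c: "c \<in> arrows" and z: "z \<in> topspace Z" and cz: "g_src T c = \<rho> z" for c z
  proof -
    obtain t y x where t: "t \<in> carr" "\<theta> t y = Some x" "c = gm t y" "g_src T c = y" "g_rng T c = x"
      by (rule arrow_cases[OF c]) blast
    have y: "y = \<rho> z" using t cz by simp
    have dy: "\<rho> z \<in> dom (\<theta> t)" using t y by auto
    then obtain z' where z': "\<tau> t z = Some z'" using dom[OF t(1)] z by blast
    have "l_act ?A c z = z'" using over_action_germ[OF over z dy t(1)] z' t y by simp
    moreover have "x = \<rho> z'" using val[OF t(1) z'] t y by simp
    moreover have "z' \<in> topspace Z" using Z.im_top[OF t(1), of z] z' by auto
    ultimately show ?thesis using t y dy z' by blast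
  qed
  have "continuous_map (fibre_product (g_arr T) Z (g_src T) \<rho>) Z (\<lambda>(c, z). l_act ?A c z)"
  proof (rule continuous_map_fibre_productI)
    fix c z assume cz: "c \<in> arrows" "z \<in> topspace Z" "g_src T c = \<rho> z"
    obtain t z' where t: "t \<in> carr" "c = gm t (\<rho> z)" "\<rho> z \<in> dom (\<theta> t)" "\<tau> t z = Some z'"
      "l_act ?A c z = z'" "z' \<in> topspace Z"
      using arr[OF cz] by blast
    then show "l_act ?A c z \<in> topspace Z" by simp
    fix V assume V: "openin Z V" "l_act ?A c z \<in> V"
    define N where "N = {z \<in> dom (\<tau> t). Z.im t z \<in> V}"
    have N: "openin Z N" unfolding N_def by (rule Z.open_preim[OF t(1) V(1)])
    have U: "openin (g_arr T) (gm t ` dom (\<theta> t))"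
      by (rule openin_T_slice[OF t(1) open_dom[OF t(1)] subset_refl])
    have act: "l_act ?A c' x \<in> V" if c': "c' \<in> gm t ` dom (\<theta> t)" "x \<in> N" "g_src T c' = \<rho> x" for c' x
    proof -
      obtain y where y: "c' = gm t y" "y \<in> dom (\<theta> t)" using c'(1) by blast
      have "y = \<rho> x" using T_src[OF t(1) y(2)] c'(3) y(1) by simp
      moreover have "x \<in> topspace Z" using c'(2) dom[OF t(1)] unfolding N_def by blast
      ultimately have "l_act ?A c' x = the (\<tau> t x)"
        using over_action_germ[OF over _ _ t(1), of x] y by simp
      then show ?thesis using c'(2) unfolding N_def by simp
    qed
    have "c \<in> gm t ` dom (\<theta> t)" "z \<in> N" using t V(2) unfolding N_def by auto
    then show "\<exists>U V'. openin (g_arr T) U \<and> openin Z V' \<and> c \<in> U \<and> z \<in> V' \<and>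
        (\<forall>c'\<in>U. \<forall>z'\<in>V'. g_src T c' = \<rho> z' \<longrightarrow> l_act ?A c' z' \<in> V)"
      using N U act by blast
  qed
  moreover have "\<rho> (l_act ?A c z) = g_rng T c"
    if "c \<in> arrows" "z \<in> topspace Z" "g_src T c = \<rho> z" for c z
    using arr[OF that] by auto
  moreover have "l_act ?A c (l_act ?A d z) = l_act ?A (g_mult T c d) z"
    if cdz: "c \<in> arrows" "d \<in> arrows" "z \<in> topspace Z"
      "g_src T c = g_rng T d" "g_src T d = \<rho> z" for c d z
  proof -
    obtain t z' where t: "t \<in> carr" "d = gm t (\<rho> z)" "\<rho> z \<in> dom (\<theta> t)" "\<tau> t z = Some z'"
      "g_rng T d = \<rho> z'" "l_act ?A d z = z'" "z' \<in> topspace Z"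
      using arr[OF cdz(2,3,5)] by blast
    obtain u x where u: "u \<in> carr" "c = gm u (\<rho> z')" "\<rho> z' \<in> dom (\<theta> u)" "\<tau> u z' = Some x"
      "l_act ?A c z' = x"
      using arr[OF cdz(1) t(7)] cdz(4) t(5) by auto
    have m: "g_mult T c d = gm (u \<odot> t) (\<rho> z)"
      unfolding u(2) t(2) by (rule T_mult[OF t(1) val[OF t(1,4)] u(1,3)])
    have x: "\<tau> (u \<odot> t) z = Some x" using t u by (auto simp: Z.act_mult_iff)
    then have "\<rho> z \<in> dom (\<theta> (u \<odot> t))" using dom[OF mult_closed[OF u(1) t(1)]] by blast
    then have "l_act ?A (g_mult T c d) z = x"
      unfolding m using over_action_germ[OF over cdz(3) _ mult_closed[OF u(1) t(1)]] x by simp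
    then show ?thesis using t u by simp
  qed
  moreover have "l_act ?A (g_unit T (\<rho> z)) z = z" if z: "z \<in> topspace Z" for z
  proof -
    have "\<rho> z \<in> topspace Y" using cont z continuous_map_funspace by blast
    then obtain e where e: "e \<in> idem" "\<rho> z \<in> dom (\<theta> e)" using cover_idem by blast
    then obtain z' where z': "\<tau> e z = Some z'" using dom[OF idem_carr[OF e(1)]] z by blast
    then have "z' = z" using Z.act_idem[OF e(1)] by blast
    then show ?thesis
      using over_action_germ[OF over z e(2) idem_carr[OF e(1)]] z' T_unit[OF e] by simp
  qed
  ultimately have "left_space T Z \<rho> (l_act ?A)"
    unfolding left_space_def T_obj using cont by blast
  moreover have "l_rng ?A = \<rho>" by (simp add: over_action_def)
  moreover have "l_act ?A c z = undefined"
    if "\<not> (c \<in> arrows \<and> z \<in> topspace Z \<and> g_src T c = \<rho> z)" for c z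
    using that by (auto simp: over_action_def)
  ultimately show ?thesis unfolding groupoid_action_def using ext by simp
qed

lemma action_hom_over_action:
  assumes over: "action_over S Y \<theta> Z \<rho> \<tau>" and t: "t \<in> carr"
  shows "action_hom Z (over_action Z \<rho> \<tau>) t = \<tau> t"
proof (rule map_eqI)
  fix z z'
  have rho: "l_rng (over_action Z \<rho> \<tau>) = \<rho>" by (simp add: over_action_def)
  have dom: "z \<in> dom (\<tau> t) \<longleftrightarrow> z \<in> topspace Z \<and> \<rho> z \<in> dom (\<theta> t)"
    using over t unfolding action_over_def by blast
  show "action_hom Z (over_action Z \<rho> \<tau>) t z = Some z' \<longleftrightarrow> \<tau> t z = Some z'"
  proof (cases "z \<in> dom (\<tau> t)")
    case True
    then have z: "z \<in> topspace Z" "\<rho> z \<in> dom (\<theta> t)" using dom by blast+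
    then show ?thesis
      using over_action_germ[OF over z t] True unfolding action_hom_iff rho by auto
  next
    case False
    then show ?thesis using dom unfolding action_hom_iff rho by blast
  qed
qed

lemma over_action_action_hom:
  assumes A: "groupoid_action T Z A"
  shows "over_action Z (l_rng A) (action_hom Z A) = A"
proof -
  have "l_act (over_action Z (l_rng A) (action_hom Z A)) c z = l_act A c z" for c z
  proof (cases "c \<in> arrows \<and> z \<in> topspace Z \<and> g_src T c = l_rng A z")
    case True
    then obtain t y where t: "t \<in> carr" "y \<in> dom (\<theta> t)" "c = gm t y" "g_src T c = y"
      using arrow_cases[of c thesis for thesis] by metis
    then have "y = l_rng A z" using True by simp
    then show ?thesis
      using over_action_germ[OF action_over_action_hom[OF A] _ _ t(1), of z] t True
      by (simp add: action_hom_def)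
  next
    case False
    then show ?thesis using A unfolding groupoid_action_def by (auto simp: over_action_def)
  qed
  then have "l_act (over_action Z (l_rng A) (action_hom Z A)) = l_act A" by blast
  then show ?thesis by (simp add: over_action_def)
qed

lemma over_action_cong:
  assumes "\<And>t. t \<in> carr \<Longrightarrow> \<tau> t = \<tau>' t"
  shows "over_action Z \<rho> \<tau> = over_action Z \<rho> \<tau>'"
proof -
  have "\<tau> (fst (SOME p. p \<in> c)) = \<tau>' (fst (SOME p. p \<in> c))" if c: "c \<in> arrows" for c
  proof -
    obtain t y where t: "t \<in> carr" "y \<in> dom (\<theta> t)" "c = gm t y" using c T_arrows by auto
    then show ?thesis using germ_some(2)[OF t(1,2) HOL.refl] assms by simp
  qed
  then show ?thesis unfolding over_action_def by (auto intro!: ext)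
qed

lemma groupoid_equivariant_iff:
  fixes Z :: "'z topology" and Z' :: "'x topology"
  assumes \<phi>: "\<phi> ` topspace Z \<subseteq> topspace Z'"
  shows "groupoid_equivariant T Z A A' \<phi> \<longleftrightarrow>
    (\<forall>z\<in>topspace Z. l_rng A' (\<phi> z) = l_rng A z) \<and>
    (\<forall>t\<in>carr. \<forall>z z'. action_hom Z A t z = Some z' \<longrightarrow> action_hom Z' A' t (\<phi> z) = Some (\<phi> z'))"
    (is "_ \<longleftrightarrow> ?rng \<and> ?act")
proof
  assume eq: "groupoid_equivariant T Z A A' \<phi>"
  then have rng: ?rng unfolding groupoid_equivariant_def by blast
  have "action_hom Z' A' t (\<phi> z) = Some (\<phi> z')"
    if t: "t \<in> carr" and z: "action_hom Z A t z = Some z'" for t z z'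
  proof -
    have z: "z \<in> topspace Z" "l_rng A z \<in> dom (\<theta> t)" "z' = l_act A (gm t (l_rng A z)) z"
      using z unfolding action_hom_iff by auto
    have "\<phi> z' = l_act A' (gm t (l_rng A z)) (\<phi> z)"
      using eq z germ_arrow[OF t z(2)] T_src[OF t z(2)] unfolding groupoid_equivariant_def by simp
    then show ?thesis using z rng \<phi> unfolding action_hom_iff by auto
  qed
  then show "?rng \<and> ?act" using rng by blast
next
  assume R: "?rng \<and> ?act"
  show "groupoid_equivariant T Z A A' \<phi>"
    unfolding groupoid_equivariant_def
  proof (intro conjI ballI impI)
    show "l_rng A' (\<phi> z) = l_rng A z" if "z \<in> topspace Z" for z using R that by blast
    fix c z assume c: "c \<in> arrows" and z: "z \<in> topspace Z" "g_src T c = l_rng A z"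
    obtain t y x where t: "t \<in> carr" "y \<in> dom (\<theta> t)" "c = gm t y" "g_src T c = y"
      by (rule arrow_cases[OF c]) blast
    have "action_hom Z A t z = Some (l_act A c z)"
      unfolding action_hom_iff using t z by simp
    then have "action_hom Z' A' t (\<phi> z) = Some (\<phi> (l_act A c z))" using R t(1) by blast
    then show "\<phi> (l_act A c z) = l_act A' c (\<phi> z)"
      using R t z unfolding action_hom_iff by auto
  qed
qed

end

section \<open>Etale groupoids and correspondences\<close>

locale etale =
  fixes G :: "('o, 'a) groupoid"
  assumes etale: "etale_groupoid G"
begin

abbreviation "arr \<equiv> topspace (g_arr G)"
abbreviation "obj \<equiv> topspace (g_obj G)"

lemma top: "topological_groupoid G"
  using etale unfolding etale_groupoid_def by blast

lemma src_open_map: "open_map (g_arr G) (g_obj G) (g_src G)"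
  using etale unfolding etale_groupoid_def local_homeomorphism_iff by blast

lemma rng_loc_inj: "g \<in> arr \<Longrightarrow> \<exists>U. openin (g_arr G) U \<and> g \<in> U \<and> inj_on (g_rng G) U"
  using etale unfolding etale_groupoid_def local_homeomorphism_iff by blast

lemma rng_cont: "continuous_map (g_arr G) (g_obj G) (g_rng G)"
  and src_cont: "continuous_map (g_arr G) (g_obj G) (g_src G)"
  and unit_embedding: "embedding_map (g_obj G) (g_arr G) (g_unit G)"
  and mult_cont: "continuous_map (fibre_product (g_arr G) (g_arr G) (g_src G) (g_rng G)) (g_arr G)
     (\<lambda>(g, h). g_mult G g h)"
  and inv_cont: "continuous_map (g_arr G) (g_arr G) (g_inv G)"
  using top unfolding topological_groupoid_def by blast+

lemma rng_unit: "x \<in> obj \<Longrightarrow> g_rng G (g_unit G x) = x"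
  and src_unit: "x \<in> obj \<Longrightarrow> g_src G (g_unit G x) = x"
  and rng_mult: "g \<in> arr \<Longrightarrow> h \<in> arr \<Longrightarrow> g_src G g = g_rng G h \<Longrightarrow> g_rng G (g_mult G g h) = g_rng G g"
  and src_mult: "g \<in> arr \<Longrightarrow> h \<in> arr \<Longrightarrow> g_src G g = g_rng G h \<Longrightarrow> g_src G (g_mult G g h) = g_src G h"
  and unit_mult: "g \<in> arr \<Longrightarrow> g_mult G (g_unit G (g_rng G g)) g = g"
  and mult_unit: "g \<in> arr \<Longrightarrow> g_mult G g (g_unit G (g_src G g)) = g"
  and rng_inv: "g \<in> arr \<Longrightarrow> g_rng G (g_inv G g) = g_src G g"
  and src_inv: "g \<in> arr \<Longrightarrow> g_src G (g_inv G g) = g_rng G g"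
  and mult_inv: "g \<in> arr \<Longrightarrow> g_mult G g (g_inv G g) = g_unit G (g_rng G g)"
  and inv_mult: "g \<in> arr \<Longrightarrow> g_mult G (g_inv G g) g = g_unit G (g_src G g)"
  using top unfolding topological_groupoid_def by simp_all

lemma assoc: "g \<in> arr \<Longrightarrow> h \<in> arr \<Longrightarrow> k \<in> arr \<Longrightarrow> g_src G g = g_rng G h \<Longrightarrow> g_src G h = g_rng G k \<Longrightarrow>
    g_mult G (g_mult G g h) k = g_mult G g (g_mult G h k)"
  using top unfolding topological_groupoid_def by simp

lemma unit_arr: "x \<in> obj \<Longrightarrow> g_unit G x \<in> arr"
  using embedding_imp_closed_map_eq[OF unit_embedding] unit_embedding
  by (metis continuous_map_funspace embedding_map_def homeomorphic_imp_continuous_map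
      continuous_map_in_subtopology funcset_mem)

lemma inv_arr: "g \<in> arr \<Longrightarrow> g_inv G g \<in> arr"
  using inv_cont continuous_map_funspace by blast

lemma mult_arr: "g \<in> arr \<Longrightarrow> h \<in> arr \<Longrightarrow> g_src G g = g_rng G h \<Longrightarrow> g_mult G g h \<in> arr"
  using continuous_map_fibre_productD[OF mult_cont] by blast

lemma inv_unit: assumes x: "x \<in> obj" shows "g_inv G (g_unit G x) = g_unit G x"
proof -
  note u = unit_arr[OF x]
  have "g_inv G (g_unit G x) = g_mult G (g_unit G x) (g_inv G (g_unit G x))"
    using unit_mult[OF inv_arr[OF u]] rng_inv[OF u] src_unit[OF x] by simp
  then show ?thesis using mult_inv[OF u] rng_unit[OF x] by simp
qed

lemma inv_eq_unit: assumes g: "g \<in> arr" and x: "x \<in> obj" and i: "g_inv G g = g_unit G x"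
  shows "g = g_unit G x"
proof -
  have s: "g_src G g = x" using rng_inv[OF g] rng_unit[OF x] i by simp
  have "g = g_mult G g (g_unit G x)" using mult_unit[OF g] s by simp
  also have "\<dots> = g_unit G (g_rng G g)" using mult_inv[OF g] i by simp
  also have "g_rng G g = x" using src_inv[OF g] i src_unit[OF x] by simp
  finally show ?thesis .
qed

lemma inv_mult_rev:
  assumes g: "g \<in> arr" and h: "h \<in> arr" and gh: "g_src G g = g_rng G h"
  shows "g_inv G (g_mult G g h) = g_mult G (g_inv G h) (g_inv G g)"
proof -
  define m where "m = g_mult G g h"
  define k where "k = g_mult G (g_inv G h) (g_inv G g)"
  note ig = inv_arr[OF g] rng_inv[OF g] src_inv[OF g] and ih = inv_arr[OF h] rng_inv[OF h] src_inv[OF h]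
  have m: "m \<in> arr" "g_rng G m = g_rng G g" "g_src G m = g_src G h"
    unfolding m_def using g h gh by (simp_all add: mult_arr rng_mult src_mult)
  have k: "k \<in> arr" "g_rng G k = g_src G h" "g_src G k = g_rng G g"
    unfolding k_def using ig ih gh by (simp_all add: mult_arr rng_mult src_mult)
  have "g_mult G k m = g_mult G (g_inv G h) (g_mult G (g_inv G g) m)"
    unfolding k_def using assoc[OF ih(1) ig(1) m(1)] ig ih m gh by simp
  also have "g_mult G (g_inv G g) m = h"
    unfolding m_def using assoc[OF ig(1) g h] ig gh inv_mult[OF g] unit_mult[OF h] by simp
  finally have km: "g_mult G k m = g_unit G (g_src G m)" using inv_mult[OF h] m by simp
  note im = inv_arr[OF m(1)] rng_inv[OF m(1)] src_inv[OF m(1)]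
  have "g_inv G m = g_mult G (g_mult G k m) (g_inv G m)" using km unit_mult[OF im(1)] im by simp
  also have "\<dots> = g_mult G k (g_mult G m (g_inv G m))" using assoc[OF k(1) m(1) im(1)] im k m by simp
  also have "\<dots> = k" using mult_inv[OF m(1)] mult_unit[OF k(1)] k m by simp
  finally show ?thesis unfolding m_def k_def .
qed

text \<open>If \<open>r\<close> is injective on a neighbourhood \<open>U\<close> of the unit \<open>1\<^sub>x\<close>, then any \<open>g \<in> U\<close> whose range
  \<open>y\<close> has its unit in \<open>U\<close> is equal to \<open>1\<^sub>y\<close>.\<close>

lemma units_open: "openin (g_arr G) (g_unit G ` obj)"
proof (subst openin_subopen, intro ballI)
  fix g assume "g \<in> g_unit G ` obj"
  then obtain x where x: "x \<in> obj" "g = g_unit G x" by blast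
  obtain U where U: "openin (g_arr G) U" "g \<in> U" "inj_on (g_rng G) U"
    using rng_loc_inj[OF unit_arr[OF x(1)]] x(2) by blast
  have uc: "continuous_map (g_obj G) (g_arr G) (g_unit G)"
    using unit_embedding unfolding embedding_map_def
    by (metis homeomorphic_imp_continuous_map continuous_map_in_subtopology)
  define V where "V = U \<inter> {g \<in> arr. g_rng G g \<in> {x \<in> obj. g_unit G x \<in> U}}"
  have "openin (g_arr G) V"
    unfolding V_def using U(1) openin_continuous_map_preimage[OF uc U(1)]
    by (intro openin_Int openin_continuous_map_preimage[OF rng_cont])
  moreover have "g \<in> V" using x U(2) unit_arr rng_unit unfolding V_def by simp
  moreover have "V \<subseteq> g_unit G ` obj"
  proof
    fix h assume h: "h \<in> V"
    then have 1: "h \<in> U" "h \<in> arr" "g_rng G h \<in> obj" "g_unit G (g_rng G h) \<in> U"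
      unfolding V_def by blast+
    then have "g_unit G (g_rng G h) = h" using U(3) rng_unit unfolding inj_on_def by blast
    then show "h \<in> g_unit G ` obj" using 1(3) by force
  qed
  ultimately show "\<exists>V. openin (g_arr G) V \<and> g \<in> V \<and> V \<subseteq> g_unit G ` obj" by blast
qed

end

locale correspondence =
  fixes H G :: "('o, 'a) groupoid" and X :: "('o, 'a, 'x) correspondence"
  assumes corr: "groupoid_correspondence H G X"
begin

sublocale H: etale H
  using corr unfolding groupoid_correspondence_def by unfold_locales blast

sublocale G: etale G
  using corr unfolding groupoid_correspondence_def by unfold_locales blast

abbreviation "sp \<equiv> topspace (k_space X)"
abbreviation "src \<equiv> k_src X"
abbreviation "rng \<equiv> k_rng X"
abbreviation "ract \<equiv> k_ract X"
abbreviation "lact \<equiv> k_lact X"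

lemma left: "left_space H (k_space X) rng lact"
  and right: "right_space G (k_space X) src ract"
  and embedding: "embedding_map (fibre_product (k_space X) (g_arr G) src (g_rng G))
       (prod_topology (k_space X) (k_space X)) (\<lambda>(x, g). (ract x g, x))"
  and src_local_homeo: "local_homeomorphism (k_space X) (g_obj G) src"
  using corr unfolding groupoid_correspondence_def basic_right_space_def by blast+

lemma src_cont: "continuous_map (k_space X) (g_obj G) src"
  and src_open_map: "open_map (k_space X) (g_obj G) src"
  and src_loc_inj: "x \<in> sp \<Longrightarrow> \<exists>U. openin (k_space X) U \<and> x \<in> U \<and> inj_on src U"
  using src_local_homeo unfolding local_homeomorphism_iff by blast+

lemma ract_cont: "continuous_map (fibre_product (k_space X) (g_arr G) src (g_rng G)) (k_space X)
    (\<lambda>(x, g). ract x g)"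
  and src_ract: "x \<in> sp \<Longrightarrow> g \<in> G.arr \<Longrightarrow> src x = g_rng G g \<Longrightarrow> src (ract x g) = g_src G g"
  and ract_ract: "x \<in> sp \<Longrightarrow> g \<in> G.arr \<Longrightarrow> h \<in> G.arr \<Longrightarrow> src x = g_rng G g \<Longrightarrow>
    g_src G g = g_rng G h \<Longrightarrow> ract (ract x g) h = ract x (g_mult G g h)"
  and ract_unit: "x \<in> sp \<Longrightarrow> ract x (g_unit G (src x)) = x"
  using right unfolding right_space_def by simp_all

lemma rng_cont: "continuous_map (k_space X) (g_obj H) rng"
  and lact_cont: "continuous_map (fibre_product (g_arr H) (k_space X) (g_src H) rng) (k_space X)
    (\<lambda>(h, x). lact h x)"
  and rng_lact: "h \<in> H.arr \<Longrightarrow> x \<in> sp \<Longrightarrow> g_src H h = rng x \<Longrightarrow> rng (lact h x) = g_rng H h"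
  and lact_lact: "g \<in> H.arr \<Longrightarrow> h \<in> H.arr \<Longrightarrow> x \<in> sp \<Longrightarrow> g_src H g = g_rng H h \<Longrightarrow>
    g_src H h = rng x \<Longrightarrow> lact g (lact h x) = lact (g_mult H g h) x"
  and lact_unit: "x \<in> sp \<Longrightarrow> lact (g_unit H (rng x)) x = x"
  using left unfolding left_space_def by simp_all

lemma ract_unit_at: "x \<in> sp \<Longrightarrow> src x = z \<Longrightarrow> ract x (g_unit G z) = x"
  using ract_unit by blast

lemma src_lact: "h \<in> H.arr \<Longrightarrow> x \<in> sp \<Longrightarrow> g_src H h = rng x \<Longrightarrow> src (lact h x) = src x"
  and rng_ract: "x \<in> sp \<Longrightarrow> g \<in> G.arr \<Longrightarrow> src x = g_rng G g \<Longrightarrow> rng (ract x g) = rng x"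
  using corr unfolding groupoid_correspondence_def by simp_all

lemma ract_sp: "x \<in> sp \<Longrightarrow> g \<in> G.arr \<Longrightarrow> src x = g_rng G g \<Longrightarrow> ract x g \<in> sp"
  using continuous_map_fibre_productD[OF ract_cont] by blast

lemma lact_sp: "h \<in> H.arr \<Longrightarrow> x \<in> sp \<Longrightarrow> g_src H h = rng x \<Longrightarrow> lact h x \<in> sp"
  using continuous_map_fibre_productD[OF lact_cont] by blast

lemma src_obj: "x \<in> sp \<Longrightarrow> src x \<in> G.obj" and rng_obj: "x \<in> sp \<Longrightarrow> rng x \<in> H.obj"
  using src_cont rng_cont continuous_map_funspace by blast+

lemma ract_free:
  assumes "x \<in> sp" "g \<in> G.arr" "h \<in> G.arr" "src x = g_rng G g" "src x = g_rng G h" "ract x g = ract x h"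
  shows "g = h"
proof -
  have "inj_on (\<lambda>(x, g). (ract x g, x)) (topspace (fibre_product (k_space X) (g_arr G) src (g_rng G)))"
    using embedding homeomorphic_imp_injective_map unfolding embedding_map_def by blast
  from inj_onD[OF this, of "(x, g)" "(x, h)"] show ?thesis using assms by simp
qed

lemma ract_stabiliser:
  assumes "x \<in> sp" "g \<in> G.arr" "src x = g_rng G g" "ract x g = x"
  shows "g = g_unit G (src x)"
  using ract_free[OF assms(1,2) G.unit_arr[OF src_obj[OF assms(1)]] assms(3)]
    G.rng_unit[OF src_obj[OF assms(1)]] ract_unit[OF assms(1)] assms(4) by simp

lemma orbit_eq_iff:
  assumes x: "x \<in> sp" and y: "y \<in> sp"
  shows "right_orbit G X x = right_orbit G X y \<longleftrightarrow> (\<exists>g\<in>G.arr. src x = g_rng G g \<and> y = ract x g)"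
proof
  have "y \<in> right_orbit G X y"
    using ract_unit[OF y] G.unit_arr[OF src_obj[OF y]] G.rng_unit[OF src_obj[OF y]]
    unfolding right_orbit_def by (intro CollectI exI[of _ "g_unit G (src y)"]) simp
  moreover assume "right_orbit G X x = right_orbit G X y"
  ultimately have "y \<in> right_orbit G X x" by simp
  then show "\<exists>g\<in>G.arr. src x = g_rng G g \<and> y = ract x g" unfolding right_orbit_def by blast
next
  have sub: "right_orbit G X (ract x g) \<subseteq> right_orbit G X x"
    if "x \<in> sp" "g \<in> G.arr" "src x = g_rng G g" for x g
  proof
    fix z assume "z \<in> right_orbit G X (ract x g)"
    then obtain h where h: "h \<in> G.arr" "src (ract x g) = g_rng G h" "z = ract (ract x g) h"
      unfolding right_orbit_def by blast
    then have "z = ract x (g_mult G g h)" "g_src G g = g_rng G h"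
      using ract_ract src_ract that by simp_all
    then show "z \<in> right_orbit G X x"
      using that h G.mult_arr G.rng_mult unfolding right_orbit_def
      by (intro CollectI exI[of _ "g_mult G g h"]) simp
  qed
  assume "\<exists>g\<in>G.arr. src x = g_rng G g \<and> y = ract x g"
  then obtain g where g: "g \<in> G.arr" "src x = g_rng G g" "y = ract x g" by blast
  have "ract y (g_inv G g) = x"
    using g x ract_ract G.inv_arr G.rng_inv G.mult_inv ract_unit_at by simp
  then have "right_orbit G X x \<subseteq> right_orbit G X y"
    using sub[OF y G.inv_arr[OF g(1)]] src_ract g x G.rng_inv by simp
  then show "right_orbit G X x = right_orbit G X y" using sub[OF x g(1,2)] g(3) by blast
qed

text \<open>The form in which the injectivity of the orbit projection on a slice is used: an arrow that
  maps a point of a slice into the slice is a unit.\<close>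

lemma slice_eqI:
  assumes U: "U \<in> slices G X" and x: "x \<in> U" "x' \<in> U"
    and g: "g \<in> G.arr" "src x = g_rng G g" "x' = ract x g"
  shows "x' = x \<and> g = g_unit G (src x)"
proof -
  have sp: "x \<in> sp" "x' \<in> sp" using U x openin_subset unfolding slices_def by blast+
  have "right_orbit G X x = right_orbit G X x'" using orbit_eq_iff[OF sp] g by blast
  then have "x' = x" using U x unfolding slices_def inj_on_def by blast
  then show ?thesis using ract_stabiliser[OF sp(1) g(1,2)] g(3) by simp
qed

lemma slice_sp: "U \<in> slices G X \<Longrightarrow> x \<in> U \<Longrightarrow> x \<in> sp"
  using openin_subset unfolding slices_def by blast

lemma slice_src_inj: "U \<in> slices G X \<Longrightarrow> x \<in> U \<Longrightarrow> x' \<in> U \<Longrightarrow> src x = src x' \<Longrightarrow> x = x'"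
  unfolding slices_def inj_on_def by blast

lemma slice_open: "U \<in> slices G X \<Longrightarrow> openin (k_space X) U"
  unfolding slices_def by blast

lemma slice_subset: "U \<in> slices G X \<Longrightarrow> openin (k_space X) V \<Longrightarrow> V \<subseteq> U \<Longrightarrow> V \<in> slices G X"
  unfolding slices_def by (blast intro: inj_on_subset)

text \<open>Since the action is basic and the units form an open set, a pair \<open>(x g, x)\<close> close to the
  diagonal has \<open>g\<close> a unit.  So points close to each other in the same orbit are equal.\<close>

lemma slice_exists:
  assumes x: "x \<in> N" and N: "openin (k_space X) N"
  shows "\<exists>U\<in>slices G X. x \<in> U \<and> U \<subseteq> N"
proof -
  let ?D = "fibre_product (k_space X) (g_arr G) src (g_rng G)"
  let ?e = "\<lambda>(x, g). (ract x g, x)"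
  let ?XX = "prod_topology (k_space X) (k_space X)"
  have xs: "x \<in> sp" using x N openin_subset by blast
  define O1 where "O1 = {(x, g). x \<in> sp \<and> g \<in> g_unit G ` G.obj \<and> src x = g_rng G g}"
  have "openin ?D O1" unfolding O1_def by (rule openin_fibre_product_box[OF openin_topspace G.units_open])
  then have "openin (subtopology ?XX (?e ` topspace ?D)) (?e ` O1)"
    using embedding homeomorphic_imp_open_map unfolding embedding_map_def open_map_def by blast
  then obtain O2 where O2: "openin ?XX O2" "?e ` O1 = O2 \<inter> ?e ` topspace ?D"
    unfolding openin_subtopology by blast
  have "(x, g_unit G (src x)) \<in> O1"
    using xs src_obj G.rng_unit unfolding O1_def by simp
  then have "?e (x, g_unit G (src x)) \<in> ?e ` O1" by (rule imageI)
  then have "(x, x) \<in> O2" using ract_unit[OF xs] O2(2) by simp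
  then obtain V1 V2 where V: "openin (k_space X) V1" "openin (k_space X) V2" "x \<in> V1" "x \<in> V2" "V1 \<times> V2 \<subseteq> O2"
    using O2(1)[unfolded openin_prod_topology_alt, rule_format, of x x] by blast
  obtain V3 where V3: "openin (k_space X) V3" "x \<in> V3" "inj_on src V3" using src_loc_inj[OF xs] by blast
  define U where "U = V1 \<inter> V2 \<inter> V3 \<inter> N"
  have U: "openin (k_space X) U" unfolding U_def using V V3 N by blast
  have "inj_on (right_orbit G X) U"
  proof (rule inj_onI)
    fix y y' assume y: "y \<in> U" "y' \<in> U" "right_orbit G X y = right_orbit G X y'"
    have sp: "y \<in> sp" "y' \<in> sp" using y openin_subset[OF U] by blast+
    then obtain g where g: "g \<in> G.arr" "src y = g_rng G g" "y' = ract y g"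
      using orbit_eq_iff y(3) by blast
    have "(y, g) \<in> topspace ?D" using sp g by simp
    then have "?e (y, g) \<in> ?e ` topspace ?D" by (rule imageI)
    moreover have "(y', y) \<in> O2" using y V(5) unfolding U_def by blast
    ultimately have "(y', y) \<in> ?e ` O1" using O2(2) g(3) by simp
    then obtain z h where z: "(z, h) \<in> O1" "y' = ract z h" "y = z" by auto
    then obtain w where "w \<in> G.obj" "h = g_unit G w" "src z = w" "z \<in> sp"
      using G.rng_unit unfolding O1_def by auto
    then show "y = y'" using z ract_unit[of z] by simp
  qed
  moreover have "inj_on src U" using V3(3) unfolding U_def by (rule inj_on_subset) blast
  ultimately have "U \<in> slices G X" using U unfolding slices_def by blast
  moreover have "x \<in> U" "U \<subseteq> N" using x V V3 unfolding U_def by blast+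
  ultimately show ?thesis by blast
qed

lemma corr_bracket_ract:
  assumes "x \<in> sp" "g \<in> G.arr" "src x = g_rng G g"
  shows "corr_bracket G X x (ract x g) = g"
  unfolding corr_bracket_def using assms ract_free by (intro the_equality) auto

lemma slice_bracket_eq:
  assumes "U \<subseteq> sp" "V \<subseteq> sp"
  shows "slice_bracket G X U V = {g \<in> G.arr. \<exists>x\<in>U. src x = g_rng G g \<and> ract x g \<in> V}"
proof (intro equalityI subsetI)
  fix g assume "g \<in> slice_bracket G X U V"
  then obtain x y where x: "x \<in> U" "y \<in> V" "right_orbit G X x = right_orbit G X y" "g = corr_bracket G X x y"
    unfolding slice_bracket_def by blast
  then have sp: "x \<in> sp" "y \<in> sp" using assms by auto
  then obtain h where "h \<in> G.arr" "src x = g_rng G h" "y = ract x h" using orbit_eq_iff x(3) by blast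
  then show "g \<in> {g \<in> G.arr. \<exists>x\<in>U. src x = g_rng G g \<and> ract x g \<in> V}"
    using x corr_bracket_ract[OF sp(1)] by auto
next
  fix g assume "g \<in> {g \<in> G.arr. \<exists>x\<in>U. src x = g_rng G g \<and> ract x g \<in> V}"
  then obtain x where x: "g \<in> G.arr" "x \<in> U" "src x = g_rng G g" "ract x g \<in> V" by blast
  then have sp: "x \<in> sp" "ract x g \<in> sp" using assms by auto
  have "right_orbit G X x = right_orbit G X (ract x g)" using orbit_eq_iff[OF sp] x by blast
  then show "g \<in> slice_bracket G X U V"
    using x corr_bracket_ract[OF sp(1) x(1,3)] unfolding slice_bracket_def by force
qed

text \<open>The bracket is the image under the second projection of the open set of all \<open>(x, g)\<close> with
  \<open>x \<in> U\<close> and \<open>x g \<in> V\<close>, and that projection is open because \<open>s\<close> is open.\<close>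

lemma openin_slice_bracket:
  assumes U: "openin (k_space X) U" and V: "openin (k_space X) V"
  shows "openin (g_arr G) (slice_bracket G X U V)"
proof -
  let ?D = "fibre_product (k_space X) (g_arr G) src (g_rng G)"
  define E where "E = {(x, g). x \<in> U \<and> g \<in> G.arr \<and> src x = g_rng G g} \<inter>
    {(x, g). x \<in> sp \<and> g \<in> G.arr \<and> src x = g_rng G g \<and> (case (x, g) of (x, g) \<Rightarrow> ract x g) \<in> V}"
  have "openin ?D E"
    unfolding E_def
    by (intro openin_Int openin_fibre_product_box[OF U openin_topspace]
        openin_fibre_product_preimage[OF ract_cont V])
  then have "openin (g_arr G) (snd ` E)"
    using open_map_fibre_product_snd[OF src_open_map G.rng_cont] unfolding open_map_def by blast
  moreover have "slice_bracket G X U V = snd ` E"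
    using slice_bracket_eq[OF openin_subset[OF U] openin_subset[OF V]] openin_subset[OF U]
    unfolding E_def by force
  ultimately show ?thesis by simp
qed

text \<open>An arrow \<open>g\<close> in the bracket links \<open>x \<in> U\<close> to \<open>x g \<in> V\<close>.  Its range determines \<open>x\<close>, and
  then \<open>x g\<close> as the only point of \<open>V\<close> in the orbit of \<open>x\<close>.  Symmetrically, its source determines
  \<open>x g\<close> and then \<open>x\<close>.  Freeness determines \<open>g\<close>.\<close>

lemma slice_bracket_inj:
  assumes U: "U \<in> slices G X" and V: "V \<in> slices G X"
  shows "inj_on (g_src G) (slice_bracket G X U V)" "inj_on (g_rng G) (slice_bracket G X U V)"
proof -
  have br: "slice_bracket G X U V = {g \<in> G.arr. \<exists>x\<in>U. src x = g_rng G g \<and> ract x g \<in> V}"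
    by (rule slice_bracket_eq) (use slice_sp U V in blast)+
  show rng: "inj_on (g_rng G) (slice_bracket G X U V)"
  proof (rule inj_onI)
    fix g h assume "g \<in> slice_bracket G X U V" "h \<in> slice_bracket G X U V" and eq: "g_rng G g = g_rng G h"
    then obtain x y where x: "g \<in> G.arr" "x \<in> U" "src x = g_rng G g" "ract x g \<in> V"
      and y: "h \<in> G.arr" "y \<in> U" "src y = g_rng G h" "ract y h \<in> V" unfolding br by blast
    have xy: "x = y" using slice_src_inj[OF U x(2) y(2)] x y eq by simp
    have sp: "x \<in> sp" using slice_sp[OF U] x by simp
    note i = G.inv_arr[OF x(1)] G.rng_inv[OF x(1)] G.src_inv[OF x(1)]
    define k where "k = g_mult G (g_inv G g) h"
    have "g_mult G g k = h"
      unfolding k_def using i x y eq G.assoc[OF x(1) i(1) y(1)] G.mult_inv[OF x(1)] G.unit_mult[OF y(1)]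
      by simp
    moreover have k: "k \<in> G.arr" "g_rng G k = g_src G g"
      unfolding k_def using i x y eq by (simp_all add: G.mult_arr G.rng_mult)
    ultimately have *: "ract y h = ract (ract x g) k" "src (ract x g) = g_rng G k"
      using ract_ract[OF sp x(1) k(1) x(3)] xy src_ract[OF sp x(1,3)] by simp_all
    have "ract y h = ract x g" using slice_eqI[OF V x(4) y(4) k(1) *(2,1)] by blast
    then have "ract x g = ract x h" "src x = g_rng G h" using xy y(3) by simp_all
    then show "g = h" using ract_free[OF sp x(1) y(1) x(3)] by blast
  qed
  show "inj_on (g_src G) (slice_bracket G X U V)"
  proof (rule inj_onI)
    fix g h assume g: "g \<in> slice_bracket G X U V" and h: "h \<in> slice_bracket G X U V" and eq: "g_src G g = g_src G h"
    then obtain x y where x: "g \<in> G.arr" "x \<in> U" "src x = g_rng G g" "ract x g \<in> V"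
      and y: "h \<in> G.arr" "y \<in> U" "src y = g_rng G h" "ract y h \<in> V" unfolding br by blast
    have sp: "x \<in> sp" "y \<in> sp" using slice_sp[OF U] x y by auto
    have eq2: "ract x g = ract y h"
      using slice_src_inj[OF V x(4) y(4)] src_ract sp x y eq by simp
    have "right_orbit G X x = right_orbit G X (ract x g)"
      using orbit_eq_iff[OF sp(1) ract_sp[OF sp(1) x(1,3)]] x by blast
    moreover have "right_orbit G X y = right_orbit G X (ract y h)"
      using orbit_eq_iff[OF sp(2) ract_sp[OF sp(2) y(1,3)]] y by blast
    ultimately have "x = y" using U x(2) y(2) eq2 unfolding slices_def inj_on_def by simp
    then show "g = h" using inj_onD[OF rng _ g h] x y by simp
  qed
qed

end

text \<open>Points of the composite are orbits.  To avoid them, an isomorphism from the composite to \<open>Z\<close> is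
  described by the map \<open>(x, y) \<mapsto> x \<cdot> y\<close> that it induces on the fibre product: it is open, and its
  fibres are the orbits.\<close>

locale correspondence_product =
  X: correspondence H G X + Y: correspondence G K Y
  for H G K :: "('o, 'a) groupoid" and X :: "('o, 'a, 'x) correspondence"
    and Y :: "('o, 'a, 'y) correspondence" +
  fixes Z :: "('o, 'a, 'z) correspondence" and \<mu> :: "('x \<times> 'y) set \<Rightarrow> 'z"
  assumes iso: "correspondence_iso H K (composite G X Y) Z \<mu>"
begin

definition dot (infixl "\<cdot>" 70) where "x \<cdot> y = \<mu> (composite_class G X Y (x, y))"

abbreviation "D \<equiv> fibre_product (k_space X) (k_space Y) X.src Y.rng"
abbreviation "cls \<equiv> composite_class G X Y"

lemma cls_iff: "(x', y') \<in> cls (x, y) \<longleftrightarrow>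
    (\<exists>g\<in>X.G.arr. g_src G g = Y.rng y \<and> x' = X.ract x (g_inv G g) \<and> y' = Y.lact g y)"
  unfolding composite_class_def by auto

lemma cls_refl: assumes "(x, y) \<in> topspace D" shows "(x, y) \<in> cls (x, y)"
  unfolding cls_iff
  using assms Y.rng_obj X.G.unit_arr X.G.src_unit X.G.inv_unit X.ract_unit_at Y.lact_unit
  by (intro bexI[of _ "g_unit G (Y.rng y)"]) auto

lemma cls_mem:
  assumes xy: "(x, y) \<in> topspace D" and mem: "(x', y') \<in> cls (x, y)"
  shows "(x', y') \<in> topspace D" "X.rng x' = X.rng x" "Y.src y' = Y.src y"
proof -
  obtain g where g: "g \<in> X.G.arr" "g_src G g = Y.rng y" "x' = X.ract x (g_inv G g)" "y' = Y.lact g y"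
    using mem unfolding cls_iff by blast
  have 1: "x \<in> X.sp" "y \<in> Y.sp" "X.src x = Y.rng y" using xy by auto
  note i = X.G.inv_arr[OF g(1)] X.G.rng_inv[OF g(1)] X.G.src_inv[OF g(1)]
  show "X.rng x' = X.rng x" using g 1 i X.rng_ract by simp
  show "Y.src y' = Y.src y" using g 1 Y.src_lact by simp
  show "(x', y') \<in> topspace D"
    using g 1 i X.ract_sp Y.lact_sp X.src_ract Y.rng_lact by simp
qed

lemma cls_eqI:
  assumes xy: "(x, y) \<in> topspace D" and mem: "(x', y') \<in> cls (x, y)"
  shows "cls (x, y) = cls (x', y')"
proof -
  have sub: "cls (x', y') \<subseteq> cls (x, y)"
    if xy: "(x, y) \<in> topspace D" and mem: "(x', y') \<in> cls (x, y)" for x y x' y'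
  proof
    fix p assume p: "p \<in> cls (x', y')"
    obtain x'' y'' where p2: "p = (x'', y'')" by force
    obtain g where g: "g \<in> X.G.arr" "g_src G g = Y.rng y" "x' = X.ract x (g_inv G g)" "y' = Y.lact g y"
      using mem unfolding cls_iff by blast
    obtain h where h: "h \<in> X.G.arr" "g_src G h = Y.rng y'" "x'' = X.ract x' (g_inv G h)" "y'' = Y.lact h y'"
      using p unfolding p2 cls_iff by blast
    have 1: "x \<in> X.sp" "y \<in> Y.sp" "X.src x = Y.rng y" using xy by auto
    have hg: "g_src G h = g_rng G g" using h g 1 Y.rng_lact by simp
    note m = X.G.mult_arr[OF h(1) g(1) hg] X.G.src_mult[OF h(1) g(1) hg]
    have inv: "g_inv G (g_mult G h g) = g_mult G (g_inv G g) (g_inv G h)"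
      by (rule X.G.inv_mult_rev[OF h(1) g(1) hg])
    have "x'' = X.ract x (g_inv G (g_mult G h g))"
      unfolding inv h(3) g(3) using 1 g h hg X.G.inv_arr X.G.rng_inv X.G.src_inv
      by (intro X.ract_ract) auto
    moreover have "y'' = Y.lact (g_mult G h g) y"
      unfolding h(4) g(4) using 1 g h hg by (intro Y.lact_lact) auto
    ultimately show "p \<in> cls (x, y)" unfolding p2 cls_iff using m g by auto
  qed
  obtain g where g: "g \<in> X.G.arr" "g_src G g = Y.rng y" "x' = X.ract x (g_inv G g)" "y' = Y.lact g y"
    using mem unfolding cls_iff by blast
  have 1: "x \<in> X.sp" "y \<in> Y.sp" "X.src x = Y.rng y" using xy by auto
  note i = X.G.inv_arr[OF g(1)] X.G.rng_inv[OF g(1)] X.G.src_inv[OF g(1)]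
  have "X.ract x' (g_inv G (g_inv G g)) = X.ract x (g_mult G (g_inv G g) (g_inv G (g_inv G g)))"
    unfolding g(3) using 1 g i X.G.inv_arr X.G.rng_inv by (intro X.ract_ract) auto
  also have "\<dots> = x" using X.G.mult_inv[OF i(1)] i X.ract_unit_at 1 g by simp
  finally have "x = X.ract x' (g_inv G (g_inv G g))" ..
  moreover have "Y.lact (g_inv G g) y' = Y.lact (g_mult G (g_inv G g) g) y"
    unfolding g(4) using 1 g i by (intro Y.lact_lact) auto
  then have "y = Y.lact (g_inv G g) y'" using X.G.inv_mult[OF g(1)] Y.lact_unit 1 g by simp
  moreover have "g_src G (g_inv G g) = Y.rng y'" using i g 1 Y.rng_lact by simp
  ultimately have "(x, y) \<in> cls (x', y')" unfolding cls_iff using i(1) by blast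
  then show ?thesis using sub[OF xy mem] sub[OF cls_mem(1)[OF xy mem]] by blast
qed

lemma composite_topspace: "topspace (k_space (composite G X Y)) = cls ` topspace D"
proof
  have "k_space (composite G X Y) = quotient_topology D cls" by (simp add: composite_def)
  then have op: "openin (quotient_topology D cls) (topspace (k_space (composite G X Y)))"
    by (metis openin_topspace)
  then show "topspace (k_space (composite G X Y)) \<subseteq> cls ` topspace D"
    unfolding openin_quotient_topology by blast
  have "{z \<in> topspace D. cls z \<in> cls ` topspace D} = topspace D" by blast
  then have "openin (quotient_topology D cls) (cls ` topspace D)"
    unfolding openin_quotient_topology by (metis openin_topspace subset_refl)
  then have "openin (k_space (composite G X Y)) (cls ` topspace D)"
    by (simp add: composite_def)
  then show "cls ` topspace D \<subseteq> topspace (k_space (composite G X Y))" by (rule openin_subset)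
qed

lemma dot_facts:
  assumes xy: "x \<in> X.sp" "y \<in> Y.sp" "X.src x = Y.rng y"
  shows "x \<cdot> y \<in> topspace (k_space Z)" "k_rng Z (x \<cdot> y) = X.rng x" "k_src Z (x \<cdot> y) = Y.src y"
proof -
  have D: "(x, y) \<in> topspace D" using xy by simp
  define p where "p = (SOME p. p \<in> cls (x, y))"
  have "p \<in> cls (x, y)" using cls_refl[OF D] unfolding p_def by (rule someI)
  then have p: "X.rng (fst p) = X.rng x" "Y.src (snd p) = Y.src y"
    using cls_mem[OF D, of "fst p" "snd p"] by simp_all
  have c: "cls (x, y) \<in> topspace (k_space (composite G X Y))"
    unfolding composite_topspace using D by blast
  then show "x \<cdot> y \<in> topspace (k_space Z)"
    using iso homeomorphic_imp_surjective_map unfolding correspondence_iso_def dot_def by blast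
  have "k_rng Z (x \<cdot> y) = k_rng (composite G X Y) (cls (x, y))"
    "k_src Z (x \<cdot> y) = k_src (composite G X Y) (cls (x, y))"
    using iso c unfolding correspondence_iso_def dot_def by blast+
  then show "k_rng Z (x \<cdot> y) = X.rng x" "k_src Z (x \<cdot> y) = Y.src y"
    using p unfolding p_def by (simp_all add: composite_def)
qed

lemma dot_eqD:
  assumes xy: "x \<in> X.sp" "y \<in> Y.sp" "X.src x = Y.rng y"
    and xy': "x' \<in> X.sp" "y' \<in> Y.sp" "X.src x' = Y.rng y'" and eq: "x \<cdot> y = x' \<cdot> y'"
  shows "\<exists>g\<in>X.G.arr. g_src G g = Y.rng y \<and> x' = X.ract x (g_inv G g) \<and> y' = Y.lact g y"
proof -
  have D: "(x, y) \<in> topspace D" "(x', y') \<in> topspace D" using xy xy' by auto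
  have "inj_on \<mu> (topspace (k_space (composite G X Y)))"
    using iso homeomorphic_imp_injective_map unfolding correspondence_iso_def by blast
  then have "cls (x, y) = cls (x', y')"
    using eq D unfolding composite_topspace dot_def inj_on_def by blast
  then show ?thesis using cls_refl[OF D(2)] cls_iff by blast
qed

text \<open>The orbit projection is open: near a point \<open>(a, b)\<close> whose orbit meets the open set
  \<open>U \<times> V\<close> in \<open>(a g\<^sup>-\<^sup>1, g b)\<close>, an arrow close to \<open>g\<close> with the required source exists because the source
  map of \<open>\<G>\<close> is open.\<close>

lemma openin_dot:
  assumes U: "openin (k_space X) U" and V: "openin (k_space Y) V"
  shows "openin (k_space Z) {x \<cdot> y | x y. x \<in> U \<and> y \<in> V \<and> X.src x = Y.rng y}"
proof -
  have sub: "U \<subseteq> X.sp" "V \<subseteq> Y.sp" using U V openin_subset by auto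
  define Q where "Q = cls ` {(x, y). x \<in> U \<and> y \<in> V \<and> X.src x = Y.rng y}"
  have "openin D {p \<in> topspace D. cls p \<in> Q}"
    unfolding openin_fibre_product
  proof (intro conjI allI impI)
    show "{p \<in> topspace D. cls p \<in> Q} \<subseteq> {(x, y). X.src x = Y.rng y}" by auto
    fix a b assume "(a, b) \<in> {p \<in> topspace D. cls p \<in> Q}"
    then obtain x y where D: "(a, b) \<in> topspace D" and xy: "x \<in> U" "y \<in> V" "X.src x = Y.rng y"
      and c: "cls (a, b) = cls (x, y)"
      unfolding Q_def by blast
    have ab: "a \<in> X.sp" "b \<in> Y.sp" "X.src a = Y.rng b" using D by auto
    have "(x, y) \<in> topspace D" using xy sub by auto
    then have "(x, y) \<in> cls (a, b)" using cls_refl c by simp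
    then obtain g where g: "g \<in> X.G.arr" "g_src G g = Y.rng b" "x = X.ract a (g_inv G g)" "y = Y.lact g b"
      unfolding cls_iff by blast
    note i = X.G.inv_arr[OF g(1)] X.G.rng_inv[OF g(1)]
    obtain S1 N1 where 1: "openin (g_arr G) S1" "openin (k_space Y) N1" "g \<in> S1" "b \<in> N1"
      "\<forall>h\<in>S1. \<forall>b\<in>N1. g_src G h = Y.rng b \<longrightarrow> Y.lact h b \<in> V"
      using continuous_map_fibre_product_box[OF Y.lact_cont V g(1) ab(2) g(2)] xy(2) g(4) by blast
    have "X.ract a (g_inv G g) \<in> U" "X.src a = g_rng G (g_inv G g)" using xy(1) g i ab by simp_all
    then obtain N2 S2 where 2: "openin (k_space X) N2" "openin (g_arr G) S2" "a \<in> N2" "g_inv G g \<in> S2"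
      "\<forall>a\<in>N2. \<forall>h\<in>S2. X.src a = g_rng G h \<longrightarrow> X.ract a h \<in> U"
      using continuous_map_fibre_product_box[OF X.ract_cont U ab(1) i(1)] by blast
    define S where "S = S1 \<inter> {h \<in> X.G.arr. g_inv G h \<in> S2}"
    have S: "openin (g_arr G) S" "g \<in> S"
      unfolding S_def using 1(1,3) 2(2,4) g(1) openin_continuous_map_preimage[OF X.G.inv_cont] by auto
    define N where "N = N1 \<inter> {b \<in> Y.sp. Y.rng b \<in> g_src G ` S}"
    have "openin (g_obj G) (g_src G ` S)" using S(1) X.G.src_open_map unfolding open_map_def by blast
    then have N: "openin (k_space Y) N"
      unfolding N_def using 1(2) openin_continuous_map_preimage[OF Y.rng_cont] by blast
    have bN: "b \<in> N" unfolding N_def using 1(4) ab(2) g(2) S(2) by force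
    have "(a', b') \<in> {p \<in> topspace D. cls p \<in> Q}"
      if a': "a' \<in> N2" and b': "b' \<in> N" and ab': "X.src a' = Y.rng b'" for a' b'
    proof -
      obtain h where h: "h \<in> S1" "h \<in> X.G.arr" "g_inv G h \<in> S2" "g_src G h = Y.rng b'"
        using b' unfolding N_def S_def by force
      have sp: "a' \<in> X.sp" "b' \<in> Y.sp" "b' \<in> N1" using a' b' 2(1) openin_subset unfolding N_def by blast+
      then have D': "(a', b') \<in> topspace D" using ab' by simp
      have hb: "Y.lact h b' \<in> V" using 1(5) h sp by blast
      have ah: "X.ract a' (g_inv G h) \<in> U" using 2(5) a' h ab' X.G.rng_inv[OF h(2)] by simp
      have mem: "(X.ract a' (g_inv G h), Y.lact h b') \<in> cls (a', b')"
        unfolding cls_iff using h by blast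
      have cm: "(X.ract a' (g_inv G h), Y.lact h b') \<in> topspace D" by (rule cls_mem(1)[OF D' mem])
      have "cls (a', b') = cls (X.ract a' (g_inv G h), Y.lact h b')"
        by (rule cls_eqI[OF D' mem])
      then show ?thesis using D' hb ah cm unfolding Q_def by auto
    qed
    then show "\<exists>U V. openin (k_space X) U \<and> openin (k_space Y) V \<and> a \<in> U \<and> b \<in> V \<and>
        (\<forall>x'\<in>U. \<forall>y'\<in>V. X.src x' = Y.rng y' \<longrightarrow> (x', y') \<in> {p \<in> topspace D. cls p \<in> Q})"
      using 2(1,3) N bN by blast
  qed
  moreover have "Q \<subseteq> cls ` topspace D" using sub unfolding Q_def by auto
  ultimately have "openin (k_space (composite G X Y)) Q"
    unfolding composite_def by (simp add: openin_quotient_topology)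
  then have "openin (k_space Z) (\<mu> ` Q)"
    using iso homeomorphic_imp_open_map unfolding correspondence_iso_def open_map_def by blast
  moreover have "\<mu> ` Q = {x \<cdot> y | x y. x \<in> U \<and> y \<in> V \<and> X.src x = Y.rng y}"
    unfolding Q_def dot_def by force
  ultimately show ?thesis by simp
qed

end

section \<open>Slices of a diagram of correspondences\<close>

locale diagram =
  fixes C :: "'c category" and F :: "('c, 'o, 'a) diagram"
  assumes category: "small_category C" and diagram: "corr_diagram C F"
begin

abbreviation "arrC \<equiv> c_arr C"
abbreviation "objC \<equiv> c_obj C"
abbreviation "sC \<equiv> c_src C"
abbreviation "rC \<equiv> c_rng C"
abbreviation "cC \<equiv> c_comp C"
abbreviation "Gr x \<equiv> d_grpd F x"
abbreviation "Co g \<equiv> d_corr F g"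
abbreviation "sp \<equiv> d_space F"
abbreviation "s g \<equiv> k_src (d_corr F g)"
abbreviation "r g \<equiv> k_rng (d_corr F g)"
abbreviation "dot \<equiv> d_mult C F"
abbreviation "slice_prod g h U V \<equiv>
  {d_mult C F g h \<gamma> \<eta> | \<gamma> \<eta>. \<gamma> \<in> U \<and> \<eta> \<in> V \<and> k_src (d_corr F g) \<gamma> = k_rng (d_corr F h) \<eta>}"
abbreviation "sl g \<equiv> slices (d_grpd F (c_src C g)) (d_corr F g)"

lemma obj_arr: "x \<in> objC \<Longrightarrow> x \<in> arrC"
  and src_objC: "g \<in> arrC \<Longrightarrow> sC g \<in> objC"
  and rng_objC: "g \<in> arrC \<Longrightarrow> rC g \<in> objC"
  and src_obj: "x \<in> objC \<Longrightarrow> sC x = x"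
  and rng_obj: "x \<in> objC \<Longrightarrow> rC x = x"
  and comp_arr: "g \<in> arrC \<Longrightarrow> h \<in> arrC \<Longrightarrow> sC g = rC h \<Longrightarrow> cC g h \<in> arrC"
  and src_comp: "g \<in> arrC \<Longrightarrow> h \<in> arrC \<Longrightarrow> sC g = rC h \<Longrightarrow> sC (cC g h) = sC h"
  and comp_id: "g \<in> arrC \<Longrightarrow> cC g (sC g) = g"
  using category unfolding small_category_def by (blast, simp_all)

lemma correspondence_Co: "g \<in> arrC \<Longrightarrow> correspondence (Gr (rC g)) (Gr (sC g)) (Co g)"
  using diagram unfolding corr_diagram_def by unfold_locales blast

lemma etale_Gr: "x \<in> objC \<Longrightarrow> etale (Gr x)"
  using diagram unfolding corr_diagram_def by unfold_locales blast

lemma product_Co: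
  assumes "g \<in> arrC" "h \<in> arrC" "sC g = rC h"
  shows "correspondence_product (Gr (rC g)) (Gr (sC g)) (Gr (sC h)) (Co g) (Co h) (Co (cC g h)) (d_mu F g h)"
proof -
  have "correspondence_iso (Gr (rC g)) (Gr (sC h)) (composite (Gr (sC g)) (Co g) (Co h))
      (Co (cC g h)) (d_mu F g h)"
    using diagram assms unfolding corr_diagram_def by blast
  then show ?thesis
    using correspondence_Co[OF assms(1)] correspondence_Co[OF assms(2)] assms(3)
    by (simp add: correspondence_product_def correspondence_product_axioms_def)
qed

lemma dot_conv:
  assumes "g \<in> arrC" "h \<in> arrC" "sC g = rC h"
  shows "dot g h \<gamma> \<eta> = correspondence_product.dot (Gr (sC g)) (Co g) (Co h) (d_mu F g h) \<gamma> \<eta>"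
  unfolding d_mult_def correspondence_product.dot_def[OF product_Co[OF assms]] ..

lemma sp_eq: "topspace (k_space (Co g)) = sp g"
  by (simp add: d_space_def)

lemma dot_sp:
  assumes "g \<in> arrC" "h \<in> arrC" "sC g = rC h" "\<gamma> \<in> sp g" "\<eta> \<in> sp h" "s g \<gamma> = r h \<eta>"
  shows "dot g h \<gamma> \<eta> \<in> sp (cC g h)" "r (cC g h) (dot g h \<gamma> \<eta>) = r g \<gamma>"
    "s (cC g h) (dot g h \<gamma> \<eta>) = s h \<eta>"
  using correspondence_product.dot_facts[OF product_Co[OF assms(1-3)], of \<gamma> \<eta>] assms(4-)
  by (simp_all add: dot_conv[OF assms(1-3)] sp_eq)

lemma dot_eqD:
  assumes "g \<in> arrC" "h \<in> arrC" "sC g = rC h" "\<gamma> \<in> sp g" "\<eta> \<in> sp h" "s g \<gamma> = r h \<eta>"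
    and "\<gamma>' \<in> sp g" "\<eta>' \<in> sp h" "s g \<gamma>' = r h \<eta>'" "dot g h \<gamma> \<eta> = dot g h \<gamma>' \<eta>'"
  shows "\<exists>k\<in>topspace (g_arr (Gr (sC g))). g_src (Gr (sC g)) k = r h \<eta> \<and>
    \<gamma>' = k_ract (Co g) \<gamma> (g_inv (Gr (sC g)) k) \<and> \<eta>' = k_lact (Co h) k \<eta>"
  using correspondence_product.dot_eqD[OF product_Co[OF assms(1-3)], of \<gamma> \<eta> \<gamma>' \<eta>'] assms(4-)
  by (simp add: dot_conv[OF assms(1-3)] sp_eq)

lemma openin_dot:
  assumes "g \<in> arrC" "h \<in> arrC" "sC g = rC h" "openin (k_space (Co g)) U" "openin (k_space (Co h)) V"
  shows "openin (k_space (Co (cC g h))) (slice_prod g h U V)"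
  using correspondence_product.openin_dot[OF product_Co[OF assms(1-3)] assms(4,5)]
  by (simp add: dot_conv[OF assms(1-3)])

lemma Co_obj:
  assumes "x \<in> objC"
  shows "k_space (Co x) = g_arr (Gr x)" "sp x = topspace (g_arr (Gr x))"
    "\<gamma> \<in> sp x \<Longrightarrow> r x \<gamma> = g_rng (Gr x) \<gamma>" "\<gamma> \<in> sp x \<Longrightarrow> s x \<gamma> = g_src (Gr x) \<gamma>"
    "\<gamma> \<in> sp x \<Longrightarrow> \<eta> \<in> sp x \<Longrightarrow> g_src (Gr x) \<gamma> = g_rng (Gr x) \<eta> \<Longrightarrow>
       k_ract (Co x) \<gamma> \<eta> = g_mult (Gr x) \<gamma> \<eta>"
  using diagram assms unfolding corr_diagram_def d_space_def by (simp_all add: Let_def)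

lemma dot_obj:
  assumes "g \<in> arrC" "\<gamma> \<in> sp g" "\<eta> \<in> topspace (g_arr (Gr (sC g)))" "s g \<gamma> = g_rng (Gr (sC g)) \<eta>"
  shows "dot g (sC g) \<gamma> \<eta> = k_ract (Co g) \<gamma> \<eta>"
  using diagram assms unfolding corr_diagram_def by simp

lemma dot_assoc:
  assumes "g \<in> arrC" "h \<in> arrC" "k \<in> arrC" "sC g = rC h" "sC h = rC k"
    "\<gamma> \<in> sp g" "\<eta> \<in> sp h" "\<zeta> \<in> sp k" "s g \<gamma> = r h \<eta>" "s h \<eta> = r k \<zeta>"
  shows "dot (cC g h) k (dot g h \<gamma> \<eta>) \<zeta> = dot g (cC h k) \<gamma> (dot h k \<eta> \<zeta>)"
  using diagram assms unfolding corr_diagram_def by simp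

text \<open>The right multiplication by \<open>k\<close> is the product with \<open>k\<close> as an element of the correspondence of
  an identity arrow, so associativity applies.\<close>

lemma ract_dot:
  assumes gh: "g \<in> arrC" "h \<in> arrC" "sC g = rC h" and \<gamma>: "\<gamma> \<in> sp g" "\<eta> \<in> sp h" "s g \<gamma> = r h \<eta>"
    and k: "k \<in> topspace (g_arr (Gr (sC h)))" "s h \<eta> = g_rng (Gr (sC h)) k"
  shows "k_ract (Co (cC g h)) (dot g h \<gamma> \<eta>) k = dot g h \<gamma> (k_ract (Co h) \<eta> k)"
proof -
  let ?x = "sC h"
  have x: "?x \<in> objC" by (rule src_objC[OF gh(2)])
  have kx: "k \<in> sp ?x" "r ?x k = s h \<eta>" using k Co_obj[OF x] by simp_all
  have "k_ract (Co (cC g h)) (dot g h \<gamma> \<eta>) k = dot (cC g h) ?x (dot g h \<gamma> \<eta>) k"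
    using dot_obj[of "cC g h"] gh k dot_sp[OF gh \<gamma>] by (simp add: comp_arr src_comp)
  also have "\<dots> = dot g (cC h ?x) \<gamma> (dot h ?x \<eta> k)"
    using gh \<gamma> kx x by (intro dot_assoc) (simp_all add: obj_arr rng_obj)
  also have "\<dots> = dot g h \<gamma> (k_ract (Co h) \<eta> k)"
    using dot_obj[OF gh(2) \<gamma>(2) k] comp_id[OF gh(2)] by simp
  finally show ?thesis .
qed

lemma slice_sp: "g \<in> arrC \<Longrightarrow> U \<in> sl g \<Longrightarrow> \<gamma> \<in> U \<Longrightarrow> \<gamma> \<in> sp g"
  using correspondence.slice_sp[OF correspondence_Co] by (simp add: sp_eq)

lemma slice_src_inj: "g \<in> arrC \<Longrightarrow> U \<in> sl g \<Longrightarrow> \<gamma> \<in> U \<Longrightarrow> \<gamma>' \<in> U \<Longrightarrow> s g \<gamma> = s g \<gamma>' \<Longrightarrow> \<gamma> = \<gamma>'"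
  using correspondence.slice_src_inj[OF correspondence_Co] by blast

lemma slice_open: "g \<in> arrC \<Longrightarrow> U \<in> sl g \<Longrightarrow> openin (k_space (Co g)) U"
  using correspondence.slice_open[OF correspondence_Co] by blast

lemma slice_exists:
  assumes "g \<in> arrC" "\<gamma> \<in> N" "openin (k_space (Co g)) N"
  shows "\<exists>U\<in>sl g. \<gamma> \<in> U \<and> U \<subseteq> N"
  using correspondence.slice_exists[OF correspondence_Co[OF assms(1)] assms(2,3)] .

lemma slice_exists_sp:
  assumes "g \<in> arrC" "\<gamma> \<in> sp g"
  shows "\<exists>U\<in>sl g. \<gamma> \<in> U"
  using slice_exists[OF assms(1), of \<gamma> "sp g"] assms(2) openin_topspace[of "k_space (Co g)"]
  unfolding sp_eq by blast

lemma slice_eqI: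
  assumes "g \<in> arrC" "U \<in> sl g" "\<gamma> \<in> U" "\<gamma>' \<in> U"
    and "k \<in> topspace (g_arr (Gr (sC g)))" "s g \<gamma> = g_rng (Gr (sC g)) k" "\<gamma>' = k_ract (Co g) \<gamma> k"
  shows "\<gamma>' = \<gamma> \<and> k = g_unit (Gr (sC g)) (s g \<gamma>)"
  using correspondence.slice_eqI[OF correspondence_Co[OF assms(1)] assms(2-)] .

lemma slicesI:
  assumes g: "g \<in> arrC" and U: "openin (k_space (Co g)) U"
    and inj: "\<And>\<gamma> \<gamma>'. \<gamma> \<in> U \<Longrightarrow> \<gamma>' \<in> U \<Longrightarrow> s g \<gamma> = s g \<gamma>' \<Longrightarrow> \<gamma> = \<gamma>'"
    and orb: "\<And>\<gamma> k. \<gamma> \<in> U \<Longrightarrow> k_ract (Co g) \<gamma> k \<in> U \<Longrightarrow> k \<in> topspace (g_arr (Gr (sC g))) \<Longrightarrow>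
      s g \<gamma> = g_rng (Gr (sC g)) k \<Longrightarrow> k_ract (Co g) \<gamma> k = \<gamma>"
  shows "U \<in> sl g"
proof -
  have "inj_on (right_orbit (Gr (sC g)) (Co g)) U"
  proof (rule inj_onI)
    fix \<gamma> \<gamma>' assume *: "\<gamma> \<in> U" "\<gamma>' \<in> U"
      "right_orbit (Gr (sC g)) (Co g) \<gamma> = right_orbit (Gr (sC g)) (Co g) \<gamma>'"
    have "\<gamma> \<in> topspace (k_space (Co g))" "\<gamma>' \<in> topspace (k_space (Co g))"
      using * openin_subset[OF U] by blast+
    then obtain k where "k \<in> topspace (g_arr (Gr (sC g)))" "s g \<gamma> = g_rng (Gr (sC g)) k"
      "\<gamma>' = k_ract (Co g) \<gamma> k"
      using correspondence.orbit_eq_iff[OF correspondence_Co[OF g]] *(3) by blast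
    then show "\<gamma> = \<gamma>'" using orb[of \<gamma> k] * by simp
  qed
  moreover have "inj_on (s g) U" using inj by (rule inj_onI)
  ultimately show ?thesis using U unfolding slices_def by blast
qed

text \<open>If \<open>\<gamma> \<eta> k = \<gamma>' \<eta>'\<close>, then \<open>\<gamma>' = \<gamma> l\<^sup>-\<^sup>1\<close> and \<open>\<eta>' = l \<eta> k\<close> for some arrow \<open>l\<close>.  This is
  a unit because \<open>\<gamma>\<close> and \<open>\<gamma>'\<close> lie in the slice \<open>U\<close>, and then \<open>\<eta>' = \<eta> k\<close> is equal to \<open>\<eta>\<close> because both
  lie in the slice \<open>V\<close>.\<close>

lemma product_slice:
  assumes gh: "g \<in> arrC" "h \<in> arrC" "sC g = rC h" and U: "U \<in> sl g" and V: "V \<in> sl h"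
  shows "slice_prod g h U V \<in> sl (cC g h)" (is "?UV \<in> _")
proof (rule slicesI)
  show "cC g h \<in> arrC" using gh by (rule comp_arr)
  show "openin (k_space (Co (cC g h))) ?UV"
    using openin_dot[OF gh slice_open[OF gh(1) U] slice_open[OF gh(2) V]] .
  have sp: "\<gamma> \<in> sp g" "\<eta> \<in> sp h" if "\<gamma> \<in> U" "\<eta> \<in> V" for \<gamma> \<eta>
    using that slice_sp[OF gh(1) U] slice_sp[OF gh(2) V] by auto
  {
    fix a b assume "a \<in> ?UV" "b \<in> ?UV" and eq: "s (cC g h) a = s (cC g h) b"
    then obtain \<gamma> \<eta> \<gamma>' \<eta>' where
      1: "a = dot g h \<gamma> \<eta>" "\<gamma> \<in> U" "\<eta> \<in> V" "s g \<gamma> = r h \<eta>" and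
      2: "b = dot g h \<gamma>' \<eta>'" "\<gamma>' \<in> U" "\<eta>' \<in> V" "s g \<gamma>' = r h \<eta>'" by blast
    have "s h \<eta> = s h \<eta>'"
      using eq 1 2 dot_sp(3)[OF gh sp[OF 1(2,3)] 1(4)] dot_sp(3)[OF gh sp[OF 2(2,3)] 2(4)] by simp
    then have "\<eta> = \<eta>'" using slice_src_inj[OF gh(2) V 1(3) 2(3)] by blast
    moreover from this have "\<gamma> = \<gamma>'" using slice_src_inj[OF gh(1) U 1(2) 2(2)] 1(4) 2(4) by simp
    ultimately show "a = b" using 1(1) 2(1) by simp
  }
  fix a k assume a: "a \<in> ?UV" and b: "k_ract (Co (cC g h)) a k \<in> ?UV"
    and k: "k \<in> topspace (g_arr (Gr (sC (cC g h))))" "s (cC g h) a = g_rng (Gr (sC (cC g h))) k"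
  from a b obtain \<gamma> \<eta> \<gamma>' \<eta>' where
    1: "a = dot g h \<gamma> \<eta>" "\<gamma> \<in> U" "\<eta> \<in> V" "s g \<gamma> = r h \<eta>" and
    2: "k_ract (Co (cC g h)) a k = dot g h \<gamma>' \<eta>'" "\<gamma>' \<in> U" "\<eta>' \<in> V" "s g \<gamma>' = r h \<eta>'" by blast
  note sp1 = sp[OF 1(2,3)] and sp2 = sp[OF 2(2,3)]
  interpret X: correspondence "Gr (rC g)" "Gr (sC g)" "Co g" by (rule correspondence_Co[OF gh(1)])
  interpret Y: correspondence "Gr (rC h)" "Gr (sC h)" "Co h" by (rule correspondence_Co[OF gh(2)])
  have k': "k \<in> topspace (g_arr (Gr (sC h)))" "s h \<eta> = g_rng (Gr (sC h)) k"
    using k src_comp[OF gh] dot_sp(3)[OF gh sp1 1(4)] 1(1) by simp_all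
  have \<eta>k: "Y.ract \<eta> k \<in> sp h" "r h (Y.ract \<eta> k) = r h \<eta>"
    using Y.ract_sp Y.rng_ract sp1(2) k' by (simp_all add: sp_eq)
  have eq: "dot g h \<gamma> (Y.ract \<eta> k) = dot g h \<gamma>' \<eta>'"
    using ract_dot[OF gh sp1 1(4) k'] 1(1) 2(1) by simp
  obtain l where l: "l \<in> X.G.arr" "g_src (Gr (sC g)) l = r h (Y.ract \<eta> k)"
    "\<gamma>' = X.ract \<gamma> (g_inv (Gr (sC g)) l)" "\<eta>' = Y.lact l (Y.ract \<eta> k)"
    using dot_eqD[OF gh sp1(1) \<eta>k(1) _ sp2 2(4) eq] \<eta>k(2) 1(4) by auto
  have "g_inv (Gr (sC g)) l = g_unit (Gr (sC g)) (s g \<gamma>)" "\<gamma>' = \<gamma>"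
    using slice_eqI[OF gh(1) U 1(2) 2(2) X.G.inv_arr[OF l(1)] _ l(3)] X.G.rng_inv[OF l(1)] l(2) \<eta>k(2) 1(4)
    by simp_all
  then have "l = g_unit (Gr (sC g)) (s g \<gamma>)"
    using X.G.inv_eq_unit[OF l(1)] X.src_obj sp1(1) by (simp add: sp_eq)
  then have "l = g_unit (Gr (rC h)) (r h (Y.ract \<eta> k))" using 1(4) \<eta>k(2) gh(3) by simp
  then have "\<eta>' = Y.ract \<eta> k" using l(4) Y.lact_unit \<eta>k(1) by (simp add: sp_eq)
  then have "Y.ract \<eta> k \<in> V" using 2(3) by simp
  then have "Y.ract \<eta> k = \<eta>"
    using slice_eqI[OF gh(2) V 1(3) _ k' HOL.refl] by blast
  then show "k_ract (Co (cC g h)) a k = a" using ract_dot[OF gh sp1 1(4) k'] 1(1) by simp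
qed

lemma bracket_slice:
  assumes g: "g \<in> arrC" and U: "U \<in> sl g" and V: "V \<in> sl g"
  shows "slice_bracket (Gr (sC g)) (Co g) U V \<in> sl (sC g)" (is "?B \<in> _")
proof -
  let ?x = "sC g"
  interpret X: correspondence "Gr (rC g)" "Gr ?x" "Co g" by (rule correspondence_Co[OF g])
  have x: "?x \<in> objC" by (rule src_objC[OF g])
  have B: "openin (g_arr (Gr ?x)) ?B"
    using X.openin_slice_bracket[OF X.slice_open[OF U] X.slice_open[OF V]] .
  have sub: "\<gamma> \<in> X.G.arr \<and> \<gamma> \<in> sp ?x" if "\<gamma> \<in> ?B" for \<gamma>
    using that openin_subset[OF B] Co_obj(2)[OF x] by blast
  show ?thesis
  proof (rule slicesI[OF obj_arr[OF x]])
    show "openin (k_space (Co ?x)) ?B" using B Co_obj(1)[OF x] by simp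
    show "\<gamma> = \<gamma>'" if "\<gamma> \<in> ?B" "\<gamma>' \<in> ?B" "s ?x \<gamma> = s ?x \<gamma>'" for \<gamma> \<gamma>'
      using inj_onD[OF X.slice_bracket_inj(1)[OF U V] _ that(1,2)] that sub Co_obj(4)[OF x] by simp
    fix \<gamma> k assume a: "\<gamma> \<in> ?B" "k_ract (Co ?x) \<gamma> k \<in> ?B"
      and k: "k \<in> topspace (g_arr (Gr (sC ?x)))" "s ?x \<gamma> = g_rng (Gr (sC ?x)) k"
    have k': "k \<in> X.G.arr" "k \<in> sp ?x" "g_src (Gr ?x) \<gamma> = g_rng (Gr ?x) k"
      using k Co_obj(2,4)[OF x] src_obj[OF x] sub[OF a(1)] by simp_all
    have eq: "k_ract (Co ?x) \<gamma> k = g_mult (Gr ?x) \<gamma> k"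
      using Co_obj(5)[OF x] sub[OF a(1)] k' by blast
    have "g_rng (Gr ?x) (g_mult (Gr ?x) \<gamma> k) = g_rng (Gr ?x) \<gamma>"
      using X.G.rng_mult sub[OF a(1)] k' by blast
    then show "k_ract (Co ?x) \<gamma> k = \<gamma>"
      using inj_onD[OF X.slice_bracket_inj(2)[OF U V] _ a(2) a(1)] eq by simp
  qed
qed

lemma slice_bracket_iff:
  assumes g: "g \<in> arrC" and U: "U \<in> sl g" and V: "V \<in> sl g"
  shows "k \<in> slice_bracket (Gr (sC g)) (Co g) U V \<longleftrightarrow>
    k \<in> topspace (g_arr (Gr (sC g))) \<and> (\<exists>\<gamma>\<in>U. s g \<gamma> = g_rng (Gr (sC g)) k \<and> k_ract (Co g) \<gamma> k \<in> V)"
proof -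
  have "U \<subseteq> topspace (k_space (Co g))" "V \<subseteq> topspace (k_space (Co g))"
    using slice_open[OF g U] slice_open[OF g V] openin_subset by auto
  then show ?thesis
    using correspondence.slice_bracket_eq[OF correspondence_Co[OF g]] by simp
qed

abbreviation "gens \<equiv> diagram_slices C F"
abbreviation "rels \<equiv> diagram_isg_relations C F"
abbreviation "IF \<equiv> diagram_isg C F"

lemma IF_eq: "IF = presented_isg gens rels"
  by (simp add: diagram_isg_def)

lemma gens_cases:
  assumes "P \<in> gens"
  obtains g U where "P = {g} \<times> U" "g \<in> arrC" "U \<in> sl g"
  using assms unfolding diagram_slices_def by blast

lemma gensI: "g \<in> arrC \<Longrightarrow> U \<in> sl g \<Longrightarrow> {g} \<times> U \<in> gens"
  unfolding diagram_slices_def by blast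

lemma slice_mult_eq:
  assumes "sC g = rC h"
  shows "diagram_slice_mult C F ({g} \<times> U) ({h} \<times> V) =
    {cC g h} \<times> slice_prod g h U V"
  using assms unfolding diagram_slice_mult_def by auto

definition Theta :: "'c \<Rightarrow> 'a set \<Rightarrow> ('c \<times> 'a) set isg_term set" where
  "Theta g U = isg_class gens rels (Gen ({g} \<times> U))"

lemma Theta_carrier: "g \<in> arrC \<Longrightarrow> U \<in> sl g \<Longrightarrow> Theta g U \<in> s_carrier IF"
  unfolding Theta_def IF_eq presented_isg_carrier using gensI by auto

lemma Theta_mult:
  assumes "g \<in> arrC" "h \<in> arrC" "sC g = rC h" "U \<in> sl g" "V \<in> sl h"
  shows "s_mult IF (Theta g U) (Theta h V) =
    Theta (cC g h) (slice_prod g h U V)"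
proof -
  have P: "{g} \<times> U \<in> gens" "{h} \<times> V \<in> gens" using assms gensI by auto
  have "(Gen (diagram_slice_mult C F ({g} \<times> U) ({h} \<times> V)), Mul (Gen ({g} \<times> U)) (Gen ({h} \<times> V))) \<in> rels"
    using P unfolding diagram_isg_relations_def by blast
  then have "isg_class gens rels (Gen (diagram_slice_mult C F ({g} \<times> U) ({h} \<times> V))) =
      isg_class gens rels (Mul (Gen ({g} \<times> U)) (Gen ({h} \<times> V)))"
    by (intro isg_class_eqI isg_eq.rel)
  then show ?thesis
    using presented_isg_mult[of "Gen ({g} \<times> U)" gens "Gen ({h} \<times> V)" rels] P
    unfolding Theta_def IF_eq slice_mult_eq[OF assms(3)] by simp
qed

lemma Theta_bracket:
  assumes "g \<in> arrC" "U \<in> sl g" "V \<in> sl g"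
  shows "s_mult IF (s_star IF (Theta g U)) (Theta g V) = Theta (sC g) (slice_bracket (Gr (sC g)) (Co g) U V)"
proof -
  have P: "{g} \<times> U \<in> gens" "{g} \<times> V \<in> gens" using assms gensI by auto
  have "(Mul (Star (Gen ({g} \<times> U))) (Gen ({g} \<times> V)),
      Gen ({sC g} \<times> slice_bracket (Gr (sC g)) (Co g) U V)) \<in> rels"
    using assms unfolding diagram_isg_relations_def by blast
  then have "isg_class gens rels (Mul (Star (Gen ({g} \<times> U))) (Gen ({g} \<times> V))) =
      isg_class gens rels (Gen ({sC g} \<times> slice_bracket (Gr (sC g)) (Co g) U V))"
    by (intro isg_class_eqI isg_eq.rel)
  then show ?thesis
    using presented_isg_mult[of "Star (Gen ({g} \<times> U))" gens "Gen ({g} \<times> V)" rels]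
      presented_isg_star[of "Gen ({g} \<times> U)" gens rels] P
    unfolding Theta_def IF_eq by simp
qed

text \<open>By this induction, homomorphisms on \<open>\<I>(F)\<close> agree if they agree on the symbols \<open>\<Theta>(U)\<close>.\<close>

lemma IF_induct [consumes 1, case_names Theta mult star]:
  assumes "t \<in> s_carrier IF"
    and "\<And>g U. g \<in> arrC \<Longrightarrow> U \<in> sl g \<Longrightarrow> P (Theta g U)"
    and "\<And>t u. t \<in> s_carrier IF \<Longrightarrow> u \<in> s_carrier IF \<Longrightarrow> P t \<Longrightarrow> P u \<Longrightarrow> P (s_mult IF t u)"
    and "\<And>t. t \<in> s_carrier IF \<Longrightarrow> P t \<Longrightarrow> P (s_star IF t)"
  shows "P t"
proof -
  have mem: "isg_class gens rels a \<in> s_carrier IF" if "set_isg_term a \<subseteq> gens" for a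
    using that unfolding IF_eq presented_isg_carrier by blast
  have "P (isg_class gens rels a)" if "set_isg_term a \<subseteq> gens" for a
    using that
  proof (induction a)
    case (Gen Q)
    then have "Q \<in> gens" by simp
    then show ?case by (rule gens_cases) (use assms(2) in \<open>simp add: Theta_def\<close>)
  next
    case (Mul a b)
    then have ab: "set_isg_term a \<subseteq> gens" "set_isg_term b \<subseteq> gens" by auto
    show ?case
      using assms(3)[OF mem[OF ab(1)] mem[OF ab(2)] Mul.IH(1)[OF ab(1)] Mul.IH(2)[OF ab(2)]]
        presented_isg_mult[OF ab] unfolding IF_eq by simp
  next
    case (Star a)
    then have a: "set_isg_term a \<subseteq> gens" by auto
    show ?case
      using assms(4)[OF mem[OF a] Star.IH[OF a]] presented_isg_star[OF a] unfolding IF_eq by simp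
  qed
  then show ?thesis using assms(1) unfolding IF_eq presented_isg_carrier by blast
qed

end

section \<open>The action of the inverse semigroup induced by a diagram action\<close>

locale diagram_action = diagram C F
  for C :: "'c category" and F :: "('c, 'o, 'a) diagram" +
  fixes Y :: "'y topology" and A :: "('c, 'o, 'a, 'y) faction"
  assumes F_action: "F_action C F Y A"
begin

abbreviation "prt \<equiv> f_part A"
abbreviation "rho \<equiv> f_rng A"
abbreviation "act \<equiv> f_act A"
abbreviation "theta \<equiv> induced_action C F A"

lemma part_Union: "(\<Union>x\<in>objC. prt x) = topspace Y"
  and part_disjoint: "disjoint_family_on prt objC"
  and part_open: "x \<in> objC \<Longrightarrow> openin Y (prt x)"
  and part_closed: "x \<in> objC \<Longrightarrow> closedin Y (prt x)"
  and rho_cont: "x \<in> objC \<Longrightarrow> continuous_map (subtopology Y (prt x)) (g_obj (Gr x)) rho"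
  and part_outside: "x \<notin> objC \<Longrightarrow> prt x = {}"
  and rho_ext: "rho \<in> extensional (topspace Y)"
  using F_action unfolding F_action_def by simp_all

abbreviation "Dom g \<equiv> fibre_product (k_space (Co g)) (subtopology Y (prt (sC g))) (s g) rho"

lemma act_cont: "g \<in> arrC \<Longrightarrow> continuous_map (Dom g) (subtopology Y (prt (rC g))) (\<lambda>(\<gamma>, y). act g \<gamma> y)"
  and act_open: "g \<in> arrC \<Longrightarrow> open_map (Dom g) (subtopology Y (prt (rC g))) (\<lambda>(\<gamma>, y). act g \<gamma> y)"
  and act_surj: "g \<in> arrC \<Longrightarrow>
    (\<lambda>(\<gamma>, y). act g \<gamma> y) ` topspace (Dom g) = topspace (subtopology Y (prt (rC g)))"
  using F_action unfolding F_action_def by (simp_all only: Let_def)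

lemma rho_act: "g \<in> arrC \<Longrightarrow> \<gamma> \<in> sp g \<Longrightarrow> y \<in> prt (sC g) \<Longrightarrow> s g \<gamma> = rho y \<Longrightarrow>
    rho (act g \<gamma> y) = r g \<gamma>"
  using F_action unfolding F_action_def by simp

lemma act_act: "g \<in> arrC \<Longrightarrow> h \<in> arrC \<Longrightarrow> sC g = rC h \<Longrightarrow> \<gamma> \<in> sp g \<Longrightarrow> \<eta> \<in> sp h \<Longrightarrow>
    y \<in> prt (sC h) \<Longrightarrow> s g \<gamma> = r h \<eta> \<Longrightarrow> s h \<eta> = rho y \<Longrightarrow>
    act g \<gamma> (act h \<eta> y) = act (cC g h) (dot g h \<gamma> \<eta>) y"
  using F_action unfolding F_action_def by simp

lemma act_eqD: "g \<in> arrC \<Longrightarrow> \<gamma> \<in> sp g \<Longrightarrow> \<gamma>' \<in> sp g \<Longrightarrow> y \<in> prt (sC g) \<Longrightarrow> y' \<in> prt (sC g) \<Longrightarrow>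
    s g \<gamma> = rho y \<Longrightarrow> s g \<gamma>' = rho y' \<Longrightarrow> act g \<gamma> y = act g \<gamma>' y' \<Longrightarrow>
    \<exists>\<eta>\<in>topspace (g_arr (Gr (sC g))). g_rng (Gr (sC g)) \<eta> = s g \<gamma> \<and> g_src (Gr (sC g)) \<eta> = rho y' \<and>
      \<gamma>' = k_ract (Co g) \<gamma> \<eta> \<and> y = act (sC g) \<eta> y'"
  using F_action unfolding F_action_def by blast

lemma act_undefined: "\<not> (g \<in> arrC \<and> \<gamma> \<in> sp g \<and> y \<in> prt (sC g) \<and> s g \<gamma> = rho y) \<Longrightarrow>
    act g \<gamma> y = undefined"
  using F_action unfolding F_action_def by blast

lemma part_top: "y \<in> prt x \<Longrightarrow> y \<in> topspace Y"
  using part_Union part_outside by (cases "x \<in> objC") auto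

lemma part_unique: "y \<in> prt x \<Longrightarrow> y \<in> prt x' \<Longrightarrow> x = x'"
  using part_disjoint part_outside unfolding disjoint_family_on_def by (metis disjoint_iff emptyE)

lemma part_exists: "y \<in> topspace Y \<Longrightarrow> \<exists>x\<in>objC. y \<in> prt x"
  using part_Union by blast

lemma topspace_part: "topspace (subtopology Y (prt x)) = prt x"
  using part_top by auto

lemma rho_obj: "x \<in> objC \<Longrightarrow> y \<in> prt x \<Longrightarrow> rho y \<in> topspace (g_obj (Gr x))"
  using continuous_map_funspace[OF rho_cont] topspace_part by blast

lemma act_part:
  assumes "g \<in> arrC" "\<gamma> \<in> sp g" "y \<in> prt (sC g)" "s g \<gamma> = rho y"
  shows "act g \<gamma> y \<in> prt (rC g)"
  using continuous_map_fibre_productD[OF act_cont[OF assms(1)], of \<gamma> y] assms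
  unfolding topspace_part sp_eq by blast

lemma act_surjD:
  assumes "g \<in> arrC" "z \<in> prt (rC g)"
  shows "\<exists>\<gamma>\<in>sp g. \<exists>y\<in>prt (sC g). s g \<gamma> = rho y \<and> z = act g \<gamma> y"
proof -
  have "z \<in> (\<lambda>(\<gamma>, y). act g \<gamma> y) ` topspace (Dom g)"
    using act_surj[OF assms(1)] assms(2) unfolding topspace_part by blast
  then show ?thesis using topspace_part by (auto simp: sp_eq)
qed

text \<open>By surjectivity \<open>y = \<gamma> \<cdot> z\<close>, and \<open>1 \<cdot> (\<gamma> \<cdot> z) = (1 \<gamma>) \<cdot> z\<close>.\<close>

lemma act_unit:
  assumes x: "x \<in> objC" and y: "y \<in> prt x"
  shows "act x (g_unit (Gr x) (rho y)) y = y"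
proof -
  interpret E: etale "Gr x" by (rule etale_Gr[OF x])
  note ids = src_obj[OF x] rng_obj[OF x] obj_arr[OF x]
  obtain \<gamma> z where \<gamma>: "\<gamma> \<in> sp x" "z \<in> prt x" "s x \<gamma> = rho z" "y = act x \<gamma> z"
    using act_surjD[of x y] y ids by auto
  have ry: "rho y = r x \<gamma>" using rho_act[of x \<gamma> z] \<gamma> ids by simp
  let ?u = "g_unit (Gr x) (rho y)"
  have o: "rho y \<in> E.obj" using rho_obj[OF x y] .
  have u: "?u \<in> sp x" "s x ?u = rho y" "\<gamma> \<in> E.arr"
    using E.unit_arr[OF o] E.src_unit[OF o] Co_obj[OF x] \<gamma>(1) by simp_all
  have "act x ?u y = act (cC x x) (dot x x ?u \<gamma>) z"
    unfolding \<gamma>(4) using act_act[of x x ?u \<gamma> z] ids u \<gamma> ry by simp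
  also have "dot x x ?u \<gamma> = k_ract (Co x) ?u \<gamma>"
    using dot_obj[of x ?u \<gamma>] ids u ry Co_obj(3)[OF x \<gamma>(1)] by simp
  also have "\<dots> = g_mult (Gr x) ?u \<gamma>"
    using Co_obj(5)[OF x u(1) \<gamma>(1)] E.src_unit[OF o] ry Co_obj(3)[OF x \<gamma>(1)] by simp
  also have "\<dots> = \<gamma>" using E.unit_mult[OF u(3)] ry Co_obj(3)[OF x \<gamma>(1)] by simp
  also have "cC x x = x" using comp_id[OF ids(3)] ids by simp
  finally show ?thesis using \<gamma>(4) by simp
qed

text \<open>Condition (ii) gives \<open>\<gamma>' = \<gamma> \<eta>\<close> and \<open>y = \<eta> \<cdot> y'\<close>, and \<open>\<eta>\<close> is a unit because \<open>\<gamma>\<close> and \<open>\<gamma>'\<close> lie in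
  the same slice.\<close>

lemma act_slice_inj:
  assumes g: "g \<in> arrC" and U: "U \<in> sl g" and \<gamma>: "\<gamma> \<in> U" "\<gamma>' \<in> U"
    and y: "y \<in> prt (sC g)" "y' \<in> prt (sC g)" "s g \<gamma> = rho y" "s g \<gamma>' = rho y'"
    and eq: "act g \<gamma> y = act g \<gamma>' y'"
  shows "\<gamma> = \<gamma>' \<and> y = y'"
proof -
  obtain \<eta> where \<eta>: "\<eta> \<in> topspace (g_arr (Gr (sC g)))" "g_rng (Gr (sC g)) \<eta> = s g \<gamma>"
    "\<gamma>' = k_ract (Co g) \<gamma> \<eta>" "y = act (sC g) \<eta> y'"
    using act_eqD[OF g slice_sp[OF g U \<gamma>(1)] slice_sp[OF g U \<gamma>(2)] y eq] by blast
  then have "\<gamma>' = \<gamma>" "\<eta> = g_unit (Gr (sC g)) (s g \<gamma>)"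
    using slice_eqI[OF g U \<gamma> \<eta>(1) \<eta>(2)[symmetric]] by blast+
  then show ?thesis using \<eta>(4) act_unit[OF src_objC[OF g] y(2)] y(4) by simp
qed

lemma slice_action_iff:
  assumes g: "g \<in> arrC" and U: "U \<in> sl g"
  shows "slice_action C F A ({g} \<times> U) y = Some z \<longleftrightarrow>
    (\<exists>\<gamma>\<in>U. y \<in> prt (sC g) \<and> s g \<gamma> = rho y \<and> z = act g \<gamma> y)"
proof (cases "\<exists>\<gamma>\<in>U. y \<in> prt (sC g) \<and> s g \<gamma> = rho y")
  case True
  then obtain \<gamma> where \<gamma>: "\<gamma> \<in> U" "y \<in> prt (sC g)" "s g \<gamma> = rho y" by blast
  have uniq: "\<gamma>' = \<gamma>" if "\<gamma>' \<in> U" "s g \<gamma>' = rho y" for \<gamma>'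
    using slice_src_inj[OF g U that(1) \<gamma>(1)] that(2) \<gamma>(3) by simp
  let ?R = "\<lambda>z. \<exists>g' \<gamma>. (g', \<gamma>) \<in> {g} \<times> U \<and> y \<in> prt (sC g') \<and> s g' \<gamma> = rho y \<and> z = act g' \<gamma> y"
  have "(THE z. ?R z) = act g \<gamma> y"
  proof (rule the_equality)
    show "?R (act g \<gamma> y)" using \<gamma> by blast
    fix z assume "?R z"
    then obtain \<delta> where "\<delta> \<in> U" "s g \<delta> = rho y" "z = act g \<delta> y" by blast
    then show "z = act g \<gamma> y" using uniq by blast
  qed
  moreover have "\<exists>g' \<gamma>. (g', \<gamma>) \<in> {g} \<times> U \<and> y \<in> prt (sC g') \<and> s g' \<gamma> = rho y" using \<gamma> by blast
  ultimately have "slice_action C F A ({g} \<times> U) y = Some (act g \<gamma> y)"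
    unfolding slice_action_def by (simp only: if_True)
  moreover have "(\<exists>\<gamma>\<in>U. y \<in> prt (sC g) \<and> s g \<gamma> = rho y \<and> z = act g \<gamma> y) \<longleftrightarrow> act g \<gamma> y = z"
    using \<gamma> uniq by blast
  ultimately show ?thesis by (simp only: option.inject)
next
  case False
  then have "\<not> (\<exists>g' \<gamma>. (g', \<gamma>) \<in> {g} \<times> U \<and> y \<in> prt (sC g') \<and> s g' \<gamma> = rho y)" by blast
  then have "slice_action C F A ({g} \<times> U) y = None" unfolding slice_action_def by (simp only: if_False)
  then show ?thesis using False by simp
qed

text \<open>Images of open sets are open because the action map is open.  Preimages are images under the
  projection of the fibre product to \<open>Y\<close>, which is open because \<open>s\<close> is open.\<close>

lemma partial_homeo_slice_action:
  assumes g: "g \<in> arrC" and U: "U \<in> sl g"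
  shows "partial_homeo Y (slice_action C F A ({g} \<times> U))" (is "partial_homeo Y ?f")
proof -
  note iff = slice_action_iff[OF g U]
  have "y \<in> topspace Y \<and> z \<in> topspace Y" if "?f y = Some z" for y z
    using that part_top act_part[OF g slice_sp[OF g U]] unfolding iff by blast
  then have sub: "dom ?f \<subseteq> topspace Y" "ran ?f \<subseteq> topspace Y"
    by (auto simp: dom_def ran_def)
  have inj: "partial_inj ?f"
    unfolding partial_inj_def iff using act_slice_inj[OF g U] by blast
  have box: "openin (Dom g) {(\<gamma>, y). \<gamma> \<in> U \<and> y \<in> prt (sC g) \<inter> V \<and> s g \<gamma> = rho y}" if "openin Y V" for V
    using slice_open[OF g U] openin_subtopology_Int2[OF that, of "prt (sC g)"]
    by (rule openin_fibre_product_box)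
  have pre: "openin Y {y. \<exists>z\<in>V. ?f y = Some z}" if V: "openin Y V" for V
  proof -
    have V': "openin (subtopology Y (prt (rC g))) (prt (rC g) \<inter> V)" using V by (rule openin_subtopology_Int2)
    define E where "E = {(\<gamma>, y). \<gamma> \<in> U \<and> y \<in> prt (sC g) \<inter> topspace Y \<and> s g \<gamma> = rho y} \<inter>
      {(\<gamma>, y). \<gamma> \<in> topspace (k_space (Co g)) \<and> y \<in> topspace (subtopology Y (prt (sC g))) \<and> s g \<gamma> = rho y \<and>
        (case (\<gamma>, y) of (\<gamma>, y) \<Rightarrow> act g \<gamma> y) \<in> prt (rC g) \<inter> V}"
    have "openin (Dom g) E"
      unfolding E_def
      by (intro openin_Int box openin_topspace openin_fibre_product_preimage[OF act_cont[OF g] V'])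
    moreover have "open_map (Dom g) (subtopology Y (prt (sC g))) snd"
      by (rule open_map_fibre_product_snd[OF correspondence.src_open_map[OF correspondence_Co[OF g]]
            rho_cont[OF src_objC[OF g]]])
    ultimately have "openin (subtopology Y (prt (sC g))) (snd ` E)" unfolding open_map_def by blast
    then have "openin Y (snd ` E)" using part_open[OF src_objC[OF g]] by (rule openin_trans_full)
    moreover have "{y. \<exists>z\<in>V. ?f y = Some z} = snd ` E"
    proof (intro equalityI subsetI)
      fix y assume "y \<in> {y. \<exists>z\<in>V. ?f y = Some z}"
      then obtain \<gamma> where \<gamma>: "\<gamma> \<in> U" "y \<in> prt (sC g)" "s g \<gamma> = rho y" "act g \<gamma> y \<in> V" unfolding iff by blast
      then have "(\<gamma>, y) \<in> E"
        unfolding E_def using part_top slice_sp[OF g U] act_part[OF g] by (simp add: sp_eq)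
      then show "y \<in> snd ` E" by force
    next
      fix y assume "y \<in> snd ` E"
      then obtain \<gamma> where "(\<gamma>, y) \<in> E" by auto
      then have "\<gamma> \<in> U" "y \<in> prt (sC g)" "s g \<gamma> = rho y" "act g \<gamma> y \<in> V" unfolding E_def by auto
      then show "y \<in> {y. \<exists>z\<in>V. ?f y = Some z}" unfolding iff by blast
    qed
    ultimately show ?thesis by simp
  qed
  have im: "openin Y {z. \<exists>y\<in>V. ?f y = Some z}" if V: "openin Y V" for V
  proof -
    have "openin (subtopology Y (prt (rC g))) ((\<lambda>(\<gamma>, y). act g \<gamma> y) `
        {(\<gamma>, y). \<gamma> \<in> U \<and> y \<in> prt (sC g) \<inter> V \<and> s g \<gamma> = rho y})"
      using act_open[OF g] box[OF V] unfolding open_map_def by blast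
    then have "openin Y ((\<lambda>(\<gamma>, y). act g \<gamma> y) `
        {(\<gamma>, y). \<gamma> \<in> U \<and> y \<in> prt (sC g) \<inter> V \<and> s g \<gamma> = rho y})"
      using part_open[OF rng_objC[OF g]] by (rule openin_trans_full)
    moreover have "{z. \<exists>y\<in>V. ?f y = Some z} = (\<lambda>(\<gamma>, y). act g \<gamma> y) `
        {(\<gamma>, y). \<gamma> \<in> U \<and> y \<in> prt (sC g) \<inter> V \<and> s g \<gamma> = rho y}"
      unfolding iff by force
    ultimately show ?thesis by simp
  qed
  show ?thesis unfolding partial_homeo_def using sub inj pre im by blast
qed

lemma partial_homeo_gens: "P \<in> gens \<Longrightarrow> partial_homeo Y (slice_action C F A P)"
  by (erule gens_cases) (simp add: partial_homeo_slice_action)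

lemma slice_action_mult:
  assumes P: "P \<in> gens" and Q: "Q \<in> gens"
  shows "slice_action C F A (diagram_slice_mult C F P Q) =
    slice_action C F A P \<circ>\<^sub>m slice_action C F A Q"
proof -
  obtain g U where P: "P = {g} \<times> U" "g \<in> arrC" "U \<in> sl g" using P by (rule gens_cases)
  obtain h V where Q: "Q = {h} \<times> V" "h \<in> arrC" "V \<in> sl h" using Q by (rule gens_cases)
  note iffs = slice_action_iff[OF P(2,3)] slice_action_iff[OF Q(2,3)]
  note sps = slice_sp[OF P(2,3)] slice_sp[OF Q(2,3)]
  show ?thesis
  proof (cases "sC g = rC h")
    case True
    note gh = P(2) Q(2) True
    note iff = slice_action_iff[OF comp_arr[OF gh] product_slice[OF gh P(3) Q(3)]]
    show ?thesis
      unfolding P(1) Q(1) slice_mult_eq[OF True]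
    proof (rule map_eqI)
      fix y z
      show "slice_action C F A ({cC g h} \<times> slice_prod g h U V) y = Some z \<longleftrightarrow>
          (slice_action C F A ({g} \<times> U) \<circ>\<^sub>m slice_action C F A ({h} \<times> V)) y = Some z" (is "?L \<longleftrightarrow> ?R")
      proof
        assume ?L
        then obtain \<gamma> \<eta> where 1: "\<gamma> \<in> U" "\<eta> \<in> V" "s g \<gamma> = r h \<eta>" "y \<in> prt (sC h)"
          "s (cC g h) (dot g h \<gamma> \<eta>) = rho y" "z = act (cC g h) (dot g h \<gamma> \<eta>) y"
          unfolding iff src_comp[OF gh] by blast
        note sp = sps(1)[OF 1(1)] sps(2)[OF 1(2)]
        have s: "s h \<eta> = rho y" using dot_sp(3)[OF gh sp 1(3)] 1(5) by simp
        have "act h \<eta> y \<in> prt (sC g)" "rho (act h \<eta> y) = r h \<eta>" "z = act g \<gamma> (act h \<eta> y)"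
          using act_part[OF Q(2) sp(2) 1(4) s] rho_act[OF Q(2) sp(2) 1(4) s]
            act_act[OF gh sp 1(4,3) s] True 1(6) by simp_all
        then have "slice_action C F A ({g} \<times> U) (act h \<eta> y) = Some z"
          "slice_action C F A ({h} \<times> V) y = Some (act h \<eta> y)"
          unfolding iffs using 1 s by auto
        then show ?R unfolding map_comp_Some_iff by blast
      next
        assume ?R
        then obtain x where "slice_action C F A ({h} \<times> V) y = Some x" "slice_action C F A ({g} \<times> U) x = Some z"
          unfolding map_comp_Some_iff by blast
        then obtain \<gamma> \<eta> where 1: "\<eta> \<in> V" "y \<in> prt (sC h)" "s h \<eta> = rho y" "x = act h \<eta> y"
          "\<gamma> \<in> U" "s g \<gamma> = rho x" "z = act g \<gamma> x"
          unfolding iffs by blast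
        note sp = sps(1)[OF 1(5)] sps(2)[OF 1(1)]
        have c: "s g \<gamma> = r h \<eta>" using rho_act[OF Q(2) sp(2) 1(2,3)] 1(4,6) by simp
        have "z = act (cC g h) (dot g h \<gamma> \<eta>) y"
          using act_act[OF gh sp 1(2) c 1(3)] 1(4,7) by simp
        moreover have "s (cC g h) (dot g h \<gamma> \<eta>) = rho y" using dot_sp(3)[OF gh sp c] 1(3) by simp
        ultimately show ?L unfolding iff src_comp[OF gh] using 1 c by blast
      qed
    qed
  next
    case False
    have "diagram_slice_mult C F P Q = {}" using False unfolding P(1) Q(1) diagram_slice_mult_def by auto
    then have L: "slice_action C F A (diagram_slice_mult C F P Q) y \<noteq> Some z" for y z
      unfolding slice_action_def by simp
    have R: "(slice_action C F A P \<circ>\<^sub>m slice_action C F A Q) y \<noteq> Some z" for y z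
    proof
      assume "(slice_action C F A P \<circ>\<^sub>m slice_action C F A Q) y = Some z"
      then obtain x where "slice_action C F A ({h} \<times> V) y = Some x" "slice_action C F A ({g} \<times> U) x = Some z"
        unfolding P(1) Q(1) map_comp_Some_iff by blast
      then obtain \<eta> where "\<eta> \<in> V" "y \<in> prt (sC h)" "s h \<eta> = rho y" "x = act h \<eta> y" "x \<in> prt (sC g)"
        unfolding iffs by blast
      then show False using act_part[OF Q(2) sps(2)] part_unique False by blast
    qed
    show ?thesis by (rule map_eqI) (simp add: L R)
  qed
qed

text \<open>By condition (ii), \<open>\<gamma> \<cdot> z = \<gamma>' \<cdot> y\<close> with \<open>\<gamma> \<in> U\<close> and \<open>\<gamma>' \<in> V\<close> holds if and only if
  \<open>\<gamma>' = \<gamma> \<eta>\<close> and \<open>z = \<eta> \<cdot> y\<close> for some \<open>\<eta>\<close>, and then \<open>\<eta>\<close> belongs to the bracket.\<close>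

lemma slice_action_bracket:
  assumes g: "g \<in> arrC" and U: "U \<in> sl g" and V: "V \<in> sl g"
  shows "partial_inverse (slice_action C F A ({g} \<times> U)) \<circ>\<^sub>m slice_action C F A ({g} \<times> V) =
    slice_action C F A ({sC g} \<times> slice_bracket (Gr (sC g)) (Co g) U V)"
proof (rule map_eqI)
  let ?x = "sC g" let ?B = "slice_bracket (Gr ?x) (Co g) U V"
  have x: "?x \<in> objC" "?x \<in> arrC" "sC ?x = ?x" "rC ?x = ?x"
    using src_objC[OF g] obj_arr src_obj rng_obj by auto
  note B = bracket_slice[OF g U V] and B_iff = slice_bracket_iff[OF g U V]
  note iffs = slice_action_iff[OF g U] slice_action_iff[OF g V] slice_action_iff[OF x(2) B, unfolded x(3)]
  have inv: "partial_inverse (slice_action C F A ({g} \<times> U)) a = Some b \<longleftrightarrow>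
      slice_action C F A ({g} \<times> U) b = Some a" for a b
    using partial_homeo_slice_action[OF g U] unfolding partial_homeo_def
    by (intro partial_inverse_Some_iff) blast
  interpret X: correspondence "Gr (rC g)" "Gr ?x" "Co g" by (rule correspondence_Co[OF g])
  fix y z
  show "(partial_inverse (slice_action C F A ({g} \<times> U)) \<circ>\<^sub>m slice_action C F A ({g} \<times> V)) y = Some z \<longleftrightarrow>
      slice_action C F A ({?x} \<times> ?B) y = Some z" (is "?L \<longleftrightarrow> ?R")
  proof
    assume ?L
    then obtain w where "slice_action C F A ({g} \<times> V) y = Some w" "slice_action C F A ({g} \<times> U) z = Some w"
      unfolding map_comp_Some_iff inv by blast
    then obtain \<gamma> \<gamma>' where 1: "\<gamma>' \<in> V" "y \<in> prt ?x" "s g \<gamma>' = rho y" "w = act g \<gamma>' y"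
      "\<gamma> \<in> U" "z \<in> prt ?x" "s g \<gamma> = rho z" "w = act g \<gamma> z"
      unfolding iffs by blast
    have eq: "act g \<gamma> z = act g \<gamma>' y" using 1(4,8) by simp
    obtain \<eta> where \<eta>: "\<eta> \<in> topspace (g_arr (Gr ?x))" "g_rng (Gr ?x) \<eta> = s g \<gamma>"
      "g_src (Gr ?x) \<eta> = rho y" "\<gamma>' = k_ract (Co g) \<gamma> \<eta>" "z = act ?x \<eta> y"
      using act_eqD[OF g slice_sp[OF g U 1(5)] slice_sp[OF g V 1(1)] 1(6,2,7,3) eq] by blast
    have "\<eta> \<in> ?B" unfolding B_iff using \<eta> 1 by auto
    moreover have "s ?x \<eta> = rho y" using Co_obj(2,4)[OF x(1)] \<eta> by simp
    ultimately show ?R unfolding iffs using 1(2) \<eta>(5) by blast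
  next
    assume ?R
    then obtain \<eta> where \<eta>: "\<eta> \<in> ?B" "y \<in> prt ?x" "s ?x \<eta> = rho y" "z = act ?x \<eta> y"
      unfolding iffs by blast
    then obtain \<gamma> where \<gamma>: "\<eta> \<in> X.G.arr" "\<gamma> \<in> U" "s g \<gamma> = g_rng (Gr ?x) \<eta>" "X.ract \<gamma> \<eta> \<in> V"
      unfolding B_iff by blast
    have \<eta>x: "\<eta> \<in> sp ?x" "r ?x \<eta> = s g \<gamma>" "g_src (Gr ?x) \<eta> = rho y"
      using Co_obj[OF x(1)] \<gamma> \<eta>(3) by simp_all
    note \<gamma>sp = slice_sp[OF g U \<gamma>(2)]
    have z: "z \<in> prt ?x" "rho z = s g \<gamma>"
      using act_part[OF x(2) \<eta>x(1)] rho_act[OF x(2) \<eta>x(1)] \<eta> \<eta>x x by simp_all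
    have "act g \<gamma> z = act g (X.ract \<gamma> \<eta>) y"
      using act_act[OF g x(2) _ \<gamma>sp \<eta>x(1)] \<eta> \<eta>x x dot_obj[OF g \<gamma>sp \<gamma>(1,3)] comp_id[OF g] by simp
    moreover have "s g (X.ract \<gamma> \<eta>) = rho y"
      using X.src_ract \<gamma>sp \<gamma> \<eta>x by (simp add: sp_eq)
    ultimately have "slice_action C F A ({g} \<times> V) y = Some (act g \<gamma> z)"
      unfolding iffs using \<gamma>(4) \<eta>(2) by blast
    moreover have "slice_action C F A ({g} \<times> U) z = Some (act g \<gamma> z)"
      unfolding iffs using \<gamma>(2) z(1) z(2)[symmetric] by blast
    ultimately show ?L unfolding map_comp_Some_iff inv by blast
  qed
qed

lemma theta_class:
  assumes "set_isg_term a \<subseteq> gens"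
  shows "theta (isg_class gens rels a) = isg_eval (slice_action C F A) a"
proof -
  have inj: "partial_inj (slice_action C F A P)" if "P \<in> gens" for P
    using partial_homeo_gens[OF that] unfolding partial_homeo_def by blast
  have rel: "isg_eval (slice_action C F A) a = isg_eval (slice_action C F A) b" if ab: "(a, b) \<in> rels" for a b
  proof -
    from ab consider P Q where "a = Gen (diagram_slice_mult C F P Q)" "b = Mul (Gen P) (Gen Q)"
        "P \<in> gens" "Q \<in> gens"
      | g U V where "a = Mul (Star (Gen ({g} \<times> U))) (Gen ({g} \<times> V))"
        "b = Gen ({sC g} \<times> slice_bracket (Gr (sC g)) (Co g) U V)" "g \<in> arrC" "U \<in> sl g" "V \<in> sl g"
      unfolding diagram_isg_relations_def by blast
    then show ?thesis by cases (simp_all add: slice_action_mult slice_action_bracket)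
  qed
  have "(SOME t. t \<in> isg_class gens rels a) \<in> isg_class gens rels a"
    using isg_class_refl[OF assms] by (rule someI)
  then have "isg_eq gens rels a (SOME t. t \<in> isg_class gens rels a)"
    by (simp add: isg_class_def)
  then show ?thesis
    unfolding induced_action_def using isg_eval_eq[of gens "slice_action C F A" rels] inj rel by simp
qed

lemma theta_Theta:
  "g \<in> arrC \<Longrightarrow> U \<in> sl g \<Longrightarrow> theta (Theta g U) = slice_action C F A ({g} \<times> U)"
  unfolding Theta_def using theta_class[of "Gen ({g} \<times> U)"] gensI by simp

lemma theta_Theta_iff:
  assumes "g \<in> arrC" "U \<in> sl g"
  shows "theta (Theta g U) y = Some z \<longleftrightarrow>
    (\<exists>\<gamma>\<in>U. y \<in> prt (sC g) \<and> s g \<gamma> = rho y \<and> z = act g \<gamma> y)"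
  unfolding theta_Theta[OF assms] by (rule slice_action_iff[OF assms])

lemma isg_action_theta: "isg_action IF Y theta"
proof -
  interpret inverse_semigroup IF unfolding IF_eq by (rule inverse_semigroup_presented_isg)
  have cls: "\<exists>a. set_isg_term a \<subseteq> gens \<and> t = isg_class gens rels a" if "t \<in> s_carrier IF" for t
    using that unfolding IF_eq presented_isg_carrier by blast
  have star: "theta (s_star IF t) = partial_inverse (theta t)" if t: "t \<in> s_carrier IF" for t
  proof -
    obtain a where a: "set_isg_term a \<subseteq> gens" "t = isg_class gens rels a" using cls[OF t] by blast
    then show ?thesis
      using presented_isg_star[OF a(1)] theta_class[of "Star a"] theta_class[of a] unfolding IF_eq by simp
  qed
  have mult: "theta (s_mult IF t u) = theta t \<circ>\<^sub>m theta u" if t: "t \<in> s_carrier IF" "u \<in> s_carrier IF" for t u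
  proof -
    obtain a where a: "set_isg_term a \<subseteq> gens" "t = isg_class gens rels a" using cls[OF t(1)] by blast
    obtain b where b: "set_isg_term b \<subseteq> gens" "u = isg_class gens rels b" using cls[OF t(2)] by blast
    show ?thesis
      using a b presented_isg_mult[OF a(1) b(1)] theta_class[of "Mul a b"] theta_class[of a] theta_class[of b]
      unfolding IF_eq by simp
  qed
  have homeo: "partial_homeo Y (theta t)" if "t \<in> s_carrier IF" for t
    using that
    by (induction rule: IF_induct)
      (simp_all add: theta_Theta partial_homeo_slice_action mult star partial_homeo_comp partial_homeo_inverse)
  have cover: "\<exists>t\<in>s_carrier IF. y \<in> dom (theta t)" if y: "y \<in> topspace Y" for y
  proof -
    obtain x where x: "x \<in> objC" "y \<in> prt x" using part_exists[OF y] by blast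
    interpret E: etale "Gr x" by (rule etale_Gr[OF x(1)])
    let ?u = "g_unit (Gr x) (rho y)"
    have o: "rho y \<in> E.obj" using rho_obj[OF x] .
    have u: "?u \<in> sp x" "s x ?u = rho y"
      using E.unit_arr[OF o] E.src_unit[OF o] Co_obj[OF x(1)] by simp_all
    obtain U where U: "U \<in> sl x" "?u \<in> U" using slice_exists_sp[OF obj_arr[OF x(1)] u(1)] by blast
    have "theta (Theta x U) y = Some (act x ?u y)"
      unfolding theta_Theta_iff[OF obj_arr[OF x(1)] U(1)] src_obj[OF x(1)] using U(2) x(2) u(2) by blast
    then show ?thesis using Theta_carrier[OF obj_arr[OF x(1)] U(1)] by blast
  qed
  show ?thesis
    by unfold_locales (fact homeo mult star cover)+
qed

sublocale isg_action IF Y theta by (rule isg_action_theta)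

end

section \<open>Equivariant maps and pullbacks of diagram actions\<close>

context diagram
begin

text \<open>The domains of \<open>\<Theta>(U)\<close> are full preimages because \<open>\<phi>\<close> respects the partitions and the maps to
  the object spaces.  For this to carry over to \<open>t\<^sup>\<star>\<close>, the induction must include the same claim about
  ranges.  Let \<open>\<phi>(z) = \<gamma> \<cdot> v\<close> with \<open>\<gamma> \<in> U\<close>.  Then \<open>z = \<gamma>' \<cdot> y\<close> for some \<open>\<gamma>'\<close> by surjectivity,
  condition (ii) in the target gives \<open>\<gamma> = \<gamma>' \<eta>\<close>, and so \<open>z = \<gamma> \<cdot> (\<eta>\<^sup>-\<^sup>1 \<cdot> y)\<close> belongs to the range
  of \<open>\<Theta>(U)\<close>.\<close>

lemma F_equivariant_action_over:
  assumes A: "F_action C F Y A" and B: "F_action C F Z B"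
    and cont: "continuous_map Y Z \<phi>" and equi: "F_equivariant C F Y A B \<phi>"
  shows "action_over IF Z (induced_action C F B) Y \<phi> (induced_action C F A)"
proof -
  interpret A: diagram_action C F Y A by unfold_locales (rule A)
  interpret B: diagram_action C F Z B by unfold_locales (rule B)
  have top: "\<phi> y \<in> topspace Z" if "y \<in> topspace Y" for y
    using continuous_map_funspace[OF cont] that by blast
  have rho: "B.rho (\<phi> y) = A.rho y" if "y \<in> topspace Y" for y
    using equi that unfolding F_equivariant_def by blast
  have part: "y \<in> A.prt x \<longleftrightarrow> \<phi> y \<in> B.prt x" if y: "y \<in> topspace Y" for x y
  proof -
    have "\<phi> y \<in> B.prt x" if "y \<in> A.prt x" for x
      using equi that A.part_outside[of x] unfolding F_equivariant_def by (cases "x \<in> objC") auto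
    then show ?thesis using A.part_exists[OF y] B.part_unique by blast
  qed
  have act: "\<phi> (A.act g \<gamma> y) = B.act g \<gamma> (\<phi> y)"
    if "g \<in> arrC" "\<gamma> \<in> sp g" "y \<in> A.prt (sC g)" "s g \<gamma> = A.rho y" for g \<gamma> y
    using equi that unfolding F_equivariant_def by blast
  define I where "I t \<longleftrightarrow>
    (\<forall>y\<in>topspace Y. \<forall>w. B.theta t (\<phi> y) = Some w \<longrightarrow> (\<exists>z. A.theta t y = Some z)) \<and>
    (\<forall>z\<in>topspace Y. \<forall>v. B.theta t v = Some (\<phi> z) \<longrightarrow> (\<exists>y. A.theta t y = Some z)) \<and>
    (\<forall>y z. A.theta t y = Some z \<longrightarrow> B.theta t (\<phi> y) = Some (\<phi> z))" for t
  have tops: "y \<in> topspace Y \<and> z \<in> topspace Y" if "t \<in> s_carrier IF" "A.theta t y = Some z" for t y z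
    using A.dom_top[OF that(1), of y] A.im_top[OF that(1), of y] that(2) by auto
  have "I t" if "t \<in> s_carrier IF" for t
    using that
  proof (induction rule: IF_induct)
    case (Theta g U)
    note iffs = A.theta_Theta_iff[OF Theta] B.theta_Theta_iff[OF Theta]
    note sp = slice_sp[OF Theta]
    show ?case
      unfolding I_def iffs
    proof (intro conjI ballI allI impI)
      fix y w assume y: "y \<in> topspace Y"
        and "\<exists>\<gamma>\<in>U. \<phi> y \<in> B.prt (sC g) \<and> s g \<gamma> = B.rho (\<phi> y) \<and> w = B.act g \<gamma> (\<phi> y)"
      then obtain \<gamma> where "\<gamma> \<in> U" "\<phi> y \<in> B.prt (sC g)" "s g \<gamma> = B.rho (\<phi> y)" by blast
      then show "\<exists>z. \<exists>\<gamma>\<in>U. y \<in> A.prt (sC g) \<and> s g \<gamma> = A.rho y \<and> z = A.act g \<gamma> y"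
        using part[OF y] rho[OF y] by auto
    next
      fix z v assume z: "z \<in> topspace Y"
        and "\<exists>\<gamma>\<in>U. v \<in> B.prt (sC g) \<and> s g \<gamma> = B.rho v \<and> \<phi> z = B.act g \<gamma> v"
      then obtain \<gamma> where \<gamma>: "\<gamma> \<in> U" "v \<in> B.prt (sC g)" "s g \<gamma> = B.rho v" "\<phi> z = B.act g \<gamma> v"
        by blast
      have "\<phi> z \<in> B.prt (rC g)" using B.act_part[OF Theta(1) sp \<gamma>(2,3)] \<gamma> by simp
      then have "z \<in> A.prt (rC g)" using part[OF z] by blast
      then obtain \<gamma>' y where y: "\<gamma>' \<in> sp g" "y \<in> A.prt (sC g)" "s g \<gamma>' = A.rho y" "z = A.act g \<gamma>' y"
        using A.act_surjD[OF Theta(1)] by blast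
      have yt: "y \<in> topspace Y" using y(2) by (rule A.part_top)
      note y' = part[OF yt, THEN iffD1, OF y(2)]
      have "B.act g \<gamma>' (\<phi> y) = B.act g \<gamma> v" using act[OF Theta(1) y(1-3)] y(4) \<gamma>(4) by simp
      then obtain \<eta> where \<eta>: "\<eta> \<in> topspace (g_arr (Gr (sC g)))" "g_rng (Gr (sC g)) \<eta> = s g \<gamma>'"
        "g_src (Gr (sC g)) \<eta> = B.rho v" "\<gamma> = k_ract (Co g) \<gamma>' \<eta>" "\<phi> y = B.act (sC g) \<eta> v"
        using B.act_eqD[OF Theta(1) y(1) sp[OF \<gamma>(1)] y' \<gamma>(2)] y(3) rho[OF yt] \<gamma>(3) by auto
      let ?x = "sC g" and ?i = "g_inv (Gr (sC g)) \<eta>"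
      have x: "?x \<in> objC" "?x \<in> arrC" "sC ?x = ?x" "rC ?x = ?x"
        using src_objC[OF Theta(1)] obj_arr src_obj rng_obj by auto
      interpret X: correspondence "Gr (rC g)" "Gr ?x" "Co g" by (rule correspondence_Co[OF Theta(1)])
      \<comment> \<open>\<open>z = \<gamma>' \<cdot> y = (\<gamma>' \<eta>) \<cdot> (\<eta>\<^sup>-\<^sup>1 \<cdot> y)\<close>, where \<open>\<gamma>' \<eta> = \<gamma>\<close> belongs to the slice.\<close>
      have i: "?i \<in> sp ?x" "s ?x ?i = A.rho y" "r ?x ?i = g_src (Gr ?x) \<eta>" "?i \<in> X.G.arr"
        using X.G.inv_arr[OF \<eta>(1)] X.G.src_inv[OF \<eta>(1)] X.G.rng_inv[OF \<eta>(1)] Co_obj[OF x(1)] \<eta>(2) y(3)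
        by simp_all
      define y1 where "y1 = A.act ?x ?i y"
      have y1: "y1 \<in> A.prt ?x" "A.rho y1 = g_src (Gr ?x) \<eta>"
        unfolding y1_def using A.act_part[OF x(2) i(1)] A.rho_act[OF x(2) i(1)] y(2) i x by simp_all
      have \<gamma>s: "s g \<gamma> = g_src (Gr ?x) \<eta>" using \<gamma>(3) \<eta>(3) by simp
      have "A.act g \<gamma> y1 = A.act (cC g ?x) (dot g ?x \<gamma> ?i) y"
        unfolding y1_def using A.act_act[OF Theta(1) x(2) _ sp[OF \<gamma>(1)] i(1)] y(2) i x \<gamma>s by simp
      also have "\<dots> = A.act g (X.ract \<gamma> ?i) y"
        using dot_obj[OF Theta(1) sp[OF \<gamma>(1)] i(4)] \<gamma>s X.G.rng_inv[OF \<eta>(1)] comp_id[OF Theta(1)] by simp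
      also have "X.ract \<gamma> ?i = X.ract \<gamma>' (g_mult (Gr ?x) \<eta> ?i)"
        unfolding \<eta>(4) using X.ract_ract[of \<gamma>' \<eta> ?i] y(1) \<eta>(1,2) i(4) X.G.rng_inv[OF \<eta>(1)]
        by (simp add: sp_eq)
      also have "\<dots> = \<gamma>'"
        using X.G.mult_inv[OF \<eta>(1)] X.ract_unit_at y(1) \<eta>(2) by (simp add: sp_eq)
      finally have "z = A.act g \<gamma> y1" using y(4) by simp
      then show "\<exists>y. \<exists>\<gamma>\<in>U. y \<in> A.prt (sC g) \<and> s g \<gamma> = A.rho y \<and> z = A.act g \<gamma> y"
        using \<gamma>(1) y1(1) y1(2)[symmetric] \<gamma>s by metis
    next
      fix y z assume "\<exists>\<gamma>\<in>U. y \<in> A.prt (sC g) \<and> s g \<gamma> = A.rho y \<and> z = A.act g \<gamma> y"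
      then obtain \<gamma> where \<gamma>: "\<gamma> \<in> U" "y \<in> A.prt (sC g)" "s g \<gamma> = A.rho y" "z = A.act g \<gamma> y" by blast
      have y: "y \<in> topspace Y" using \<gamma>(2) by (rule A.part_top)
      have "\<phi> z = B.act g \<gamma> (\<phi> y)" using act[OF Theta(1) sp[OF \<gamma>(1)] \<gamma>(2,3)] \<gamma>(4) by simp
      then show "\<exists>\<gamma>\<in>U. \<phi> y \<in> B.prt (sC g) \<and> s g \<gamma> = B.rho (\<phi> y) \<and> \<phi> z = B.act g \<gamma> (\<phi> y)"
        using \<gamma> part[OF y] rho[OF y] by auto
    qed
  next
    case (mult t u)
    note tu = mult(1,2)
    have t: "\<And>y w. y \<in> topspace Y \<Longrightarrow> B.theta t (\<phi> y) = Some w \<Longrightarrow> \<exists>z. A.theta t y = Some z"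
      "\<And>z v. z \<in> topspace Y \<Longrightarrow> B.theta t v = Some (\<phi> z) \<Longrightarrow> \<exists>y. A.theta t y = Some z"
      "\<And>y z. A.theta t y = Some z \<Longrightarrow> B.theta t (\<phi> y) = Some (\<phi> z)"
      using mult(3) unfolding I_def by blast+
    have u: "\<And>y w. y \<in> topspace Y \<Longrightarrow> B.theta u (\<phi> y) = Some w \<Longrightarrow> \<exists>z. A.theta u y = Some z"
      "\<And>z v. z \<in> topspace Y \<Longrightarrow> B.theta u v = Some (\<phi> z) \<Longrightarrow> \<exists>y. A.theta u y = Some z"
      "\<And>y z. A.theta u y = Some z \<Longrightarrow> B.theta u (\<phi> y) = Some (\<phi> z)"
      using mult(4) unfolding I_def by blast+
    show ?case
      unfolding I_def A.act_mult_iff[OF tu] B.act_mult_iff[OF tu]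
    proof (intro conjI ballI allI impI)
      fix y w assume y: "y \<in> topspace Y" and "\<exists>x. B.theta u (\<phi> y) = Some x \<and> B.theta t x = Some w"
      then obtain x where x: "B.theta u (\<phi> y) = Some x" "B.theta t x = Some w" by blast
      obtain x' where x': "A.theta u y = Some x'" using u(1)[OF y x(1)] by blast
      have "x = \<phi> x'" using u(3)[OF x'] x(1) by simp
      then show "\<exists>z x. A.theta u y = Some x \<and> A.theta t x = Some z"
        using t(1)[of x' w] tops[OF tu(2) x'] x(2) x' by blast
    next
      fix z v assume z: "z \<in> topspace Y" and "\<exists>x. B.theta u v = Some x \<and> B.theta t x = Some (\<phi> z)"
      then obtain x where x: "B.theta u v = Some x" "B.theta t x = Some (\<phi> z)" by blast
      obtain x' where x': "A.theta t x' = Some z" using t(2)[OF z x(2)] by blast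
      have "x = \<phi> x'" using B.act_inj[OF tu(1) x(2) t(3)[OF x']] .
      then show "\<exists>y x. A.theta u y = Some x \<and> A.theta t x = Some z"
        using u(2)[of x' v] tops[OF tu(1) x'] x(1) x' by blast
    next
      fix y z assume "\<exists>x. A.theta u y = Some x \<and> A.theta t x = Some z"
      then show "\<exists>x. B.theta u (\<phi> y) = Some x \<and> B.theta t x = Some (\<phi> z)"
        using u(3) t(3) by blast
    qed
  next
    case (star t)
    then show ?case
      unfolding I_def A.act_star_iff[OF star(1)] B.act_star_iff[OF star(1)] by blast
  qed
  then have I: "(\<forall>y\<in>topspace Y. \<forall>w. B.theta t (\<phi> y) = Some w \<longrightarrow> (\<exists>z. A.theta t y = Some z))"
    "(\<forall>y z. A.theta t y = Some z \<longrightarrow> B.theta t (\<phi> y) = Some (\<phi> z))" if "t \<in> s_carrier IF" for t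
    using that unfolding I_def by blast+
  have "y \<in> dom (A.theta t) \<longleftrightarrow> y \<in> topspace Y \<and> \<phi> y \<in> dom (B.theta t)" if t: "t \<in> s_carrier IF" for t y
    using I[OF t] tops[OF t] unfolding dom_def by blast
  then show ?thesis
    unfolding action_over_def
    using cont A.homeo A.act_star A.act_mult I(2) by blast
qed

text \<open>The \<open>F\<close>-action on \<open>Y\<close> that belongs to an action \<open>\<tau>\<close> of \<open>\<I>(F)\<close> over \<open>\<rho>\<close>; the chosen slice
  does not matter by \<open>tau_actB\<close> below.\<close>

definition pullback ::
  "('c, 'o, 'a, 'w) faction \<Rightarrow> 'y topology \<Rightarrow> ('y \<Rightarrow> 'w)
     \<Rightarrow> (('c \<times> 'a) set isg_term set \<Rightarrow> 'y \<rightharpoonup> 'y) \<Rightarrow> ('c, 'o, 'a, 'y) faction" where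
  "pullback W Y \<rho> \<tau> =
     \<lparr>f_part = (\<lambda>x. {y \<in> topspace Y. \<rho> y \<in> f_part W x}),
      f_rng = restrict (\<lambda>y. f_rng W (\<rho> y)) (topspace Y),
      f_act = (\<lambda>g \<gamma> y.
        if g \<in> arrC \<and> \<gamma> \<in> sp g \<and> y \<in> topspace Y \<and> \<rho> y \<in> f_part W (sC g) \<and> s g \<gamma> = f_rng W (\<rho> y)
        then the (\<tau> (Theta g (SOME U. U \<in> sl g \<and> \<gamma> \<in> U)) y) else undefined)\<rparr>"

lemma pullback_cong:
  assumes "\<And>t. t \<in> s_carrier IF \<Longrightarrow> \<tau> t = \<tau>' t"
  shows "pullback W Y \<rho> \<tau> = pullback W Y \<rho> \<tau>'"
proof -
  have "\<tau> (Theta g (SOME U. U \<in> sl g \<and> \<gamma> \<in> U)) = \<tau>' (Theta g (SOME U. U \<in> sl g \<and> \<gamma> \<in> U))"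
    if "g \<in> arrC" "\<gamma> \<in> sp g" for g \<gamma>
  proof -
    have "\<exists>U. U \<in> sl g \<and> \<gamma> \<in> U" using slice_exists_sp[OF that] by blast
    then have "(SOME U. U \<in> sl g \<and> \<gamma> \<in> U) \<in> sl g" by (rule someI2_ex) blast
    then show ?thesis using assms[OF Theta_carrier[OF that(1)]] by blast
  qed
  then have "(if g \<in> arrC \<and> \<gamma> \<in> sp g \<and> y \<in> topspace Y \<and> \<rho> y \<in> f_part W (sC g) \<and> s g \<gamma> = f_rng W (\<rho> y)
        then the (\<tau> (Theta g (SOME U. U \<in> sl g \<and> \<gamma> \<in> U)) y) else undefined) =
      (if g \<in> arrC \<and> \<gamma> \<in> sp g \<and> y \<in> topspace Y \<and> \<rho> y \<in> f_part W (sC g) \<and> s g \<gamma> = f_rng W (\<rho> y)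
        then the (\<tau>' (Theta g (SOME U. U \<in> sl g \<and> \<gamma> \<in> U)) y) else undefined)" for g \<gamma> y
    by simp
  then show ?thesis unfolding pullback_def by (simp only:)
qed

end

locale diagram_action_over = diagram_action C F \<Omega> W
  for C :: "'c category" and F :: "('c, 'o, 'a) diagram"
    and \<Omega> :: "'w topology" and W :: "('c, 'o, 'a, 'w) faction" +
  fixes Y :: "'y topology" and \<rho> :: "'y \<Rightarrow> 'w"
    and \<tau> :: "('c \<times> 'a) set isg_term set \<Rightarrow> 'y \<rightharpoonup> 'y"
  assumes over: "action_over IF \<Omega> (induced_action C F W) Y \<rho> \<tau>"
begin

sublocale tau: isg_action IF Y \<tau>
  by (rule isg_action_over[OF over])

abbreviation "B \<equiv> pullback W Y \<rho> \<tau>"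
abbreviation "prtB \<equiv> f_part B"
abbreviation "rhoB \<equiv> f_rng B"
abbreviation "actB \<equiv> f_act B"

lemma anchor_cont: "continuous_map Y \<Omega> \<rho>"
  and tau_dom: "t \<in> carr \<Longrightarrow>
    y \<in> dom (\<tau> t) \<longleftrightarrow> y \<in> topspace Y \<and> \<rho> y \<in> dom (theta t)"
  and tau_val: "t \<in> carr \<Longrightarrow> \<tau> t y = Some z \<Longrightarrow>
    theta t (\<rho> y) = Some (\<rho> z)"
  using over unfolding action_over_def by blast+

lemma part_iff: "y \<in> prtB x \<longleftrightarrow> y \<in> topspace Y \<and> \<rho> y \<in> prt x"
  by (simp add: pullback_def)

lemma rhoB_eq: "y \<in> topspace Y \<Longrightarrow> rhoB y = rho (\<rho> y)"
  by (simp add: pullback_def)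

text \<open>The bracket \<open>\<langle>U' | U'\<rangle>\<close> consists of the units at the points of \<open>s(U')\<close>.  So the product keeps the
  points of \<open>U\<close> with source in \<open>s(U')\<close>, and these lie in \<open>U'\<close> because \<open>s\<close> is injective on \<open>U\<close>.\<close>

lemma slice_restrict:
  assumes g: "g \<in> arrC" and U: "U \<in> sl g" and U': "U' \<in> sl g" and sub: "U' \<subseteq> U"
  shows "slice_prod g (sC g) U (slice_bracket (Gr (sC g)) (Co g) U' U') = U'"
proof (intro equalityI subsetI)
  let ?x = "sC g"
  have x: "?x \<in> objC" by (rule src_objC[OF g])
  interpret X: correspondence "Gr (rC g)" "Gr ?x" "Co g" by (rule correspondence_Co[OF g])
  note E_iff = slice_bracket_iff[OF g U' U']
  {
    fix a assume "a \<in> slice_prod g ?x U (slice_bracket (Gr ?x) (Co g) U' U')"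
    then obtain \<gamma> \<eta> \<gamma>1 where 1: "a = dot g ?x \<gamma> \<eta>" "\<gamma> \<in> U" "s g \<gamma> = r ?x \<eta>" "\<eta> \<in> X.G.arr"
      "\<gamma>1 \<in> U'" "s g \<gamma>1 = g_rng (Gr ?x) \<eta>" "X.ract \<gamma>1 \<eta> \<in> U'"
      unfolding E_iff by blast
    have r\<eta>: "r ?x \<eta> = g_rng (Gr ?x) \<eta>" using Co_obj[OF x] 1(4) by simp
    have "\<gamma> = \<gamma>1" using slice_src_inj[OF g U 1(2), of \<gamma>1] sub 1(3,5,6) r\<eta> by auto
    moreover have "X.ract \<gamma>1 \<eta> = \<gamma>1" using slice_eqI[OF g U' 1(5,7,4,6) HOL.refl] by blast
    moreover have "a = X.ract \<gamma> \<eta>"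
      using 1(1) dot_obj[OF g slice_sp[OF g U 1(2)] 1(4)] 1(3) r\<eta> by simp
    ultimately show "a \<in> U'" using 1(5) by simp
  }
  fix a assume a: "a \<in> U'"
  have sp: "a \<in> sp g" "a \<in> X.sp" using slice_sp[OF g U' a] by (simp_all add: sp_eq)
  let ?u = "g_unit (Gr ?x) (s g a)"
  have o: "s g a \<in> X.G.obj" using X.src_obj[OF sp(2)] .
  have u: "?u \<in> X.G.arr" "g_rng (Gr ?x) ?u = s g a" using X.G.unit_arr[OF o] X.G.rng_unit[OF o] .
  have "?u \<in> slice_bracket (Gr ?x) (Co g) U' U'"
    unfolding E_iff using u a X.ract_unit[OF sp(2)] by auto
  moreover have "dot g ?x a ?u = a"
    using dot_obj[OF g sp(1) u(1)] u(2) X.ract_unit[OF sp(2)] by simp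
  moreover have "s g a = r ?x ?u" using Co_obj[OF x] u by simp
  ultimately show "a \<in> slice_prod g ?x U (slice_bracket (Gr ?x) (Co g) U' U')"
    using a sub by force
qed

text \<open>By the preceding lemma, \<open>\<Theta>(U') = \<Theta>(U) \<Theta>(U')\<^sup>\<star> \<Theta>(U')\<close>, and the two factors on the right fix
  the points in the domain of \<open>\<Theta>(U')\<close>.\<close>

lemma tau_restrict:
  assumes g: "g \<in> arrC" and U: "U \<in> sl g" and U': "U' \<in> sl g" and sub: "U' \<subseteq> U"
    and y: "\<tau> (Theta g U') y = Some z"
  shows "\<tau> (Theta g U) y = Some z"
proof -
  let ?t = "Theta g U" and ?t' = "Theta g U'"
  have t: "?t \<in> carr" "?t' \<in> carr" using Theta_carrier[OF g] U U' by auto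
  have x: "sC g \<in> objC" by (rule src_objC[OF g])
  have "s_mult IF ?t (s_mult IF (s_star IF ?t') ?t') = ?t'"
    using Theta_bracket[OF g U' U'] Theta_mult[OF g obj_arr[OF x] _ U bracket_slice[OF g U' U']]
      slice_restrict[OF g U U' sub] rng_obj[OF x] comp_id[OF g] by simp
  then have "\<tau> (s_mult IF ?t (s_mult IF (s_star IF ?t') ?t')) y = Some z" using y by simp
  then obtain v w where "\<tau> ?t' y = Some v" "\<tau> (s_star IF ?t') v = Some w" "\<tau> ?t w = Some z"
    using t by (auto simp: tau.act_mult_iff mult_closed star_closed)
  moreover from this have "w = y"
    using tau.act_inj[OF t(2)] tau.act_star_iff[OF t(2)] by blast
  ultimately show ?thesis by simp
qed

text \<open>Two slices containing \<open>\<gamma>\<close> act alike on \<open>y\<close>, since both extend the action of their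
  intersection, which is defined at \<open>y\<close> by the condition on the domains.\<close>

lemma tau_actB:
  assumes g: "g \<in> arrC" and U: "U \<in> sl g" and \<gamma>: "\<gamma> \<in> U" and y: "y \<in> prtB (sC g)" "s g \<gamma> = rhoB y"
  shows "\<tau> (Theta g U) y = Some (actB g \<gamma> y)"
proof -
  have y1: "y \<in> topspace Y" "\<rho> y \<in> prt (sC g)" "s g \<gamma> = rho (\<rho> y)"
    using y part_iff rhoB_eq by auto
  define U0 where "U0 = (SOME U. U \<in> sl g \<and> \<gamma> \<in> U)"
  have "U0 \<in> sl g \<and> \<gamma> \<in> U0" unfolding U0_def by (rule someI[of _ U]) (use U \<gamma> in blast)
  then have U0: "U0 \<in> sl g" "\<gamma> \<in> U0" by auto
  have U1: "U0 \<inter> U \<in> sl g"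
    using correspondence.slice_subset[OF correspondence_Co[OF g] U, of "U0 \<inter> U"]
      slice_open[OF g U] slice_open[OF g U0(1)] by blast
  have "theta (Theta g (U0 \<inter> U)) (\<rho> y) = Some (act g \<gamma> (\<rho> y))"
    unfolding theta_Theta_iff[OF g U1] using U0 \<gamma> y1 by blast
  then obtain z where z: "\<tau> (Theta g (U0 \<inter> U)) y = Some z"
    using tau_dom[OF Theta_carrier[OF g U1], of y] y1(1) by blast
  have "\<tau> (Theta g U0) y = Some z" by (rule tau_restrict[OF g U0(1) U1 _ z]) blast
  moreover have "actB g \<gamma> y = the (\<tau> (Theta g U0) y)"
    using g slice_sp[OF g U \<gamma>] y1 unfolding U0_def by (simp add: pullback_def)
  moreover have "\<tau> (Theta g U) y = Some z" by (rule tau_restrict[OF g U U1 _ z]) blast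
  ultimately show ?thesis by simp
qed

lemma tau_Theta_iff:
  assumes g: "g \<in> arrC" and U: "U \<in> sl g"
  shows "\<tau> (Theta g U) y = Some z \<longleftrightarrow>
    (\<exists>\<gamma>\<in>U. y \<in> prtB (sC g) \<and> s g \<gamma> = rhoB y \<and> z = actB g \<gamma> y)"
proof
  note t = Theta_carrier[OF g U]
  assume z: "\<tau> (Theta g U) y = Some z"
  then have y: "y \<in> topspace Y" using tau.dom_top[OF t] by blast
  obtain \<gamma> where \<gamma>: "\<gamma> \<in> U" "\<rho> y \<in> prt (sC g)" "s g \<gamma> = rho (\<rho> y)"
    using tau_val[OF t z] unfolding theta_Theta_iff[OF g U] by blast
  then have p: "y \<in> prtB (sC g)" "s g \<gamma> = rhoB y" using y part_iff rhoB_eq by auto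
  then have "z = actB g \<gamma> y" using tau_actB[OF g U \<gamma>(1)] z by simp
  then show "\<exists>\<gamma>\<in>U. y \<in> prtB (sC g) \<and> s g \<gamma> = rhoB y \<and> z = actB g \<gamma> y" using \<gamma>(1) p by blast
next
  assume "\<exists>\<gamma>\<in>U. y \<in> prtB (sC g) \<and> s g \<gamma> = rhoB y \<and> z = actB g \<gamma> y"
  then show "\<tau> (Theta g U) y = Some z" using tau_actB[OF g U] by blast
qed

lemma anchor_actB:
  assumes g: "g \<in> arrC" and \<gamma>: "\<gamma> \<in> sp g" and y: "y \<in> prtB (sC g)" "s g \<gamma> = rhoB y"
  shows "actB g \<gamma> y \<in> topspace Y" "\<rho> (actB g \<gamma> y) = act g \<gamma> (\<rho> y)"
proof -
  obtain U where U: "U \<in> sl g" "\<gamma> \<in> U" using slice_exists_sp[OF g \<gamma>] by blast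
  note t = Theta_carrier[OF g U(1)]
  note \<tau> = tau_actB[OF g U y]
  have y1: "\<rho> y \<in> prt (sC g)" "s g \<gamma> = rho (\<rho> y)" using y part_iff rhoB_eq by auto
  show "actB g \<gamma> y \<in> topspace Y" using tau.im_top[OF t, of y] \<tau> by auto
  have "theta (Theta g U) (\<rho> y) = Some (act g \<gamma> (\<rho> y))"
    unfolding theta_Theta_iff[OF g U(1)] using U(2) y1 by blast
  then show "\<rho> (actB g \<gamma> y) = act g \<gamma> (\<rho> y)" using tau_val[OF t \<tau>] by simp
qed

lemma actB_part:
  assumes g: "g \<in> arrC" and \<gamma>: "\<gamma> \<in> sp g" and y: "y \<in> prtB (sC g)" "s g \<gamma> = rhoB y"
  shows "actB g \<gamma> y \<in> prtB (rC g)" "rhoB (actB g \<gamma> y) = r g \<gamma>"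
proof -
  note a = anchor_actB[OF assms]
  have y1: "\<rho> y \<in> prt (sC g)" "s g \<gamma> = rho (\<rho> y)" using y part_iff rhoB_eq by auto
  show "actB g \<gamma> y \<in> prtB (rC g)" unfolding part_iff using a act_part[OF g \<gamma> y1] by simp
  show "rhoB (actB g \<gamma> y) = r g \<gamma>" using rhoB_eq[OF a(1)] a(2) rho_act[OF g \<gamma> y1] by simp
qed

lemma openin_prtB: assumes "x \<in> objC" shows "openin Y (prtB x)"
proof -
  have "prtB x = {y \<in> topspace Y. \<rho> y \<in> prt x}" using part_iff by blast
  then show ?thesis using openin_continuous_map_preimage[OF anchor_cont part_open[OF assms]] by simp
qed

lemma closedin_prtB: assumes "x \<in> objC" shows "closedin Y (prtB x)"
proof -
  have "prtB x = {y \<in> topspace Y. \<rho> y \<in> prt x}" using part_iff by blast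
  then show ?thesis using closedin_continuous_map_preimage[OF anchor_cont part_closed[OF assms]] by simp
qed

lemma topspace_prtB: "topspace (subtopology Y (prtB x)) = prtB x"
  using part_iff by auto

lemma rhoB_cont: assumes x: "x \<in> objC" shows "continuous_map (subtopology Y (prtB x)) (g_obj (Gr x)) rhoB"
proof -
  have "continuous_map (subtopology Y (prtB x)) (subtopology \<Omega> (prt x)) \<rho>"
    unfolding continuous_map_in_subtopology
    using continuous_map_from_subtopology[OF anchor_cont] part_iff by auto
  then have "continuous_map (subtopology Y (prtB x)) (g_obj (Gr x)) (rho \<circ> \<rho>)"
    using rho_cont[OF x] by (rule continuous_map_compose)
  then show ?thesis
    by (rule continuous_map_eq) (use rhoB_eq part_iff topspace_prtB in auto)
qed

abbreviation "DomB g \<equiv> fibre_product (k_space (Co g)) (subtopology Y (prtB (sC g))) (s g) rhoB"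

lemma actB_cont:
  assumes g: "g \<in> arrC"
  shows "continuous_map (DomB g) (subtopology Y (prtB (rC g))) (\<lambda>(\<gamma>, y). actB g \<gamma> y)"
proof (rule continuous_map_fibre_productI)
  fix \<gamma> y assume "\<gamma> \<in> topspace (k_space (Co g))" "y \<in> topspace (subtopology Y (prtB (sC g)))"
    and c: "s g \<gamma> = rhoB y"
  then have \<gamma>: "\<gamma> \<in> sp g" "y \<in> prtB (sC g)" unfolding topspace_prtB sp_eq by auto
  show "actB g \<gamma> y \<in> topspace (subtopology Y (prtB (rC g)))"
    unfolding topspace_prtB by (rule actB_part(1)[OF g \<gamma> c])
  fix V assume "openin (subtopology Y (prtB (rC g))) V" and av: "actB g \<gamma> y \<in> V"
  then have V: "openin Y V" using openin_prtB[OF rng_objC[OF g]] openin_trans_full by blast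
  obtain U where U: "U \<in> sl g" "\<gamma> \<in> U" using slice_exists_sp[OF g \<gamma>(1)] by blast
  note t = Theta_carrier[OF g U(1)]
  define N where "N = prtB (sC g) \<inter> {y \<in> dom (\<tau> (Theta g U)). tau.im (Theta g U) y \<in> V}"
  have N: "openin (subtopology Y (prtB (sC g))) N"
    unfolding N_def by (rule openin_subtopology_Int2[OF tau.open_preim[OF t V]])
  have yN: "y \<in> N" unfolding N_def using \<gamma>(2) tau_actB[OF g U \<gamma>(2) c] av by auto
  have "actB g \<gamma>' y' \<in> V" if "\<gamma>' \<in> U" "y' \<in> N" "s g \<gamma>' = rhoB y'" for \<gamma>' y'
    using tau_actB[OF g U(1) that(1) _ that(3)] that(2) unfolding N_def by simp
  then show "\<exists>U V'. openin (k_space (Co g)) U \<and> openin (subtopology Y (prtB (sC g))) V' \<and> \<gamma> \<in> U \<and> y \<in> V' \<and>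
      (\<forall>\<gamma>'\<in>U. \<forall>y'\<in>V'. s g \<gamma>' = rhoB y' \<longrightarrow> actB g \<gamma>' y' \<in> V)"
    using slice_open[OF g U(1)] U(2) N yN by blast
qed

text \<open>Near \<open>(\<gamma>, y)\<close>, the action map is the projection to \<open>Y\<close> followed by the partial homeomorphism
  of a slice containing \<open>\<gamma>\<close>.\<close>

lemma actB_open:
  assumes g: "g \<in> arrC"
  shows "open_map (DomB g) (subtopology Y (prtB (rC g))) (\<lambda>(\<gamma>, y). actB g \<gamma> y)"
  unfolding open_map_def
proof (intro allI impI)
  fix S assume S: "openin (DomB g) S"
  let ?m = "\<lambda>(\<gamma>, y). actB g \<gamma> y"
  have Ssub: "S \<subseteq> topspace (DomB g)" using S by (rule openin_subset)
  have mem: "\<gamma> \<in> sp g \<and> y \<in> prtB (sC g) \<and> s g \<gamma> = rhoB y" if "(\<gamma>, y) \<in> S" for \<gamma> y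
    using that Ssub topspace_prtB by (auto simp: sp_eq)
  have sub: "?m ` S \<subseteq> prtB (rC g)"
  proof
    fix z assume "z \<in> ?m ` S"
    then obtain \<gamma> y where \<gamma>: "(\<gamma>, y) \<in> S" "z = actB g \<gamma> y" by auto
    then show "z \<in> prtB (rC g)" using mem[OF \<gamma>(1)] actB_part(1)[OF g, of \<gamma> y] by simp
  qed
  have "openin Y (?m ` S)"
  proof (subst openin_subopen, intro ballI)
    fix z assume "z \<in> ?m ` S"
    then obtain \<gamma> y where \<gamma>: "(\<gamma>, y) \<in> S" "z = actB g \<gamma> y" by auto
    note m = mem[OF \<gamma>(1)]
    obtain U0 V0 where 0: "openin (k_space (Co g)) U0" "openin (subtopology Y (prtB (sC g))) V0"
      "\<gamma> \<in> U0" "y \<in> V0" "\<forall>\<gamma>\<in>U0. \<forall>y\<in>V0. s g \<gamma> = rhoB y \<longrightarrow> (\<gamma>, y) \<in> S"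
      using S[unfolded openin_fibre_product] \<gamma>(1) by blast
    have V0: "openin Y V0" using 0(2) openin_prtB[OF src_objC[OF g]] openin_trans_full by blast
    obtain U where U: "U \<in> sl g" "\<gamma> \<in> U" "U \<subseteq> U0" using slice_exists[OF g 0(3,1)] by blast
    let ?t = "Theta g U"
    note t = Theta_carrier[OF g U(1)]
    let ?N = "tau.im ?t ` (V0 \<inter> dom (\<tau> ?t))"
    have "openin Y ?N" by (rule tau.open_im[OF t V0])
    moreover have "\<tau> ?t y = Some z" using tau_actB[OF g U(1,2)] m \<gamma>(2) by simp
    then have "z \<in> ?N" using 0(4) by force
    moreover have "?N \<subseteq> ?m ` S"
    proof
      fix w assume "w \<in> ?N"
      then obtain v where v: "v \<in> V0" "\<tau> ?t v = Some w" by auto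
      then obtain \<delta> where \<delta>: "\<delta> \<in> U" "s g \<delta> = rhoB v" "w = actB g \<delta> v"
        unfolding tau_Theta_iff[OF g U(1)] by blast
      then have "(\<delta>, v) \<in> S" using 0(5) U(3) v(1) by blast
      then show "w \<in> ?m ` S" using \<delta>(3) by force
    qed
    ultimately show "\<exists>N. openin Y N \<and> z \<in> N \<and> N \<subseteq> ?m ` S" by blast
  qed
  moreover have "?m ` S = prtB (rC g) \<inter> ?m ` S" using sub by blast
  ultimately show "openin (subtopology Y (prtB (rC g))) (?m ` S)"
    by (metis openin_subtopology_Int2)
qed

text \<open>If \<open>\<rho>(z) = \<gamma> \<cdot> v\<close> and \<open>\<gamma> \<in> U\<close>, then \<open>\<Theta>(U)\<^sup>\<star>\<close> is defined at \<open>\<rho>(z)\<close> and so at \<open>z\<close>.\<close>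

lemma actB_surj:
  assumes g: "g \<in> arrC"
  shows "(\<lambda>(\<gamma>, y). actB g \<gamma> y) ` topspace (DomB g) = topspace (subtopology Y (prtB (rC g)))"
    (is "?m ` _ = _")
proof (intro equalityI subsetI)
  fix z assume "z \<in> ?m ` topspace (DomB g)"
  then show "z \<in> topspace (subtopology Y (prtB (rC g)))"
    using actB_part(1)[OF g] topspace_prtB by (auto simp: sp_eq)
next
  fix z assume "z \<in> topspace (subtopology Y (prtB (rC g)))"
  then have z: "z \<in> topspace Y" "\<rho> z \<in> prt (rC g)" unfolding topspace_prtB part_iff by auto
  obtain \<gamma> v where v: "\<gamma> \<in> sp g" "v \<in> prt (sC g)" "s g \<gamma> = rho v" "\<rho> z = act g \<gamma> v"
    using act_surjD[OF g z(2)] by blast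
  obtain U where U: "U \<in> sl g" "\<gamma> \<in> U" using slice_exists_sp[OF g v(1)] by blast
  let ?t = "Theta g U"
  note t = Theta_carrier[OF g U(1)]
  have "theta ?t v = Some (\<rho> z)" unfolding theta_Theta_iff[OF g U(1)] using v U(2) by blast
  then have "theta (s_star IF ?t) (\<rho> z) = Some v" using act_star_iff[OF t] by blast
  then obtain y where "\<tau> (s_star IF ?t) z = Some y"
    using tau_dom[OF star_closed[OF t], of z] z(1) by blast
  then have "\<tau> ?t y = Some z" using tau.act_star_iff[OF t] by blast
  then obtain \<delta> where \<delta>: "\<delta> \<in> U" "y \<in> prtB (sC g)" "s g \<delta> = rhoB y" "z = actB g \<delta> y"
    unfolding tau_Theta_iff[OF g U(1)] by blast
  then have "(\<delta>, y) \<in> topspace (DomB g)"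
    using slice_sp[OF g U(1)] topspace_prtB[of "sC g"] by (simp add: sp_eq)
  then show "z \<in> ?m ` topspace (DomB g)" using \<delta>(4) by force
qed

lemma actB_actB:
  assumes gh: "g \<in> arrC" "h \<in> arrC" "sC g = rC h" and \<gamma>: "\<gamma> \<in> sp g" "\<eta> \<in> sp h"
    and y: "y \<in> prtB (sC h)" "s g \<gamma> = r h \<eta>" "s h \<eta> = rhoB y"
  shows "actB g \<gamma> (actB h \<eta> y) = actB (cC g h) (dot g h \<gamma> \<eta>) y"
proof -
  obtain U where U: "U \<in> sl g" "\<gamma> \<in> U" using slice_exists_sp[OF gh(1) \<gamma>(1)] by blast
  obtain V where V: "V \<in> sl h" "\<eta> \<in> V" using slice_exists_sp[OF gh(2) \<gamma>(2)] by blast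
  define UV where "UV = slice_prod g h U V"
  have UV: "UV \<in> sl (cC g h)" "dot g h \<gamma> \<eta> \<in> UV"
    unfolding UV_def using product_slice[OF gh U(1) V(1)] U(2) V(2) y(2) by auto
  have t: "Theta g U \<in> carr" "Theta h V \<in> carr"
    using Theta_carrier gh U V by auto
  have eq: "s_mult IF (Theta g U) (Theta h V) = Theta (cC g h) UV"
    unfolding UV_def by (rule Theta_mult[OF gh U(1) V(1)])
  have 1: "\<tau> (Theta h V) y = Some (actB h \<eta> y)" by (rule tau_actB[OF gh(2) V y(1,3)])
  have "\<tau> (Theta g U) (actB h \<eta> y) = Some (actB g \<gamma> (actB h \<eta> y))"
    using actB_part[OF gh(2) \<gamma>(2) y(1,3)] gh(3) y(2) by (intro tau_actB[OF gh(1) U]) simp_all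
  then have "\<tau> (Theta (cC g h) UV) y = Some (actB g \<gamma> (actB h \<eta> y))"
    using 1 unfolding eq[symmetric] tau.act_mult_iff[OF t] by blast
  moreover have "\<tau> (Theta (cC g h) UV) y = Some (actB (cC g h) (dot g h \<gamma> \<eta>) y)"
    using src_comp[OF gh] dot_sp(3)[OF gh \<gamma> y(2)] y
    by (intro tau_actB[OF comp_arr[OF gh] UV]) simp_all
  ultimately show ?thesis by simp
qed

text \<open>Condition (ii) in \<open>\<Omega>\<close> provides \<open>\<eta>\<close> with \<open>\<gamma>' = \<gamma> \<eta>\<close>.  Then
  \<open>\<gamma> \<cdot> y = \<gamma>' \<cdot> y' = \<gamma> \<cdot> (\<eta> \<cdot> y')\<close>, and a slice containing \<open>\<gamma>\<close> acts injectively.\<close>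

lemma actB_eqD:
  assumes g: "g \<in> arrC" and \<gamma>: "\<gamma> \<in> sp g" "\<gamma>' \<in> sp g" and y: "y \<in> prtB (sC g)" "y' \<in> prtB (sC g)"
    "s g \<gamma> = rhoB y" "s g \<gamma>' = rhoB y'" and eq: "actB g \<gamma> y = actB g \<gamma>' y'"
  shows "\<exists>\<eta>\<in>topspace (g_arr (Gr (sC g))). g_rng (Gr (sC g)) \<eta> = s g \<gamma> \<and>
    g_src (Gr (sC g)) \<eta> = rhoB y' \<and> \<gamma>' = k_ract (Co g) \<gamma> \<eta> \<and> y = actB (sC g) \<eta> y'"
proof -
  let ?x = "sC g"
  have x: "?x \<in> objC" "?x \<in> arrC" "sC ?x = ?x" "rC ?x = ?x"
    using src_objC[OF g] obj_arr src_obj rng_obj by auto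
  have w: "\<rho> y \<in> prt ?x" "\<rho> y' \<in> prt ?x" "s g \<gamma> = rho (\<rho> y)" "s g \<gamma>' = rho (\<rho> y')"
    using y part_iff rhoB_eq by auto
  have "act g \<gamma> (\<rho> y) = act g \<gamma>' (\<rho> y')"
    using anchor_actB(2)[OF g \<gamma>(1) y(1,3)] anchor_actB(2)[OF g \<gamma>(2) y(2,4)] eq by simp
  then obtain \<eta> where \<eta>: "\<eta> \<in> topspace (g_arr (Gr ?x))" "g_rng (Gr ?x) \<eta> = s g \<gamma>"
    "g_src (Gr ?x) \<eta> = rho (\<rho> y')" "\<gamma>' = k_ract (Co g) \<gamma> \<eta>" "\<rho> y = act ?x \<eta> (\<rho> y')"
    using act_eqD[OF g \<gamma> w] by blast
  have \<eta>x: "\<eta> \<in> sp ?x" "s ?x \<eta> = rhoB y'" "r ?x \<eta> = s g \<gamma>"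
    using Co_obj[OF x(1)] \<eta> w(4) y(4) by simp_all
  have v: "actB ?x \<eta> y' \<in> prtB ?x" "rhoB (actB ?x \<eta> y') = s g \<gamma>"
    using actB_part[OF x(2) \<eta>x(1)] y(2) \<eta>x x by simp_all
  have "actB g \<gamma> (actB ?x \<eta> y') = actB (cC g ?x) (dot g ?x \<gamma> \<eta>) y'"
    using \<eta>x x y(2) by (intro actB_actB[OF g x(2) _ \<gamma>(1) \<eta>x(1)]) simp_all
  also have "\<dots> = actB g \<gamma> y"
    using dot_obj[OF g \<gamma>(1) \<eta>(1)] \<eta>(2,4) comp_id[OF g] eq by simp
  finally have act: "actB g \<gamma> (actB ?x \<eta> y') = actB g \<gamma> y" .
  obtain U where U: "U \<in> sl g" "\<gamma> \<in> U" using slice_exists_sp[OF g \<gamma>(1)] by blast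
  have "\<tau> (Theta g U) y = Some (actB g \<gamma> y)" by (rule tau_actB[OF g U y(1,3)])
  moreover have "\<tau> (Theta g U) (actB ?x \<eta> y') = Some (actB g \<gamma> y)"
    using tau_actB[OF g U v(1)] v(2) act by simp
  ultimately have "y = actB ?x \<eta> y'" using tau.act_inj[OF Theta_carrier[OF g U(1)]] by blast
  then show ?thesis using \<eta> w(4) y(4) by auto
qed

lemma F_action_pullback: "F_action C F Y B"
proof -
  have Un: "(\<Union>x\<in>objC. prtB x) = topspace Y"
  proof (intro equalityI subsetI)
    fix y assume y: "y \<in> topspace Y"
    then have "\<rho> y \<in> topspace \<Omega>" using continuous_map_funspace[OF anchor_cont] by blast
    then show "y \<in> (\<Union>x\<in>objC. prtB x)" using part_exists y part_iff by blast
  qed (use part_iff in blast)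
  have dis: "disjoint_family_on prtB objC"
    unfolding disjoint_family_on_def using part_iff part_unique by blast
  have outside: "prtB x = {}" if "x \<notin> objC" for x
    using part_iff part_outside[OF that] by blast
  have ext: "rhoB \<in> extensional (topspace Y)" by (simp add: pullback_def)
  have undef: "actB g \<gamma> y = undefined"
    if "\<not> (g \<in> arrC \<and> \<gamma> \<in> sp g \<and> y \<in> prtB (sC g) \<and> s g \<gamma> = rhoB y)" for g \<gamma> y
  proof -
    have "\<not> (g \<in> arrC \<and> \<gamma> \<in> sp g \<and> y \<in> topspace Y \<and> \<rho> y \<in> prt (sC g) \<and> s g \<gamma> = rho (\<rho> y))"
      using that part_iff rhoB_eq by metis
    then show ?thesis unfolding pullback_def faction.select_convs by (simp only: if_False)
  qed
  show ?thesis
    unfolding F_action_def Let_def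
    by (intro conjI ballI impI allI Un dis openin_prtB closedin_prtB rhoB_cont actB_cont actB_open
        actB_surj actB_part(2) actB_actB actB_eqD outside ext undef)
qed

lemma F_equivariant_anchor: "F_equivariant C F Y B W \<rho>"
  unfolding F_equivariant_def using part_iff rhoB_eq anchor_actB(2) by auto

lemma induced_pullback:
  assumes "t \<in> carr"
  shows "induced_action C F B t = \<tau> t"
proof -
  interpret B: diagram_action C F Y B by unfold_locales (rule F_action_pullback)
  show ?thesis
    using assms
  proof (induction rule: IF_induct)
    case (Theta g U)
    show ?case
      by (rule map_eqI) (simp only: B.theta_Theta_iff[OF Theta] tau_Theta_iff[OF Theta])
  next
    case (mult t u)
    then show ?case by (simp add: B.act_mult tau.act_mult)
  next
    case (star t)
    then show ?case by (simp add: B.act_star tau.act_star)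
  qed
qed

end

lemma (in diagram) pullback_induced:
  assumes A: "F_action C F Y A" and W: "F_action C F \<Omega> W"
    and cont: "continuous_map Y \<Omega> \<rho>" and equi: "F_equivariant C F Y A W \<rho>"
  shows "pullback W Y \<rho> (induced_action C F A) = A"
proof -
  interpret A: diagram_action C F Y A by unfold_locales (rule A)
  interpret P: diagram_action_over C F \<Omega> W Y \<rho> "induced_action C F A"
    by (intro diagram_action_over.intro diagram_action_over_axioms.intro
        diagram_action.intro diagram_action_axioms.intro F_equivariant_action_over A W cont equi)
      (rule diagram_axioms)
  interpret B: diagram_action C F Y P.B by unfold_locales (rule P.F_action_pullback)
  have sub: "y \<in> P.prtB x" if "y \<in> A.prt x" for x y
    using equi that A.part_top[OF that] A.part_outside[of x] P.part_iff[of y x]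
    unfolding F_equivariant_def by (cases "x \<in> objC") auto
  have part: "y \<in> P.prtB x \<longleftrightarrow> y \<in> A.prt x" for x y
    using sub A.part_exists[OF B.part_top, of y x] B.part_unique by blast
  have rho: "P.rhoB y = A.rho y" for y
  proof (cases "y \<in> topspace Y")
    case True
    then show ?thesis using equi P.rhoB_eq unfolding F_equivariant_def by simp
  next
    case False
    then show ?thesis using A.rho_ext B.rho_ext by (simp add: extensional_def)
  qed
  have act: "P.actB g \<gamma> y = A.act g \<gamma> y" for g \<gamma> y
  proof (cases "g \<in> arrC \<and> \<gamma> \<in> sp g \<and> y \<in> A.prt (sC g) \<and> s g \<gamma> = A.rho y")
    case True
    then have g: "g \<in> arrC" and \<gamma>: "\<gamma> \<in> sp g" "y \<in> A.prt (sC g)" "s g \<gamma> = A.rho y" by auto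
    obtain U where U: "U \<in> sl g" "\<gamma> \<in> U" using slice_exists_sp[OF g \<gamma>(1)] by blast
    have "A.theta (Theta g U) y = Some (P.actB g \<gamma> y)"
      using P.tau_actB[OF g U] part rho \<gamma> by simp
    moreover have "A.theta (Theta g U) y = Some (A.act g \<gamma> y)"
      unfolding A.theta_Theta_iff[OF g U(1)] using U(2) \<gamma> by blast
    ultimately show ?thesis by simp
  next
    case False
    then show ?thesis using A.act_undefined B.act_undefined part rho by simp
  qed
  have "P.prtB = A.prt" "P.rhoB = A.rho" "P.actB = A.act" using part rho act by blast+
  then show ?thesis by (rule faction.equality) simp
qed

section \<open>The groupoid model\<close>

locale universal_diagram_action = diagram_action C F \<Omega> W
  for C :: "'c category" and F :: "('c, 'o, 'a) diagram"
    and \<Omega> :: "'w topology" and W :: "('c, 'o, 'a, 'w) faction" +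
  fixes ty :: "'y itself"
  assumes universal: "universal_F_action ty C F \<Omega> W"
begin

lemma anchor_exists:
  fixes Y :: "'y topology"
  assumes "F_action C F Y A"
  shows "\<exists>\<phi>. \<phi> \<in> extensional (topspace Y) \<and> continuous_map Y \<Omega> \<phi> \<and> F_equivariant C F Y A W \<phi>"
  using universal assms unfolding universal_F_action_def by blast

lemma anchor_unique:
  fixes Y :: "'y topology"
  assumes "F_action C F Y A"
    and "\<phi> \<in> extensional (topspace Y)" "continuous_map Y \<Omega> \<phi>" "F_equivariant C F Y A W \<phi>"
    and "\<psi> \<in> extensional (topspace Y)" "continuous_map Y \<Omega> \<psi>" "F_equivariant C F Y A W \<psi>"
  shows "\<phi> = \<psi>"
  using universal assms unfolding universal_F_action_def by blast

definition to_diagram_action ::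
  "'y topology \<Rightarrow> ('w, (('c \<times> 'a) set isg_term set \<times> 'w) set, 'y) gaction \<Rightarrow> ('c, 'o, 'a, 'y) faction" where
  "to_diagram_action Y A = pullback W Y (l_rng A) (action_hom Y A)"

text \<open>The unique equivariant map to the universal action.\<close>

definition anchor :: "'y topology \<Rightarrow> ('c, 'o, 'a, 'y) faction \<Rightarrow> 'y \<Rightarrow> 'w" where
  "anchor Y B = (SOME \<phi>. \<phi> \<in> extensional (topspace Y) \<and> continuous_map Y \<Omega> \<phi> \<and> F_equivariant C F Y B W \<phi>)"

definition to_groupoid_action ::
  "'y topology \<Rightarrow> ('c, 'o, 'a, 'y) faction \<Rightarrow> ('w, (('c \<times> 'a) set isg_term set \<times> 'w) set, 'y) gaction" where
  "to_groupoid_action Y B = over_action Y (anchor Y B) (induced_action C F B)"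

lemma anchor:
  assumes "F_action C F Y B"
  shows "anchor Y B \<in> extensional (topspace Y)" "continuous_map Y \<Omega> (anchor Y B)"
    "F_equivariant C F Y B W (anchor Y B)"
  using someI_ex[OF anchor_exists[OF assms]] unfolding anchor_def by blast+

lemma diagram_action_over_groupoid_action:
  assumes "groupoid_action T Y A"
  shows "diagram_action_over C F \<Omega> W Y (l_rng A) (action_hom Y A)"
  using action_over_action_hom[OF assms] by unfold_locales

lemma to_diagram_action:
  assumes A: "groupoid_action T Y A"
  shows "F_action C F Y (to_diagram_action Y A)"
    "F_equivariant C F Y (to_diagram_action Y A) W (l_rng A)"
    "\<And>t. t \<in> carr \<Longrightarrow>
       induced_action C F (to_diagram_action Y A) t = action_hom Y A t"
    "l_rng A \<in> extensional (topspace Y)" "continuous_map Y \<Omega> (l_rng A)"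
proof -
  interpret diagram_action_over C F \<Omega> W Y "l_rng A" "action_hom Y A"
    by (rule diagram_action_over_groupoid_action[OF A])
  show "F_action C F Y (to_diagram_action Y A)"
    unfolding to_diagram_action_def by (rule F_action_pullback)
  show "F_equivariant C F Y (to_diagram_action Y A) W (l_rng A)"
    unfolding to_diagram_action_def by (rule F_equivariant_anchor)
  show "induced_action C F (to_diagram_action Y A) t = action_hom Y A t"
    if "t \<in> carr" for t
    unfolding to_diagram_action_def by (rule induced_pullback[OF that])
  show "l_rng A \<in> extensional (topspace Y)" using A unfolding groupoid_action_def by blast
  show "continuous_map Y \<Omega> (l_rng A)" by (rule anchor_cont)
qed

lemma to_groupoid_action:
  assumes B: "F_action C F Y B"
  shows "groupoid_action T Y (to_groupoid_action Y B)"
    "to_diagram_action Y (to_groupoid_action Y B) = B"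
proof -
  note a = anchor[OF B]
  have over: "action_over IF \<Omega> (induced_action C F W) Y (anchor Y B) (induced_action C F B)"
    by (rule F_equivariant_action_over[OF B F_action a(2,3)])
  show "groupoid_action T Y (to_groupoid_action Y B)"
    unfolding to_groupoid_action_def by (rule groupoid_action_over_action[OF over a(1)])
  have "l_rng (to_groupoid_action Y B) = anchor Y B"
    by (simp add: to_groupoid_action_def over_action_def)
  then have "to_diagram_action Y (to_groupoid_action Y B) =
      pullback W Y (anchor Y B) (action_hom Y (to_groupoid_action Y B))"
    by (simp add: to_diagram_action_def)
  also have "\<dots> = pullback W Y (anchor Y B) (induced_action C F B)"
    by (rule pullback_cong) (simp add: to_groupoid_action_def action_hom_over_action[OF over])
  also have "\<dots> = B" by (rule pullback_induced[OF B F_action a(2,3)])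
  finally show "to_diagram_action Y (to_groupoid_action Y B) = B" .
qed

lemma to_groupoid_action_inverse:
  assumes A: "groupoid_action T Y A"
  shows "to_groupoid_action Y (to_diagram_action Y A) = A"
proof -
  note d = to_diagram_action[OF A]
  have "anchor Y (to_diagram_action Y A) = l_rng A"
    by (rule anchor_unique[OF d(1) anchor[OF d(1)] d(4,5,2)])
  then have "to_groupoid_action Y (to_diagram_action Y A) =
      over_action Y (l_rng A) (induced_action C F (to_diagram_action Y A))"
    by (simp add: to_groupoid_action_def)
  also have "\<dots> = over_action Y (l_rng A) (action_hom Y A)"
    by (rule over_action_cong) (rule d(3))
  also have "\<dots> = A" by (rule over_action_action_hom[OF A])
  finally show ?thesis .
qed

lemma bij_betw_to_diagram_action:
  "bij_betw (to_diagram_action Y) {A. groupoid_action T Y A} {B. F_action C F Y B}"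
  by (rule bij_betw_byWitness[where f' = "to_groupoid_action Y"])
    (auto simp: to_groupoid_action to_groupoid_action_inverse to_diagram_action(1))

text \<open>Both notions of equivariance say that \<open>\<phi>\<close> intertwines the induced actions of \<open>\<I>(F)\<close>, but the
  one for the groupoid also demands that \<open>\<phi>\<close> be compatible with the anchor maps to \<open>\<Omega>\<close>.  Universality
  supplies this.\<close>

lemma equivariant_iff:
  assumes A: "groupoid_action T Y A" and A': "groupoid_action T Y' A'"
    and cont: "continuous_map Y Y' \<phi>"
  shows "groupoid_equivariant T Y A A' \<phi> \<longleftrightarrow>
    F_equivariant C F Y (to_diagram_action Y A) (to_diagram_action Y' A') \<phi>"
proof -
  note d = to_diagram_action[OF A] and d' = to_diagram_action[OF A']
  let ?B = "to_diagram_action Y A" and ?B' = "to_diagram_action Y' A'"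
  interpret B: diagram_action C F Y ?B by unfold_locales (rule d(1))
  interpret B': diagram_action C F Y' ?B' by unfold_locales (rule d'(1))
  interpret P: diagram_action_over C F \<Omega> W Y "l_rng A" "action_hom Y A"
    by (rule diagram_action_over_groupoid_action[OF A])
  interpret P': diagram_action_over C F \<Omega> W Y' "l_rng A'" "action_hom Y' A'"
    by (rule diagram_action_over_groupoid_action[OF A'])
  have B: "P.B = ?B" "P'.B = ?B'" by (simp_all add: to_diagram_action_def)
  have top: "\<phi> y \<in> topspace Y'" if "y \<in> topspace Y" for y
    using continuous_map_funspace[OF cont] that by blast
  have img: "\<phi> ` topspace Y \<subseteq> topspace Y'" using top by blast
  note iff = groupoid_equivariant_iff[OF img, of A A']
  show ?thesis
  proof
    assume "groupoid_equivariant T Y A A' \<phi>"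
    then have rng: "\<And>y. y \<in> topspace Y \<Longrightarrow> l_rng A' (\<phi> y) = l_rng A y"
      and hom: "\<And>t y z. t \<in> carr \<Longrightarrow> action_hom Y A t y = Some z \<Longrightarrow>
        action_hom Y' A' t (\<phi> y) = Some (\<phi> z)"
      unfolding iff by blast+
    have part: "\<phi> y \<in> B'.prt x" if "y \<in> B.prt x" for x y
      using that rng top P.part_iff P'.part_iff unfolding B by auto
    have rho: "B'.rho (\<phi> y) = B.rho y" if "y \<in> topspace Y" for y
      using that rng top P.rhoB_eq P'.rhoB_eq unfolding B by simp
    have act: "\<phi> (B.act g \<gamma> y) = B'.act g \<gamma> (\<phi> y)"
      if g: "g \<in> arrC" and \<gamma>: "\<gamma> \<in> sp g" "y \<in> B.prt (sC g)" "s g \<gamma> = B.rho y"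
      for g \<gamma> y
    proof -
      obtain U where U: "U \<in> sl g" "\<gamma> \<in> U"
        using slice_exists_sp[OF g \<gamma>(1)] by blast
      note t = Theta_carrier[OF g U(1)]
      have y: "y \<in> topspace Y" using \<gamma>(2) by (rule B.part_top)
      have "action_hom Y A (Theta g U) y = Some (B.act g \<gamma> y)"
        using P.tau_actB[OF g U] \<gamma> unfolding B by blast
      then have "action_hom Y' A' (Theta g U) (\<phi> y) = Some (\<phi> (B.act g \<gamma> y))" by (rule hom[OF t])
      moreover have "action_hom Y' A' (Theta g U) (\<phi> y) = Some (B'.act g \<gamma> (\<phi> y))"
        using P'.tau_actB[OF g U, of "\<phi> y"] part[OF \<gamma>(2)] rho[OF y] \<gamma>(3) unfolding B by simp
      ultimately show ?thesis by simp
    qed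
    show "F_equivariant C F Y ?B ?B' \<phi>"
      unfolding F_equivariant_def using part rho act by blast
  next
    assume equi: "F_equivariant C F Y ?B ?B' \<phi>"
    have over: "action_over IF Y' (induced_action C F ?B') Y \<phi> (induced_action C F ?B)"
      by (rule F_equivariant_action_over[OF d(1) d'(1) cont equi])
    have hom: "action_hom Y' A' t (\<phi> y) = Some (\<phi> z)"
      if t: "t \<in> carr" and "action_hom Y A t y = Some z" for t y z
    proof -
      have "induced_action C F ?B t y = Some z" using that(2) d(3)[OF t] by simp
      then have "induced_action C F ?B' t (\<phi> y) = Some (\<phi> z)"
        using over t unfolding action_over_def by blast
      then show ?thesis using d'(3)[OF t] by simp
    qed
    \<comment> \<open>The composite of \<open>\<phi>\<close> with the anchor map of \<open>Y'\<close> is a second equivariant map to \<open>\<Omega>\<close>.\<close>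
    let ?\<psi> = "restrict (\<lambda>y. l_rng A' (\<phi> y)) (topspace Y)"
    have "continuous_map Y \<Omega> (l_rng A' \<circ> \<phi>)" using cont d'(5) by (rule continuous_map_compose)
    then have cont\<psi>: "continuous_map Y \<Omega> ?\<psi>" by (rule continuous_map_eq) simp
    have "F_equivariant C F Y ?B W ?\<psi>"
      unfolding F_equivariant_def
    proof (intro conjI ballI impI)
      fix x assume x: "x \<in> objC"
      have "l_rng A' (\<phi> y) \<in> prt x" if "y \<in> B.prt x" for y
        using equi d'(2) x that unfolding F_equivariant_def by blast
      then show "?\<psi> ` B.prt x \<subseteq> prt x" using B.part_top by auto
    next
      fix y assume "y \<in> topspace Y"
      then show "rho (?\<psi> y) = B.rho y"
        using equi d'(2) top unfolding F_equivariant_def by simp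
    next
      fix g \<gamma> y assume g: "g \<in> arrC" and \<gamma>: "\<gamma> \<in> sp g" "y \<in> B.prt (sC g)"
        "s g \<gamma> = B.rho y"
      have y: "y \<in> topspace Y" using \<gamma>(2) by (rule B.part_top)
      have a: "B.act g \<gamma> y \<in> topspace Y" using B.act_part[OF g \<gamma>] by (rule B.part_top)
      have x: "sC g \<in> objC" by (rule src_objC[OF g])
      have 1: "\<phi> (B.act g \<gamma> y) = B'.act g \<gamma> (\<phi> y)" "\<phi> y \<in> B'.prt (sC g)" "B'.rho (\<phi> y) = B.rho y"
        using equi g \<gamma> y x unfolding F_equivariant_def by blast+
      have "l_rng A' (B'.act g \<gamma> (\<phi> y)) = act g \<gamma> (l_rng A' (\<phi> y))"
        using d'(2) g \<gamma> 1(2,3) unfolding F_equivariant_def by simp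
      then show "?\<psi> (B.act g \<gamma> y) = act g \<gamma> (?\<psi> y)" using a y 1(1) by simp
    qed
    then have "?\<psi> = l_rng A"
      using anchor_unique[OF d(1) _ cont\<psi> _ d(4,5,2)] by simp
    then have "l_rng A' (\<phi> y) = l_rng A y" if "y \<in> topspace Y" for y
      using that by (metis restrict_apply)
    then show "groupoid_equivariant T Y A A' \<phi>" unfolding iff using hom by blast
  qed
qed

lemma groupoid_model: "groupoid_model ty C F T"
  unfolding groupoid_model_def
proof (intro conjI exI[of _ to_diagram_action] allI impI)
  show "etale_groupoid T" by (rule etale_T)
qed (fact bij_betw_to_diagram_action, rule equivariant_iff)

end

theorem proposition5p12:
  fixes C :: "'c category"
    and F :: "('c, 'o, 'a) diagram"
    and \<Omega> :: "'w topology"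
    and W :: "('c, 'o, 'a, 'w) faction"
  assumes "small_category C"
    and "corr_diagram C F"
    and "universal_F_action TYPE('y) C F \<Omega> W"
  shows "groupoid_model TYPE('y) C F
           (transformation_groupoid (diagram_isg C F) \<Omega> (induced_action C F W))"
proof -
  have "F_action C F \<Omega> W" using assms(3) unfolding universal_F_action_def by blast
  then interpret universal_diagram_action C F \<Omega> W "TYPE('y)"
    using assms by unfold_locales
  show ?thesis by (rule groupoid_model)
qed

end
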